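(* Let $n\in\mathbb{Z}_{>0}$ and let $\mu,\lambda\in\mathbb{Z}^n$ with $\lambda_1\ge\cdots\ge\lambda_n$. Then $$E_\mu(1,t,t^2,\ldots,t^{n-1};q,t)=t^{\frac{(n-1)}2|\mu|}\,t^{-\frac12\ell(v_\mu^{-1})}\,\mathrm{ev}^t_0\big(c^{Y^{-1}}_{u_\mu}\big),$$ $$P_\lambda(1,t,t^2,\ldots,t^{n-1};q,t)=t^{\frac{(n-1)}2|\lambda|}\,\mathrm{ev}^{t^{-1}}_0\big(c^{Y^{-1}}_{t_\lambda}\big),$$ and $$A_{\lambda+\rho}(1,t,t^2,\ldots,t^{n-1};q,t)=0 .$$
   Context: Let $q,t^{1/2}$ be independent indeterminates over $\mathbb{C}$, $t=(t^{1/2})^2$, $K=\mathbb{C}(q,t^{1/2})$, $K[X]=K[x_1^{\pm1},\ldots,x_n^{\pm1}]$. $S_n$ acts on $K[X]$ by permuting variables and on $\mathbb{Z}^n$ by $(w\mu)_{w(i)}=\mu_i$; $s_i=(i,i+1)$; $\ell$ is the length. Put $x^\mu=x_1^{\mu_1}\cdots x_n^{\mu_n}$, $|\mu|=\mu_1+\cdots+\mu_n$, $\rho=(n-1,n-2,\ldots,1,0)$, $\partial_if=\frac{f-s_if}{x_i-x_{i+1}}$. For $\mu\in\mathbb{Z}^n$, $v_\mu\in S_n$ is the minimal length permutation such that $v_\mu\mu$ is weakly increasing; explicitly $v_\mu(r)=1+\#\{r'<r:\mu_{r'}\le\mu_r\}+\#\{r'>r:\mu_{r'}<\mu_r\}$.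 The electronic (nonsymmetric) Macdonald polynomials $E_\mu=E_\mu(x_1,\ldots,x_n;q,t)\in K[X]$, $\mu\in\mathbb{Z}^n$, are determined by: (E0) $E_{(0,\ldots,0)}=1$; (E1) $E_{(\mu_n+1,\mu_1,\ldots,\mu_{n-1})}=q^{\mu_n}x_1E_\mu(x_2,\ldots,x_n,q^{-1}x_1)$; (E2) if $\mu\in\mathbb{Z}_{\ge0}^n$ and $\mu_i>\mu_{i+1}$ then $E_{s_i\mu}=\partial_i(x_iE_\mu)-tx_i\partial_iE_\mu+\frac{(1-t)a}{1-a}E_\mu$ with $a=q^{\mu_i-\mu_{i+1}}t^{v_\mu(i)-v_\mu(i+1)}$; (E3) $E_{(\mu_1-1,\ldots,\mu_n-1)}=x_1^{-1}\cdots x_n^{-1}E_\mu$. For weakly decreasing $\lambda$: $P_\lambda=\frac1{W_\lambda(t)}\sum_{w\in S_n}w\big(E_\lambda\prod_{i<j}\frac{x_i-tx_j}{x_i-x_j}\big)$, where $W_\lambda(t)$ is the constant making the coefficient of $x^\lambda$ in $P_\lambda$ equal to $1$; and $A_{\lambda+\rho}=\big(\prod_{i<j}\frac{x_j-tx_i}{x_i-x_j}\big)\sum_{w\in S_n}(-1)^{\ell(w)}wE_{\lambda+\rho}$. An $n$-periodic permutation is a bijection $w:\mathbb{Z}\to\mathbb{Z}$ with $w(i+n)=w(i)+n$ for all $i$. Its inversion set is $\mathrm{Inv}(w)=\{(i,k): i\in\{1,\ldots,n\},\ k\in\mathbb{Z},\ i<k,\ w(i)>w(k)\}$. For $\mu\in\mathbb{Z}^n$,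 $t_\mu$ is the $n$-periodic permutation with $t_\mu(i)=i+n\mu_i$ for $i\in\{1,\ldots,n\}$, and $u_\mu=t_\mu v_\mu^{-1}$ (with $v_\mu$ extended $n$-periodically). For commuting variables $Y_1,\ldots,Y_n$, $i,j\in\{1,\ldots,n\}$ and $m\in\mathbb{Z}$ define $$c^{Y^{-1}}_{(i,j+mn)}=t^{-\frac12}\frac{1-q^mtY_i^{-1}Y_j}{1-q^mY_i^{-1}Y_j},\qquad c^{Y^{-1}}_w=\prod_{(i,k)\in\mathrm{Inv}(w)}c^{Y^{-1}}_{(i,k)} .$$ The evaluations are the homomorphisms with $\mathrm{ev}^t_0(Y_i)=t^{-(i-1)+\frac12(n-1)}$ and $\mathrm{ev}^{t^{-1}}_0(Y_i)=t^{(i-1)-\frac12(n-1)}$ for $i\in\{1,\ldots,n\}$ (they act only on the $Y_i$, fixing $q$ and $t$).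
   Formalization: The third claim, A_{λ+ρ}(1,t,…,t^{n-1};q,t)=0, is stated only for n≥2, since for n=1 one has A_{(m)}=E_{(m)}=x_1^m, whose value at x_1=1 is 1, not 0. *)

theory Defs
  imports
    Complex_Main
    "HOL-Library.Poly_Mapping"
    "HOL-Combinatorics.Permutations"
    "HOL-Computational_Algebra.Polynomial_Factorial"
begin

text \<open>
  The coefficient field \<open>\<complex>(q, t\<^sup>1\<^sup>/\<^sup>2)\<close> is the fraction field of \<open>\<complex>[q][t\<^sup>1\<^sup>/\<^sup>2]\<close>.
\<close>

type_synonym K = "complex poly poly fract"

definition qK :: K where
  "qK = to_fract [:[:0, 1:]:]"

definition thalf :: K where
  "thalf = to_fract [:0, 1:]"

definition tK :: K where
  "tK = thalf ^ 2"

text \<open>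
  Elements of \<open>\<int>\<^sup>n\<close> are finitely supported functions \<open>nat \<Rightarrow>\<^sub>0 int\<close> with support in \<open>{1..n}\<close>.
  Laurent polynomials are finitely supported functions from exponent vectors to \<open>K\<close>; the type
  allows countably many variables, and only those with index in \<open>{1..n}\<close> are used.
  All computations take place in the fraction field \<open>ratfun\<close>.
\<close>

type_synonym laurent = "(nat \<Rightarrow>\<^sub>0 int) \<Rightarrow>\<^sub>0 K"

type_synonym ratfun = "laurent fract"

definition Zn :: "nat \<Rightarrow> (nat \<Rightarrow>\<^sub>0 int) set" where
  "Zn n = {\<mu>. Poly_Mapping.keys \<mu> \<subseteq> {1..n}}"

definition zvec :: "nat \<Rightarrow> (nat \<Rightarrow> int) \<Rightarrow> (nat \<Rightarrow>\<^sub>0 int)" where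
  "zvec n f = (\<Sum>i\<in>{1..n}. Poly_Mapping.single i (f i))"

definition wt_sum :: "nat \<Rightarrow> (nat \<Rightarrow>\<^sub>0 int) \<Rightarrow> int" where
  "wt_sum n \<mu> = (\<Sum>i\<in>{1..n}. Poly_Mapping.lookup \<mu> i)"

definition scal :: "K \<Rightarrow> ratfun" where
  "scal c = to_fract (Poly_Mapping.single 0 c)"

definition xvar :: "nat \<Rightarrow> ratfun" where
  "xvar i = to_fract (Poly_Mapping.single (Poly_Mapping.single i 1) 1)"

definition laurent_polys :: "nat \<Rightarrow> ratfun set" where
  "laurent_polys n = {to_fract p | p. Poly_Mapping.keys p \<subseteq> Zn n}"

text \<open>
  Substitution of \<open>x i\<close> for the \<open>i\<close>-th variable, with \<open>\<phi>\<close> embedding the coefficients in the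
  target field, first for Laurent polynomials and then for rational functions. The value of the
  latter is unspecified unless the rational function has some representation whose denominator
  does not vanish under the substitution; the \<open>x i\<close> should be nonzero.
\<close>

definition leval :: "(K \<Rightarrow> 'b::field) \<Rightarrow> (nat \<Rightarrow> 'b) \<Rightarrow> laurent \<Rightarrow> 'b" where
  "leval \<phi> x f =
    (\<Sum>\<mu>\<in>Poly_Mapping.keys f. \<phi> (Poly_Mapping.lookup f \<mu>) *
      (\<Prod>i\<in>Poly_Mapping.keys \<mu>. x i powi Poly_Mapping.lookup \<mu> i))"

definition feval :: "(K \<Rightarrow> 'b::field) \<Rightarrow> (nat \<Rightarrow> 'b) \<Rightarrow> ratfun \<Rightarrow> 'b" where
  "feval \<phi> x r =
    (THE c. \<exists>a b. leval \<phi> x b \<noteq> 0 \<and> r = Fraction_Field.Fract a b \<and> c = leval \<phi> x a / leval \<phi> x b)"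

definition rsubst :: "(nat \<Rightarrow> ratfun) \<Rightarrow> ratfun \<Rightarrow> ratfun" where
  "rsubst x r = feval scal x r"

definition eval_at :: "(nat \<Rightarrow> K) \<Rightarrow> ratfun \<Rightarrow> K" where
  "eval_at x r = feval (\<lambda>c. c) x r"

definition act :: "(nat \<Rightarrow> nat) \<Rightarrow> ratfun \<Rightarrow> ratfun" where
  "act w f = rsubst (\<lambda>i. xvar (w i)) f"

text \<open>The action on \<open>\<int>\<^sup>n\<close> is \<open>(w \<mu>)\<^bsub>w(i)\<^esub> = \<mu>\<^sub>i\<close>, so that \<open>w\<close> maps \<open>x\<^sup>\<mu>\<close> to \<open>x\<^bsup>w\<mu>\<^esup>\<close>.\<close>

definition vact :: "nat \<Rightarrow> (nat \<Rightarrow> nat) \<Rightarrow> (nat \<Rightarrow>\<^sub>0 int) \<Rightarrow> (nat \<Rightarrow>\<^sub>0 int)" where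
  "vact n w \<mu> = zvec n (\<lambda>j. Poly_Mapping.lookup \<mu> (inv w j))"

abbreviation sref :: "nat \<Rightarrow> nat \<Rightarrow> nat" where
  "sref i \<equiv> Transposition.transpose i (i + 1)"

definition ddiff :: "nat \<Rightarrow> ratfun \<Rightarrow> ratfun" where
  "ddiff i f = (f - act (sref i) f) / (xvar i - xvar (i + 1))"

text \<open>
  \<open>periodic_ext n f\<close> is the function \<open>w\<close> with \<open>w i = f i\<close> for \<open>i \<in> {1..n}\<close> and
  \<open>w (i + n) = w i + n\<close>. An integer \<open>k\<close> is written as \<open>k = res_ix n k + n * quot_ix n k\<close> with
  residue in \<open>{1..n}\<close>.
\<close>

definition res_ix :: "nat \<Rightarrow> int \<Rightarrow> nat" where
  "res_ix n k = nat ((k - 1) mod int n) + 1"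

definition quot_ix :: "nat \<Rightarrow> int \<Rightarrow> int" where
  "quot_ix n k = (k - 1) div int n"

definition periodic_ext :: "nat \<Rightarrow> (nat \<Rightarrow> int) \<Rightarrow> int \<Rightarrow> int" where
  "periodic_ext n f k = f (res_ix n k) + int n * quot_ix n k"

abbreviation ext_perm :: "nat \<Rightarrow> (nat \<Rightarrow> nat) \<Rightarrow> int \<Rightarrow> int" where
  "ext_perm n w \<equiv> periodic_ext n (\<lambda>i. int (w i))"

definition Inv :: "nat \<Rightarrow> (int \<Rightarrow> int) \<Rightarrow> (int \<times> int) set" where
  "Inv n w = {(i, k). i \<in> {1..int n} \<and> i < k \<and> w i > w k}"

text \<open>
  The length of \<open>w \<in> S\<^sub>n\<close> is its number of inversions; for the periodic extension of \<open>w\<close> all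
  inversions \<open>(i, k)\<close> have \<open>k \<le> n\<close>.
\<close>

definition len :: "nat \<Rightarrow> (nat \<Rightarrow> nat) \<Rightarrow> nat" where
  "len n w = card (Inv n (ext_perm n w))"

text \<open>
  \<open>vperm n \<mu>\<close> is the permutation \<open>v\<^sub>\<mu>\<close> of minimal length such that \<open>v\<^sub>\<mu> \<mu>\<close> is weakly increasing,
  given by its closed formula.
\<close>

definition vperm :: "nat \<Rightarrow> (nat \<Rightarrow>\<^sub>0 int) \<Rightarrow> nat \<Rightarrow> nat" where
  "vperm n \<mu> r =
    (if r \<in> {1..n} then
       1 + card {r' \<in> {1..n}. r' < r \<and> Poly_Mapping.lookup \<mu> r' \<le> Poly_Mapping.lookup \<mu> r}
         + card {r' \<in> {1..n}. r' > r \<and> Poly_Mapping.lookup \<mu> r' < Poly_Mapping.lookup \<mu> r}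
     else r)"

definition transl :: "nat \<Rightarrow> (nat \<Rightarrow>\<^sub>0 int) \<Rightarrow> int \<Rightarrow> int" where
  "transl n \<mu> = periodic_ext n (\<lambda>i. int i + int n * Poly_Mapping.lookup \<mu> i)"

definition uperm :: "nat \<Rightarrow> (nat \<Rightarrow>\<^sub>0 int) \<Rightarrow> int \<Rightarrow> int" where
  "uperm n \<mu> = transl n \<mu> \<circ> inv (ext_perm n (vperm n \<mu>))"

text \<open>
  \<open>macdonald_E n E\<close> says that the family \<open>E\<close> of Laurent polynomials satisfies the relations that
  determine the electronic Macdonald polynomials in \<open>n\<close> variables; a unique such family exists on
  \<open>Zn n\<close>, and the values of \<open>E\<close> outside \<open>Zn n\<close> are unconstrained. The substitution in the second
  relation is \<open>f(x\<^sub>1, \<dots>, x\<^sub>n) \<mapsto> f(x\<^sub>2, \<dots>, x\<^sub>n, q\<^sup>-\<^sup>1x\<^sub>1)\<close>.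
\<close>

definition macdonald_E :: "nat \<Rightarrow> ((nat \<Rightarrow>\<^sub>0 int) \<Rightarrow> ratfun) \<Rightarrow> bool" where
  "macdonald_E n E \<longleftrightarrow>
    (\<forall>\<mu>\<in>Zn n. E \<mu> \<in> laurent_polys n) \<and>
    E 0 = 1 \<and>
    (\<forall>\<mu>\<in>Zn n.
      E (zvec n (\<lambda>i. if i = 1 then Poly_Mapping.lookup \<mu> n + 1 else Poly_Mapping.lookup \<mu> (i - 1))) =
        scal (qK powi Poly_Mapping.lookup \<mu> n) * xvar 1 *
        rsubst (\<lambda>i. if i \<in> {1..<n} then xvar (i + 1) else if i = n then scal (inverse qK) * xvar 1 else xvar i)
          (E \<mu>)) \<and>
    (\<forall>\<mu>\<in>Zn n. \<forall>i\<in>{1..<n}.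
      (\<forall>j\<in>{1..n}. Poly_Mapping.lookup \<mu> j \<ge> 0) \<and>
      Poly_Mapping.lookup \<mu> i > Poly_Mapping.lookup \<mu> (i + 1) \<longrightarrow>
      (let a = qK powi (Poly_Mapping.lookup \<mu> i - Poly_Mapping.lookup \<mu> (i + 1)) *
               tK powi (int (vperm n \<mu> i) - int (vperm n \<mu> (i + 1)))
       in E (vact n (sref i) \<mu>) =
            ddiff i (xvar i * E \<mu>) - scal tK * xvar i * ddiff i (E \<mu>) + scal ((1 - tK) * a / (1 - a)) * E \<mu>)) \<and>
    (\<forall>\<mu>\<in>Zn n.
      E (zvec n (\<lambda>i. Poly_Mapping.lookup \<mu> i - 1)) = (\<Prod>i\<in>{1..n}. inverse (xvar i)) * E \<mu>)"

definition pairs :: "nat \<Rightarrow> (nat \<times> nat) set" where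
  "pairs n = {(i, j). 1 \<le> i \<and> i < j \<and> j \<le> n}"

definition rho :: "nat \<Rightarrow> (nat \<Rightarrow>\<^sub>0 int)" where
  "rho n = zvec n (\<lambda>i. int n - int i)"

definition P_sum :: "nat \<Rightarrow> ((nat \<Rightarrow>\<^sub>0 int) \<Rightarrow> ratfun) \<Rightarrow> (nat \<Rightarrow>\<^sub>0 int) \<Rightarrow> ratfun" where
  "P_sum n E lam =
    (\<Sum>w | w permutes {1..n}.
      act w (E lam * (\<Prod>(i, j)\<in>pairs n. (xvar i - scal tK * xvar j) / (xvar i - xvar j))))"

text \<open>
  \<open>W_const\<close> is the normalising constant \<open>W\<^bsub>lam\<^esub>(t)\<close>: the rational function \<open>P_sum / c\<close> is a Laurent
  polynomial whose coefficient at \<open>x\<^bsup>lam\<^esup>\<close> is \<open>1\<close>.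
\<close>

definition W_const :: "nat \<Rightarrow> ((nat \<Rightarrow>\<^sub>0 int) \<Rightarrow> ratfun) \<Rightarrow> (nat \<Rightarrow>\<^sub>0 int) \<Rightarrow> K" where
  "W_const n E lam =
    (THE c. \<exists>p. scal (1 / c) * P_sum n E lam = to_fract p \<and> Poly_Mapping.lookup p lam = 1)"

definition macdonald_P :: "nat \<Rightarrow> ((nat \<Rightarrow>\<^sub>0 int) \<Rightarrow> ratfun) \<Rightarrow> (nat \<Rightarrow>\<^sub>0 int) \<Rightarrow> ratfun" where
  "macdonald_P n E lam = scal (1 / W_const n E lam) * P_sum n E lam"

text \<open>\<open>macdonald_A n E lam\<close> is \<open>A\<^bsub>lam+\<rho>\<^esub>\<close>.\<close>

definition macdonald_A :: "nat \<Rightarrow> ((nat \<Rightarrow>\<^sub>0 int) \<Rightarrow> ratfun) \<Rightarrow> (nat \<Rightarrow>\<^sub>0 int) \<Rightarrow> ratfun" where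
  "macdonald_A n E lam =
    (\<Prod>(i, j)\<in>pairs n. (xvar j - scal tK * xvar i) / (xvar i - xvar j)) *
    (\<Sum>w | w permutes {1..n}. (-1) ^ len n w * act w (E (lam + rho n)))"

text \<open>
  In the \<open>c\<close>-functions the generators \<open>xvar i\<close> of \<open>ratfun\<close> play the role of the commuting
  variables \<open>Y\<^sub>i\<close>.
\<close>

definition c_fun :: "nat \<Rightarrow> int \<times> int \<Rightarrow> ratfun" where
  "c_fun n = (\<lambda>(i, k).
    let Yi = xvar (nat i); Yj = xvar (res_ix n k); qm = scal (qK powi quot_ix n k)
    in scal (inverse thalf) * ((1 - qm * scal tK * inverse Yi * Yj) / (1 - qm * inverse Yi * Yj)))"

definition c_prod :: "nat \<Rightarrow> (int \<Rightarrow> int) \<Rightarrow> ratfun" where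
  "c_prod n w = (\<Prod>p\<in>Inv n w. c_fun n p)"

text \<open>
  The evaluations \<open>ev\<^sub>0\<^sup>t\<close> and \<open>ev\<^sub>0\<close> with \<open>t\<close> replaced by \<open>t\<^sup>-\<^sup>1\<close>; exponents are those of
  \<open>t\<^sup>1\<^sup>/\<^sup>2\<close>.
\<close>

definition ev0_t :: "nat \<Rightarrow> ratfun \<Rightarrow> K" where
  "ev0_t n = eval_at (\<lambda>i. thalf powi (- 2 * (int i - 1) + (int n - 1)))"

definition ev0_tinv :: "nat \<Rightarrow> ratfun \<Rightarrow> K" where
  "ev0_tinv n = eval_at (\<lambda>i. thalf powi (2 * (int i - 1) - (int n - 1)))"

definition eval_princ :: "ratfun \<Rightarrow> K" where
  "eval_princ = eval_at (\<lambda>i. tK ^ (i - 1))"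

end

theory Submission
  imports Defs
begin

text \<open>
  Write \<open>ev\<close> for the evaluation at \<open>x\<^sub>i = t\<^sup>i\<^sup>-\<^sup>1\<close>. The factor \<open>t x\<^sub>i - x\<^sub>i\<^sub>+\<^sub>1\<close> in the
  Demazure-Lusztig operator \<open>T\<^sub>i\<close> vanishes at this point, hence \<open>ev (T\<^sub>i f) = ev f\<close>.
  The \<open>E\<^sub>\<mu>\<close> are eigenvectors of the Cherednik operators \<open>Y\<^sub>1, \<dots>, Y\<^sub>n\<close>, and
  \<open>Y\<^sub>n = T\<^sub>n\<^sub>-\<^sub>1 \<cdots> T\<^sub>1 G\<close> with \<open>G\<close> the substitution in (E1). So \<open>ev (G E\<^sub>\<mu>)\<close> is an
  eigenvalue times \<open>ev (E\<^sub>\<mu>)\<close>; together with (E2) this determines \<open>ev (E\<^sub>\<mu>)\<close> recursively,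
  and the product over the inversions of \<open>u\<^sub>\<mu>\<close> satisfies the same recursion.

  In \<open>ev (P\<^sub>\<lambda>)\<close> only the term \<open>w = 1\<close> of the symmetrization survives: every other \<open>w\<close>
  produces a factor \<open>x\<^sub>r\<^sub>+\<^sub>1 - t x\<^sub>r\<close>. The constant \<open>W\<^sub>\<lambda>\<close> is the coefficient of the
  lexicographically largest monomial \<open>x\<^sup>\<lambda>\<close>; by triangularity of \<open>E\<^sub>\<lambda>\<close> it is the
  Poincare polynomial of the stabilizer of \<open>\<lambda>\<close>. That polynomial is also the symmetrization of the
  constant 1 over the stabilizer, and evaluating the latter gives its product formula.
  Finally \<open>A\<^sub>\<lambda>\<^sub>+\<^sub>\<rho>\<close> has the factor \<open>x\<^sub>2 - t x\<^sub>1\<close>.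
\<close>

text \<open>Three moves on exponents (rotation, swapping a descent, lowering all entries) reach all
  of Z^n from 0, so every fact about the family \<open>E\<close> is an induction over them
  (\<open>Zn_induct\<close>). The evaluation uses the eigenvalue of Y_n alone, but the induction has
  to carry all the Y_i because rotation permutes them cyclically.

  The inversions of u_mu are indexed by pairs of positions of mu and an integer m. In this form
  rotation merely reindexes the product, and a swap lengthens the range of m for one pair. For
  dominant lambda the inversions of t_lambda give the same product, up to powers of t^(1/2),
  together with factors at m = 0. These multiply to the quotient of the Poincare polynomials of S_n
  and of the stabilizer, which is what symmetrizing and dividing by W_lambda produces.

  Two obstacles shape the rest. The value of a rational function is a definite description, so each
  value must be justified by a denominator that survives. And W_lambda is pinned down only once the
  symmetrization is known to be a Laurent polynomial with a known coefficient at lambda, whence the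
  divisibility and triangularity arguments.\<close>

abbreviation lk :: "('a \<Rightarrow>\<^sub>0 'b::zero) \<Rightarrow> 'a \<Rightarrow> 'b" where "lk \<equiv> Poly_Mapping.lookup"
abbreviation keys :: "('a \<Rightarrow>\<^sub>0 'b::zero) \<Rightarrow> 'a set" where "keys \<equiv> Poly_Mapping.keys"
abbreviation single :: "'a \<Rightarrow> 'b::zero \<Rightarrow> ('a \<Rightarrow>\<^sub>0 'b)" where "single \<equiv> Poly_Mapping.single"

subsection \<open>Substitution into Laurent polynomials\<close>

lemma single_eq_single_iff: "single a c = single b c \<longleftrightarrow> a = b \<or> c = 0"
  by (metis keys_single single_zero singleton_inject)

lemma single_eq_0_iff: "single a c = 0 \<longleftrightarrow> c = 0"
  by (metis lookup_single_eq lookup_zero single_zero)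

lemma keys_nonempty: "p \<noteq> 0 \<Longrightarrow> keys p \<noteq> {}"
  by (auto simp: in_keys_iff intro: poly_mapping_eqI)

lemma sum_single_lookup: "(\<Sum>\<nu>\<in>keys p. single \<nu> (lk p \<nu>)) = p"
  by (rule poly_mapping_eqI) (auto simp: lookup_sum lookup_single when_def in_keys_iff)

definition mon :: "(nat \<Rightarrow> 'b::field) \<Rightarrow> (nat \<Rightarrow>\<^sub>0 int) \<Rightarrow> 'b" where
  "mon x \<mu> = (\<Prod>i\<in>keys \<mu>. x i powi lk \<mu> i)"

lemma mon_superset: "finite A \<Longrightarrow> keys \<mu> \<subseteq> A \<Longrightarrow> mon x \<mu> = (\<Prod>i\<in>A. x i powi lk \<mu> i)"
  unfolding mon_def by (rule prod.mono_neutral_left) (auto simp: in_keys_iff)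

lemma mon_zero [simp]: "mon x 0 = 1"
  by (simp add: mon_def)

lemma mon_single [simp]: "mon x (single i k) = x i powi k"
  by (cases "k = 0") (simp_all add: mon_def)

lemma mon_add:
  assumes "\<And>i. x i \<noteq> 0"
  shows "mon x (\<mu> + \<nu>) = mon x \<mu> * mon x \<nu>"
proof -
  let ?A = "keys \<mu> \<union> keys \<nu>"
  have "keys (\<mu> + \<nu>) \<subseteq> ?A" by (rule Poly_Mapping.keys_add)
  then have "mon x (\<mu> + \<nu>) = (\<Prod>i\<in>?A. x i powi (lk \<mu> i + lk \<nu> i))"
    by (simp add: mon_superset[of ?A] lookup_add)
  also have "\<dots> = mon x \<mu> * mon x \<nu>"
    using assms by (simp add: mon_superset[of ?A] power_int_add prod.distrib)
  finally show ?thesis .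
qed

lemma mon_nonzero: "(\<And>i. x i \<noteq> 0) \<Longrightarrow> mon x \<mu> \<noteq> 0"
  by (simp add: mon_def)

text \<open>One interface for two targets: \<open>\<phi>\<close> is \<open>scal\<close> for
  substitutions into the rational functions and the identity for evaluations in \<open>K\<close>.
  The values must be nonzero for negative exponents to behave multiplicatively.\<close>

locale evaluation =
  fixes \<phi> :: "K \<Rightarrow> 'b::field" and x :: "nat \<Rightarrow> 'b"
  assumes \<phi>_0: "\<phi> 0 = 0" and \<phi>_1: "\<phi> 1 = 1"
    and \<phi>_add: "\<phi> (a + b) = \<phi> a + \<phi> b" and \<phi>_mult: "\<phi> (a * b) = \<phi> a * \<phi> b"
    and x_nonzero: "x i \<noteq> 0"
begin

lemma leval_mon: "leval \<phi> x f = (\<Sum>\<mu>\<in>keys f. \<phi> (lk f \<mu>) * mon x \<mu>)"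
  by (simp add: leval_def mon_def)

lemma leval_superset:
  "finite A \<Longrightarrow> keys f \<subseteq> A \<Longrightarrow> leval \<phi> x f = (\<Sum>\<mu>\<in>A. \<phi> (lk f \<mu>) * mon x \<mu>)"
  unfolding leval_mon by (rule sum.mono_neutral_left) (auto simp: in_keys_iff \<phi>_0)

lemma leval_0 [simp]: "leval \<phi> x 0 = 0"
  by (simp add: leval_mon)

lemma leval_single: "leval \<phi> x (single \<mu> c) = \<phi> c * mon x \<mu>"
  by (cases "c = 0") (simp_all add: leval_mon \<phi>_0)

lemma leval_1 [simp]: "leval \<phi> x 1 = 1"
  using leval_single[of 0 1] by (simp add: \<phi>_1)

lemma leval_add: "leval \<phi> x (f + g) = leval \<phi> x f + leval \<phi> x g"
proof -
  let ?A = "keys f \<union> keys g"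
  have "keys (f + g) \<subseteq> ?A" by (rule Poly_Mapping.keys_add)
  then show ?thesis
    by (simp add: leval_superset[of ?A] lookup_add \<phi>_add distrib_right sum.distrib)
qed

lemma leval_sum: "leval \<phi> x (\<Sum>a\<in>A. f a) = (\<Sum>a\<in>A. leval \<phi> x (f a))"
  by (induction A rule: infinite_finite_induct) (simp_all add: leval_add)

lemma leval_mult: "leval \<phi> x (f * g) = leval \<phi> x f * leval \<phi> x g"
proof -
  have "f * g = (\<Sum>\<mu>\<in>keys f. single \<mu> (lk f \<mu>)) * (\<Sum>\<nu>\<in>keys g. single \<nu> (lk g \<nu>))"
    by (simp add: sum_single_lookup)
  also have "\<dots> = (\<Sum>\<mu>\<in>keys f. \<Sum>\<nu>\<in>keys g. single (\<mu> + \<nu>) (lk f \<mu> * lk g \<nu>))"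
    by (simp add: sum_product mult_single)
  finally have "leval \<phi> x (f * g) = (\<Sum>\<mu>\<in>keys f. \<Sum>\<nu>\<in>keys g. \<phi> (lk f \<mu>) * mon x \<mu> * (\<phi> (lk g \<nu>) * mon x \<nu>))"
    by (simp add: leval_sum leval_single \<phi>_mult mon_add x_nonzero mult_ac)
  also have "\<dots> = leval \<phi> x f * leval \<phi> x g"
    by (simp add: leval_mon sum_product)
  finally show ?thesis .
qed

lemma leval_uminus: "leval \<phi> x (- f) = - leval \<phi> x f"
  using leval_add[of f "- f"] by (simp add: eq_neg_iff_add_eq_0 add.commute)

text \<open>The relation behind \<open>feval\<close>, with both fractions cross-multiplied. Values
  can then be combined by ring arithmetic, and \<open>feval\<close> is computed by exhibiting one
  admissible fraction.\<close>

definition has_value :: "ratfun \<Rightarrow> 'b \<Rightarrow> bool" where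
  "has_value r c \<longleftrightarrow> (\<exists>a b. leval \<phi> x b \<noteq> 0 \<and> r * to_fract b = to_fract a \<and> c * leval \<phi> x b = leval \<phi> x a)"

text \<open>Two fractions for \<open>r\<close> give \<open>a * b' = a' * b\<close> already for
  Laurent polynomials, since these embed in their fraction field; applying the ring homomorphism
  \<open>leval\<close> compares the values.\<close>

lemma has_value_unique:
  assumes "has_value r c" "has_value r d"
  shows "c = d"
proof -
  obtain a b where ab: "leval \<phi> x b \<noteq> 0" "r * to_fract b = to_fract a" "c * leval \<phi> x b = leval \<phi> x a"
    using assms(1) by (auto simp: has_value_def)
  obtain a' b' where ab': "leval \<phi> x b' \<noteq> 0" "r * to_fract b' = to_fract a'" "d * leval \<phi> x b' = leval \<phi> x a'"
    using assms(2) by (auto simp: has_value_def)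
  have "to_fract (a * b') = to_fract (a' * b)"
    unfolding to_fract_mult ab(2)[symmetric] ab'(2)[symmetric] by (simp add: mult_ac)
  then have "a * b' = a' * b" by (simp only: to_fract_eq_iff)
  then have "leval \<phi> x a * leval \<phi> x b' = leval \<phi> x a' * leval \<phi> x b"
    by (metis leval_mult)
  then have "c * leval \<phi> x b * leval \<phi> x b' = d * leval \<phi> x b' * leval \<phi> x b"
    using ab(3) ab'(3) by simp
  then show ?thesis using ab(1) ab'(1) by simp
qed

lemma feval_eq:
  assumes "has_value r c"
  shows "feval \<phi> x r = c"
proof -
  have *: "(\<exists>a b. leval \<phi> x b \<noteq> 0 \<and> r = Fraction_Field.Fract a b \<and> d = leval \<phi> x a / leval \<phi> x b) \<longleftrightarrow> has_value r d" for d
  proof -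
    have "r = Fraction_Field.Fract a b \<and> d = leval \<phi> x a / leval \<phi> x b \<longleftrightarrow>
        r * to_fract b = to_fract a \<and> d * leval \<phi> x b = leval \<phi> x a" if "leval \<phi> x b \<noteq> 0" for a b
    proof -
      have "b \<noteq> 0" using that by auto
      then show ?thesis using that by (simp add: Fract_conv_to_fract eq_divide_eq)
    qed
    then show ?thesis unfolding has_value_def by blast
  qed
  show ?thesis unfolding feval_def * using assms has_value_unique by blast
qed

lemma has_value_to_fract: "has_value (to_fract p) (leval \<phi> x p)"
  unfolding has_value_def by (rule exI[of _ p], rule exI[of _ 1]) simp

lemma has_value_add:
  assumes "has_value r c" "has_value s d"
  shows "has_value (r + s) (c + d)"
proof -
  obtain a b where ab: "leval \<phi> x b \<noteq> 0" "r * to_fract b = to_fract a" "c * leval \<phi> x b = leval \<phi> x a"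
    using assms(1) by (auto simp: has_value_def)
  obtain a' b' where ab': "leval \<phi> x b' \<noteq> 0" "s * to_fract b' = to_fract a'" "d * leval \<phi> x b' = leval \<phi> x a'"
    using assms(2) by (auto simp: has_value_def)
  have "(r + s) * to_fract (b * b') = (r * to_fract b) * to_fract b' + (s * to_fract b') * to_fract b"
    by (simp add: algebra_simps)
  also have "\<dots> = to_fract (a * b' + a' * b)" by (simp add: ab ab')
  finally have 1: "(r + s) * to_fract (b * b') = to_fract (a * b' + a' * b)" .
  have "(c + d) * leval \<phi> x (b * b') = (c * leval \<phi> x b) * leval \<phi> x b' + (d * leval \<phi> x b') * leval \<phi> x b"
    by (simp add: leval_mult algebra_simps)
  also have "\<dots> = leval \<phi> x (a * b' + a' * b)" by (simp add: ab ab' leval_mult leval_add)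
  finally show ?thesis using 1 ab(1) ab'(1) unfolding has_value_def
    by (intro exI[of _ "a * b' + a' * b"] exI[of _ "b * b'"]) (simp add: leval_mult)
qed

lemma has_value_mult:
  assumes "has_value r c" "has_value s d"
  shows "has_value (r * s) (c * d)"
proof -
  obtain a b where ab: "leval \<phi> x b \<noteq> 0" "r * to_fract b = to_fract a" "c * leval \<phi> x b = leval \<phi> x a"
    using assms(1) by (auto simp: has_value_def)
  obtain a' b' where ab': "leval \<phi> x b' \<noteq> 0" "s * to_fract b' = to_fract a'" "d * leval \<phi> x b' = leval \<phi> x a'"
    using assms(2) by (auto simp: has_value_def)
  have "(r * s) * to_fract (b * b') = (r * to_fract b) * (s * to_fract b')"
    by (simp add: algebra_simps)
  then have 1: "(r * s) * to_fract (b * b') = to_fract (a * a')" by (simp add: ab ab')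
  have "(c * d) * leval \<phi> x (b * b') = (c * leval \<phi> x b) * (d * leval \<phi> x b')"
    by (simp add: leval_mult algebra_simps)
  then have "(c * d) * leval \<phi> x (b * b') = leval \<phi> x (a * a')" by (simp add: ab ab' leval_mult)
  then show ?thesis using 1 ab(1) ab'(1) unfolding has_value_def
    by (intro exI[of _ "a * a'"] exI[of _ "b * b'"]) (simp add: leval_mult)
qed

lemma has_value_1: "has_value 1 1"
  using has_value_to_fract[of 1] by simp

lemma has_value_uminus: "has_value r c \<Longrightarrow> has_value (- r) (- c)"
  using has_value_mult[OF has_value_to_fract[of "-1"], of r c] by (simp add: leval_uminus)

lemma has_value_diff: "has_value r c \<Longrightarrow> has_value s d \<Longrightarrow> has_value (r - s) (c - d)"
  using has_value_add[OF _ has_value_uminus, of r c s d] by simp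

lemma has_value_inverse:
  assumes "has_value r c" "c \<noteq> 0"
  shows "has_value (inverse r) (inverse c)"
proof -
  obtain a b where ab: "leval \<phi> x b \<noteq> 0" "r * to_fract b = to_fract a" "c * leval \<phi> x b = leval \<phi> x a"
    using assms(1) by (auto simp: has_value_def)
  have la: "leval \<phi> x a \<noteq> 0" unfolding ab(3)[symmetric] using ab(1) assms(2) by simp
  then have "a \<noteq> 0" by auto
  then have "r \<noteq> 0" using ab(2) by auto
  have "inverse r * to_fract a = to_fract b" unfolding ab(2)[symmetric] using \<open>r \<noteq> 0\<close> by simp
  moreover have "inverse c * leval \<phi> x a = leval \<phi> x b" unfolding ab(3)[symmetric] using assms(2) by simp
  ultimately show ?thesis using la unfolding has_value_def by blast
qed

lemma has_value_divide: "has_value r c \<Longrightarrow> has_value s d \<Longrightarrow> d \<noteq> 0 \<Longrightarrow> has_value (r / s) (c / d)"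
  by (simp add: divide_inverse has_value_mult has_value_inverse)

lemma has_value_prod:
  "(\<And>a. a \<in> A \<Longrightarrow> has_value (r a) (c a)) \<Longrightarrow> has_value (\<Prod>a\<in>A. r a) (\<Prod>a\<in>A. c a)"
  by (induction A rule: infinite_finite_induct) (auto intro: has_value_mult has_value_1)

lemma has_value_sum:
  "(\<And>a. a \<in> A \<Longrightarrow> has_value (r a) (c a)) \<Longrightarrow> has_value (\<Sum>a\<in>A. r a) (\<Sum>a\<in>A. c a)"
  by (induction A rule: infinite_finite_induct)
    (use has_value_to_fract[of 0] in \<open>auto intro: has_value_add\<close>)

lemma has_value_scal: "has_value (scal c) (\<phi> c)"
  using has_value_to_fract[of "single 0 c"] by (simp add: leval_single scal_def)

lemma has_value_xvar: "has_value (xvar i) (x i)"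
  using has_value_to_fract[of "single (single i 1) 1"] by (simp add: leval_single xvar_def \<phi>_1)

text \<open>If no nonzero Laurent polynomial is sent to 0, every denominator survives and the
  substitution is defined on the whole field.\<close>

lemma has_value_if_injective:
  assumes "\<And>p. p \<noteq> 0 \<Longrightarrow> leval \<phi> x p \<noteq> 0"
  shows "has_value r (feval \<phi> x r)"
proof -
  obtain a b where r: "r = Fraction_Field.Fract a b" "b \<noteq> 0" by (cases r) auto
  have "has_value (to_fract a / to_fract b) (leval \<phi> x a / leval \<phi> x b)"
    by (intro has_value_divide has_value_to_fract assms r)
  then have "has_value r (leval \<phi> x a / leval \<phi> x b)" by (simp add: r Fract_conv_to_fract)
  then show ?thesis using feval_eq by metis
qed

end

subsection \<open>Monomials\<close>

definition xmon :: "(nat \<Rightarrow>\<^sub>0 int) \<Rightarrow> ratfun" where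
  "xmon \<mu> = to_fract (single \<mu> 1)"

lemma scal_0 [simp]: "scal 0 = 0" and scal_1 [simp]: "scal 1 = 1"
  and scal_add: "scal (a + b) = scal a + scal b" and scal_mult: "scal (a * b) = scal a * scal b"
  by (simp_all add: scal_def single_add mult_single flip: to_fract_add to_fract_mult)

lemma scal_uminus: "scal (- a) = - scal a"
  by (simp add: scal_def single_uminus flip: to_fract_uminus)

lemma scal_diff: "scal (a - b) = scal a - scal b"
  using scal_add[of a "- b"] by (simp add: scal_uminus)

lemma scal_eq_iff [simp]: "scal a = scal b \<longleftrightarrow> a = b"
  by (metis lookup_single_eq scal_def to_fract_eq_iff)

lemma scal_eq_0_iff [simp]: "scal a = 0 \<longleftrightarrow> a = 0"
  using scal_eq_iff[of a 0] by (simp del: scal_eq_iff)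

lemma scal_inverse: "scal (inverse a) = inverse (scal a)"
proof (cases "a = 0")
  case False
  then have "scal a * scal (inverse a) = 1" by (simp flip: scal_mult)
  then show ?thesis by (simp add: inverse_unique)
qed simp

lemma scal_power: "scal (a ^ k) = scal a ^ k"
  by (induction k) (simp_all add: scal_mult)

lemma scal_powi: "scal (a powi k) = scal a powi k"
  by (cases "k \<ge> 0") (simp_all add: power_int_def scal_power scal_inverse)

lemma scal_prod: "scal (\<Prod>a\<in>A. f a) = (\<Prod>a\<in>A. scal (f a))"
  by (induction A rule: infinite_finite_induct) (simp_all add: scal_mult)

lemma xmon_0 [simp]: "xmon 0 = 1"
  by (simp add: xmon_def)

lemma xmon_add: "xmon (\<mu> + \<nu>) = xmon \<mu> * xmon \<nu>"
  by (simp add: xmon_def mult_single flip: to_fract_mult)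

lemma xmon_nonzero [simp]: "xmon \<mu> \<noteq> 0"
  by (simp add: xmon_def single_eq_0_iff)

lemma xmon_uminus: "xmon (- \<mu>) = inverse (xmon \<mu>)"
  using xmon_add[of \<mu> "- \<mu>"] inverse_unique[of "xmon \<mu>" "xmon (- \<mu>)"] by simp

lemma xmon_diff: "xmon (\<mu> - \<nu>) = xmon \<mu> / xmon \<nu>"
  using xmon_add[of \<mu> "- \<nu>"] by (simp add: xmon_uminus divide_inverse)

lemma xvar_xmon: "xvar i = xmon (single i 1)"
  by (simp add: xvar_def xmon_def)

lemma xvar_nonzero [simp]: "xvar i \<noteq> 0"
  by (simp add: xvar_xmon)

lemma xvar_eq_iff [simp]: "xvar i = xvar j \<longleftrightarrow> i = j"
  by (simp add: xvar_def single_eq_single_iff)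

lemma xmon_single: "xmon (single i k) = xvar i powi k"
proof -
  have nat: "xmon (single i (int m)) = xvar i ^ m" for m
    by (induction m) (simp_all add: single_add xmon_add xvar_xmon)
  have "xmon (single i k) = inverse (xmon (single i (- k)))"
    by (simp add: single_uminus flip: xmon_uminus)
  then show ?thesis using nat[of "nat k"] nat[of "nat (- k)"]
    by (cases "k \<ge> 0") (simp_all add: power_int_def power_inverse)
qed

lemma xmon_eq_mon: "xmon \<mu> = mon xvar \<mu>"
proof -
  have "xmon (\<Sum>i\<in>A. single i (lk \<mu> i)) = (\<Prod>i\<in>A. xvar i powi lk \<mu> i)" if "finite A" for A
    using that by induction (simp_all add: xmon_add xmon_single)
  from this[of "keys \<mu>"] show ?thesis by (simp add: sum_single_lookup mon_def)
qed

lemma to_fract_single: "to_fract (single \<mu> c) = scal c * xmon \<mu>"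
  by (simp add: scal_def xmon_def mult_single flip: to_fract_mult)

lemma to_fract_expand: "to_fract p = (\<Sum>\<mu>\<in>keys p. scal (lk p \<mu>) * xmon \<mu>)"
proof -
  have "to_fract p = to_fract (\<Sum>\<mu>\<in>keys p. single \<mu> (lk p \<mu>))" by (simp add: sum_single_lookup)
  then show ?thesis by (simp only: to_fract_sum to_fract_single)
qed

subsection \<open>Field endomorphisms\<close>

definition field_endo :: "(ratfun \<Rightarrow> ratfun) \<Rightarrow> bool" where
  "field_endo F \<longleftrightarrow> F 1 = 1 \<and> (\<forall>a b. F (a + b) = F a + F b) \<and> (\<forall>a b. F (a * b) = F a * F b)"

context
  fixes F assumes F: "field_endo F"
begin

lemma field_endo_1: "F 1 = 1" and field_endo_add: "F (a + b) = F a + F b"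
  and field_endo_mult: "F (a * b) = F a * F b"
  using F by (simp_all add: field_endo_def)

lemma field_endo_0: "F 0 = 0"
  using field_endo_add[of 0 0] by (metis add_cancel_right_right add_0)

lemma field_endo_uminus: "F (- a) = - F a"
  using field_endo_add[of a "- a"] by (simp add: field_endo_0 eq_neg_iff_add_eq_0 add.commute)

lemma field_endo_diff: "F (a - b) = F a - F b"
  using field_endo_add[of a "- b"] by (simp add: field_endo_uminus)

lemma field_endo_inverse: "F (inverse a) = inverse (F a)"
proof (cases "a = 0")
  case False
  then have "F a * F (inverse a) = 1" by (simp add: field_endo_1 flip: field_endo_mult)
  then show ?thesis by (simp add: inverse_unique)
qed (simp add: field_endo_0)

lemma field_endo_divide: "F (a / b) = F a / F b"
  by (simp add: divide_inverse field_endo_mult field_endo_inverse)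

lemma field_endo_sum: "F (\<Sum>a\<in>A. f a) = (\<Sum>a\<in>A. F (f a))"
  by (induction A rule: infinite_finite_induct) (simp_all add: field_endo_0 field_endo_add)

lemma field_endo_prod: "F (\<Prod>a\<in>A. f a) = (\<Prod>a\<in>A. F (f a))"
  by (induction A rule: infinite_finite_induct) (simp_all add: field_endo_1 field_endo_mult)

lemma field_endo_power: "F (a ^ k) = F a ^ k"
  by (induction k) (simp_all add: field_endo_1 field_endo_mult)

lemma field_endo_powi: "F (a powi k) = F a powi k"
  by (cases "k \<ge> 0") (simp_all add: power_int_def field_endo_power field_endo_inverse)

lemma field_endo_xmon: "F (xmon \<mu>) = mon (\<lambda>i. F (xvar i)) \<mu>"
  by (simp add: xmon_eq_mon mon_def field_endo_prod field_endo_powi)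

end

lemma field_endo_comp: "field_endo F \<Longrightarrow> field_endo G \<Longrightarrow> field_endo (\<lambda>r. F (G r))"
  by (simp add: field_endo_def)

text \<open>Scalars and variables generate the field: a Laurent polynomial is a sum of scaled
  monomials, and any element is a quotient of two. Identities between compositions of permutations
  and rotations thus reduce to the images of the \<open>xvar i\<close>.\<close>

lemma field_endo_eqI:
  assumes F: "field_endo F" and G: "field_endo G"
    and "\<And>c. F (scal c) = G (scal c)" "\<And>i. F (xvar i) = G (xvar i)"
  shows "F r = G r"
proof -
  have p: "F (to_fract p) = G (to_fract p)" for p
    using assms(3,4) unfolding to_fract_expand
    by (simp add: field_endo_sum[OF F] field_endo_sum[OF G] field_endo_mult[OF F] field_endo_mult[OF G]
        field_endo_xmon[OF F] field_endo_xmon[OF G] del: scal_eq_iff)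
  obtain a b where "r = Fraction_Field.Fract a b" by (cases r) auto
  then show ?thesis
    by (simp add: Fract_conv_to_fract field_endo_divide[OF F] field_endo_divide[OF G] p)
qed

definition permexp :: "(nat \<Rightarrow> nat) \<Rightarrow> (nat \<Rightarrow>\<^sub>0 int) \<Rightarrow> (nat \<Rightarrow>\<^sub>0 int)" where
  "permexp w \<mu> = Poly_Mapping.map_key (inv w) \<mu>"

lemma lookup_permexp: "bij w \<Longrightarrow> lk (permexp w \<mu>) i = lk \<mu> (inv w i)"
  by (simp add: permexp_def map_key.rep_eq bij_imp_bij_inv bij_is_inj)

lemma permexp_eq_iff: "bij w \<Longrightarrow> permexp w \<mu> = permexp w \<nu> \<longleftrightarrow> \<mu> = \<nu>"
  by (metis bij_inv_eq_iff lookup_permexp poly_mapping_eqI)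

lemma mon_comp_bij:
  assumes "bij w"
  shows "mon (\<lambda>i. xvar (w i)) \<mu> = xmon (permexp w \<mu>)"
proof -
  have k: "keys (permexp w \<mu>) = w ` keys \<mu>"
  proof -
    have "i \<in> keys (permexp w \<mu>) \<longleftrightarrow> inv w i \<in> keys \<mu>" for i
      by (simp add: in_keys_iff lookup_permexp[OF assms])
    then have "keys (permexp w \<mu>) = inv w -` keys \<mu>" by auto
    then show ?thesis by (simp only: bij_vimage_eq_inv_image[OF bij_imp_bij_inv[OF assms]] inv_inv_eq[OF assms])
  qed
  have "xmon (permexp w \<mu>) = (\<Prod>i\<in>keys \<mu>. xvar (w i) powi lk (permexp w \<mu>) (w i))"
    using prod.reindex[of w "keys \<mu>" "\<lambda>j. xvar j powi lk (permexp w \<mu>) j"] inj_on_subset[OF bij_is_inj[OF assms]]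
    by (simp add: xmon_eq_mon mon_def k)
  then show ?thesis by (simp only: mon_def lookup_permexp[OF assms] inv_f_f[OF bij_is_inj[OF assms]])
qed

lemma evaluation_scal: "(\<And>i. x i \<noteq> 0) \<Longrightarrow> evaluation scal x"
  by unfold_locales (simp_all add: scal_add scal_mult)

text \<open>Variables permuted and rescaled: this covers \<open>act\<close>, with all scalars 1, and
  the rotation, where x_n picks up the scalar q^(-1).\<close>

context
  fixes x :: "nat \<Rightarrow> ratfun" and c :: "nat \<Rightarrow> K" and w :: "nat \<Rightarrow> nat"
  assumes x: "\<And>i. x i = scal (c i) * xvar (w i)" and c: "\<And>i. c i \<noteq> 0" and w: "bij w"
begin

interpretation evaluation scal x
  by (rule evaluation_scal) (use c in \<open>simp add: x\<close>)

lemma mon_scaled: "mon x \<mu> = scal (mon c \<mu>) * xmon (permexp w \<mu>)"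
proof -
  have "mon x \<mu> = (\<Prod>i\<in>keys \<mu>. scal (c i) powi lk \<mu> i) * mon (\<lambda>i. xvar (w i)) \<mu>"
    unfolding mon_def by (simp add: x power_int_mult_distrib prod.distrib)
  also have "(\<Prod>i\<in>keys \<mu>. scal (c i) powi lk \<mu> i) = scal (mon c \<mu>)"
    by (simp add: mon_def scal_prod scal_powi)
  finally show ?thesis by (simp only: mon_comp_bij[OF w])
qed

text \<open>Distinct monomials go to multiples of distinct monomials, so nothing cancels: the
  coefficient at \<open>permexp w \<nu>\<close> comes from \<open>\<nu>\<close> alone.\<close>

lemma leval_scaled_nonzero:
  assumes "p \<noteq> 0" shows "leval scal x p \<noteq> 0"
proof
  assume 0: "leval scal x p = 0"
  obtain \<nu> where \<nu>: "\<nu> \<in> keys p" using assms keys_nonempty[OF assms] by blast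
  have "leval scal x p = to_fract (\<Sum>\<mu>\<in>keys p. single (permexp w \<mu>) (lk p \<mu> * mon c \<mu>))"
    by (simp add: leval_mon mon_scaled to_fract_single scal_mult mult_ac)
  then have "to_fract (\<Sum>\<mu>\<in>keys p. single (permexp w \<mu>) (lk p \<mu> * mon c \<mu>)) = 0"
    unfolding 0 by (rule sym)
  then have "(\<Sum>\<mu>\<in>keys p. single (permexp w \<mu>) (lk p \<mu> * mon c \<mu>)) = 0"
    by (rule iffD1[OF to_fract_eq_0_iff])
  then have "lk (\<Sum>\<mu>\<in>keys p. single (permexp w \<mu>) (lk p \<mu> * mon c \<mu>)) (permexp w \<nu>) = 0" by simp
  then have "(\<Sum>\<mu>\<in>keys p. if \<mu> = \<nu> then lk p \<mu> * mon c \<mu> else 0) = 0"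
    by (simp add: lookup_sum lookup_single permexp_eq_iff[OF w] when_def)
  then have "lk p \<nu> * mon c \<nu> = 0" using \<nu> by simp
  then show False using \<nu> by (simp add: in_keys_iff mon_nonzero c)
qed

lemma rsubst_has_value: "has_value r (rsubst x r)"
  unfolding rsubst_def by (rule has_value_if_injective) (rule leval_scaled_nonzero)

lemma field_endo_rsubst: "field_endo (rsubst x)"
  unfolding field_endo_def
  by (auto intro!: has_value_unique[OF rsubst_has_value] has_value_1
      has_value_add[OF rsubst_has_value rsubst_has_value] has_value_mult[OF rsubst_has_value rsubst_has_value])

lemma rsubst_scal: "rsubst x (scal k) = scal k"
  by (rule has_value_unique[OF rsubst_has_value has_value_scal])

lemma rsubst_xvar: "rsubst x (xvar i) = x i"
  by (rule has_value_unique[OF rsubst_has_value has_value_xvar])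

end

subsection \<open>The symmetric group action\<close>

lemma act_alt: "act w = rsubst (\<lambda>i. xvar (w i))"
  by (rule ext) (simp add: act_def)

lemma field_endo_act: "bij w \<Longrightarrow> field_endo (act w)"
  unfolding act_alt by (rule field_endo_rsubst[of _ "\<lambda>_. 1" w]) simp_all

lemma act_scal: "bij w \<Longrightarrow> act w (scal k) = scal k"
  unfolding act_alt by (rule rsubst_scal[of _ "\<lambda>_. 1" w]) simp_all

lemma act_xvar: "bij w \<Longrightarrow> act w (xvar i) = xvar (w i)"
  unfolding act_alt by (rule rsubst_xvar[of _ "\<lambda>_. 1" w]) simp_all

lemma act_xmon: "bij w \<Longrightarrow> act w (xmon \<mu>) = xmon (permexp w \<mu>)"
  by (simp add: field_endo_xmon[OF field_endo_act] act_xvar mon_comp_bij)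

lemma act_act: "bij v \<Longrightarrow> bij w \<Longrightarrow> act v (act w r) = act (v \<circ> w) r"
proof (rule field_endo_eqI[where F = "\<lambda>r. act v (act w r)" and G = "act (v \<circ> w)"])
  assume v: "bij v" and w: "bij w"
  note vw = bij_comp[OF w v]
  show "field_endo (\<lambda>r. act v (act w r))" by (rule field_endo_comp[OF field_endo_act[OF v] field_endo_act[OF w]])
  show "field_endo (act (v \<circ> w))" by (rule field_endo_act[OF vw])
  show "act v (act w (scal c)) = act (v \<circ> w) (scal c)" for c
    by (simp only: act_scal[OF v] act_scal[OF w] act_scal[OF vw])
  show "act v (act w (xvar i)) = act (v \<circ> w) (xvar i)" for i
    by (simp only: act_xvar[OF v] act_xvar[OF w] act_xvar[OF vw] o_apply)
qed

lemma act_id: "act id r = r"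
  by (rule field_endo_eqI[where F = "act id" and G = "\<lambda>r. r"])
    (simp_all only: field_endo_act act_scal act_xvar bij_id id_apply, simp add: field_endo_def)

subsection \<open>Hecke operators\<close>

abbreviation tt :: ratfun where "tt \<equiv> scal tK"
abbreviation S :: "nat \<Rightarrow> ratfun \<Rightarrow> ratfun" where "S i \<equiv> act (Transposition.transpose i (Suc i))"

lemma qK_nonzero [simp]: "qK \<noteq> 0" and thalf_nonzero [simp]: "thalf \<noteq> 0" and tK_nonzero [simp]: "tK \<noteq> 0"
  by (simp_all add: qK_def thalf_def tK_def)

lemmas endo_S = field_endo_act[OF bij_transpose]
lemmas S_add = field_endo_add[OF endo_S] and S_mult = field_endo_mult[OF endo_S]
  and S_diff = field_endo_diff[OF endo_S] and S_divide = field_endo_divide[OF endo_S]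
  and S_1 = field_endo_1[OF endo_S] and S_scal = act_scal[OF bij_transpose]
  and S_xvar = act_xvar[OF bij_transpose]

lemma S_invol: "act (Transposition.transpose i j) (act (Transposition.transpose i j) f) = f"
  by (simp only: act_act[OF bij_transpose bij_transpose] transpose_comp_involutory act_id)

text \<open>The Demazure-Lusztig operator with eigenvalues 1 and -t; up to adding a multiple of E_mu
  it is the right-hand side of the second relation.\<close>

definition T :: "nat \<Rightarrow> ratfun \<Rightarrow> ratfun" where
  "T i f = ((1 - tt) * xvar i * f + (tt * xvar i - xvar (Suc i)) * S i f) / (xvar i - xvar (Suc i))"

text \<open>\<open>Tb i\<close> is \<open>t\<close> times the inverse of \<open>T i\<close>.\<close>

definition Tb :: "nat \<Rightarrow> ratfun \<Rightarrow> ratfun" where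
  "Tb i f = T i f - (1 - tt) * f"

text \<open>The coefficients of 1 and s_i in T_i, with two free indices because permutations carry
  them to nonadjacent pairs in the braid relation.\<close>

definition Ta :: "nat \<Rightarrow> nat \<Rightarrow> ratfun" where "Ta i j = (1 - tt) * xvar i / (xvar i - xvar j)"
definition Tc :: "nat \<Rightarrow> nat \<Rightarrow> ratfun" where "Tc i j = (tt * xvar i - xvar j) / (xvar i - xvar j)"

lemma T_alt: "T i f = Ta i (Suc i) * f + Tc i (Suc i) * S i f"
  by (simp add: T_def Ta_def Tc_def add_divide_distrib)

lemma T_add: "T i (f + g) = T i f + T i g"
  by (simp add: T_alt S_add algebra_simps)

lemma T_invariant_mult: "S i h = h \<Longrightarrow> T i (h * f) = h * T i f"
  by (simp add: T_alt S_mult algebra_simps)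

lemma T_scal: "T i (scal c * f) = scal c * T i f"
  by (simp add: T_invariant_mult S_scal)

lemma T_diff: "T i (f - g) = T i f - T i g"
  using T_add[of i "f - g" g] by simp

lemma T_1: "T i 1 = 1"
  by (simp add: T_def S_1 field_simps)

lemma T_invariant: "S i h = h \<Longrightarrow> T i h = h"
  using T_invariant_mult[of i h 1] by (simp add: T_1)

lemma S_Ta: "act (Transposition.transpose k l) (Ta i j) = Ta (Transposition.transpose k l i) (Transposition.transpose k l j)"
  and S_Tc: "act (Transposition.transpose k l) (Tc i j) = Tc (Transposition.transpose k l i) (Transposition.transpose k l j)"
  by (simp_all only: Ta_def Tc_def S_divide S_mult S_diff S_1 S_scal S_xvar)

section \<open>Rational function identities behind the Hecke relations\<close>

context
  fixes t x y z f g :: "'a::field"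
begin

lemma hecke_coeff_sum: "x \<noteq> y \<Longrightarrow> (1 - t) * x / (x - y) + (1 - t) * y / (y - x) = 1 - t"
  by (simp add: divide_simps) (simp add: algebra_simps)

lemma hecke_coeff_quadratic: "x \<noteq> y \<Longrightarrow> (1 - t) * x / (x - y) * ((1 - t) * x / (x - y)) + (t * x - y) / (x - y) * ((t * y - x) / (y - x))
    = (1 - t) * ((1 - t) * x / (x - y)) + t"
  by (simp add: divide_simps) (simp add: algebra_simps)

lemma hecke_xvar:
  assumes "x \<noteq> y"
  shows "((1 - t) * x * (y * f) + (t * x - y) * (x * g)) / (x - y) = x * (((1 - t) * x * f + (t * x - y) * g) / (x - y) - (1 - t) * f)"
    and "((1 - t) * x * (x * f) + (t * x - y) * (y * g)) / (x - y) - (1 - t) * (x * f) = y * (((1 - t) * x * f + (t * x - y) * g) / (x - y))"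
  using assms by (simp add: divide_simps, simp add: algebra_simps)+

text \<open>Used with x, y, z the values of \<open>Ta\<close> at the pairs 12, 23, 13. Substituting
  the hypothesis, itself the first braid identity, for the product xy avoids clearing denominators
  in a cubic identity.\<close>

lemma hecke_coeff_cubic:
  assumes "x * y + z * (1 - t - x) = y * z"
  shows "x * x * y + ((1 - t) * x + t - x * x) * z = y * y * x + ((1 - t) * y + t - y * y) * z"
proof -
  have xy: "x * y = y * z - z * (1 - t - x)" using assms by (simp add: eq_diff_eq)
  have "x * x * y - y * y * x = (x * y) * (x - y)" by (simp add: algebra_simps)
  also have "\<dots> = ((1 - t) * y + t - y * y) * z - ((1 - t) * x + t - x * x) * z"
    unfolding xy by (simp add: algebra_simps)
  finally show ?thesis by (simp add: algebra_simps)
qed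

lemma hecke_coeff_braid:
  assumes "x \<noteq> y" "y \<noteq> z" "x \<noteq> z"
  shows "(1 - t) * x / (x - y) * ((1 - t) * y / (y - z)) + (1 - t) * x / (x - z) * ((1 - t) * y / (y - x))
      = (1 - t) * y / (y - z) * ((1 - t) * x / (x - z))"
    and "(1 - t) * x / (x - y) * ((1 - t) * x / (x - z))
      = (1 - t) * y / (y - z) * ((1 - t) * x / (x - y)) + (1 - t) * x / (x - z) * ((1 - t) * z / (z - y))"
  using assms by (simp add: divide_simps, simp add: algebra_simps)+

end

lemma Ta_sum: "i \<noteq> j \<Longrightarrow> Ta i j + Ta j i = 1 - tt"
  unfolding Ta_def by (rule hecke_coeff_sum) simp

lemma Ta_Tc: "i \<noteq> j \<Longrightarrow> Ta i j * Ta i j + Tc i j * Tc j i = (1 - tt) * Ta i j + tt"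
  unfolding Ta_def Tc_def by (rule hecke_coeff_quadratic) simp

lemma T_quadratic: "T i (T i f) = (1 - tt) * T i f + tt * f"
proof -
  let ?a = "Ta i (Suc i)" and ?b = "Tc i (Suc i)" and ?a' = "Ta (Suc i) i" and ?b' = "Tc (Suc i) i"
  have 1: "?a' = 1 - tt - ?a" using Ta_sum[of i "i+1"] by (simp add: algebra_simps)
  have 2: "?b * ?b' = (1 - tt) * ?a + tt - ?a * ?a" using Ta_Tc[of i "i+1"] by (simp add: algebra_simps)
  have "T i (T i f) = ?a * (?a * f + ?b * S i f) + ?b * (?a' * S i f + ?b' * f)"
    by (simp add: T_alt S_add S_mult S_Ta S_Tc S_invol)
  also have "\<dots> = (?a * ?a + ?b * ?b') * f + (?a + ?a') * ?b * S i f" by (simp add: algebra_simps)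
  also have "\<dots> = (1 - tt) * (?a * f + ?b * S i f) + tt * f" unfolding 1 2 by (simp add: algebra_simps)
  finally show ?thesis by (simp add: T_alt)
qed

lemma one_minus_tt: "1 - tt = scal (1 - tK)"
  by (simp add: scal_diff)

lemma Tb_T: "Tb i (T i f) = tt * f"
  by (simp add: Tb_def T_diff T_quadratic one_minus_tt T_scal)

lemma Tb_add: "Tb i (f + g) = Tb i f + Tb i g" and Tb_scal: "Tb i (scal c * f) = scal c * Tb i f"
  and Tb_invariant_mult: "S i h = h \<Longrightarrow> Tb i (h * f) = h * Tb i f"
  unfolding Tb_def T_add T_scal by (simp_all only: T_invariant_mult) (simp_all add: algebra_simps)

lemma S_comm: "Suc i < j \<Longrightarrow> S i (S j f) = S j (S i f)"
  unfolding act_act[OF bij_transpose bij_transpose]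
  by (rule arg_cong[of _ _ "\<lambda>w. act w f"]) (auto simp: fun_eq_iff transpose_def)

lemma T_comm_less: "Suc i < j \<Longrightarrow> T i (T j f) = T j (T i f)"
proof -
  assume ij: "Suc i < j"
  have "Transposition.transpose i (Suc i) j = j" "Transposition.transpose i (Suc i) (Suc j) = Suc j"
    "Transposition.transpose j (Suc j) i = i" "Transposition.transpose j (Suc j) (Suc i) = Suc i"
    using ij by (auto simp: transpose_def)
  then show ?thesis
    unfolding T_alt S_add S_mult S_Ta S_Tc S_comm[OF ij] by (simp add: algebra_simps)
qed

lemma T_comm: "Suc i < j \<or> Suc j < i \<Longrightarrow> T i (T j f) = T j (T i f)"
  using T_comm_less[of i j f] T_comm_less[of j i f] by auto

lemma T_Tb_comm: "Suc i < j \<or> Suc j < i \<Longrightarrow> T i (Tb j f) = Tb j (T i f)"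
  using T_comm[of i j f] by (simp only: Tb_def T_diff one_minus_tt T_scal)

lemma S_braid: "S i (S (Suc i) (S i f)) = S (Suc i) (S i (S (Suc i) f))"
  unfolding act_act[OF bij_transpose bij_transpose] act_act[OF bij_transpose bij_comp[OF bij_transpose bij_transpose]]
  by (rule arg_cong[of _ _ "\<lambda>w. act w f"]) (auto simp: fun_eq_iff transpose_def)

text \<open>For consecutive i, j, k these compare coefficients in the braid relation: the first
  identity belongs to s_i, the second to s_(i+1), the third to the identity permutation.\<close>

lemma braid_coeff:
  assumes "i \<noteq> j" "j \<noteq> k" "i \<noteq> k"
  shows "Ta i j * Ta j k + Ta i k * Ta j i = Ta j k * Ta i k"
    and "Ta i j * Ta i k = Ta j k * Ta i j + Ta i k * Ta k j"
    and "Ta i j * Ta i j * Ta j k + Tc i j * Tc j i * Ta i k = Ta j k * Ta j k * Ta i j + Tc j k * Tc k j * Ta i k"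
proof -
  show 1: "Ta i j * Ta j k + Ta i k * Ta j i = Ta j k * Ta i k"
    unfolding Ta_def by (rule hecke_coeff_braid(1)) (use assms in simp_all)
  show 2: "Ta i j * Ta i k = Ta j k * Ta i j + Ta i k * Ta k j"
    unfolding Ta_def by (rule hecke_coeff_braid(2)) (use assms in simp_all)
  have ij: "Tc i j * Tc j i = (1 - tt) * Ta i j + tt - Ta i j * Ta i j"
    using Ta_Tc[of i j] assms by (simp add: algebra_simps)
  have jk: "Tc j k * Tc k j = (1 - tt) * Ta j k + tt - Ta j k * Ta j k"
    using Ta_Tc[of j k] assms by (simp add: algebra_simps)
  have ji: "Ta j i = 1 - tt - Ta i j" using Ta_sum[of i j] assms by (simp add: algebra_simps)
  have "Ta i j * Ta j k + Ta i k * (1 - tt - Ta i j) = Ta j k * Ta i k" using 1 ji by simp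
  then show "Ta i j * Ta i j * Ta j k + Tc i j * Tc j i * Ta i k = Ta j k * Ta j k * Ta i j + Tc j k * Tc k j * Ta i k"
    unfolding ij jk by (rule hecke_coeff_cubic)
qed

lemma T_braid: "T i (T (Suc i) (T i f)) = T (Suc i) (T i (T (Suc i) f))"
proof -
  define a12 a13 a23 a21 a32 where a: "a12 = Ta i (Suc i)" "a13 = Ta i (i+2)" "a23 = Ta (Suc i) (i+2)"
    "a21 = Ta (Suc i) i" "a32 = Ta (i+2) (Suc i)"
  define b12 b13 b23 b21 b32 where b: "b12 = Tc i (Suc i)" "b13 = Tc i (i+2)" "b23 = Tc (Suc i) (i+2)"
    "b21 = Tc (Suc i) i" "b32 = Tc (i+2) (Suc i)"
  have S1: "S i a12 = a21" "S i a13 = a23" "S i a23 = a13" "S i b12 = b21" "S i b13 = b23" "S i b23 = b13"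
    and S2: "S (Suc i) a12 = a13" "S (Suc i) a13 = a12" "S (Suc i) a23 = a32"
      "S (Suc i) b12 = b13" "S (Suc i) b13 = b12" "S (Suc i) b23 = b32"
    unfolding a b by (simp_all add: S_Ta S_Tc transpose_def)
  have T1: "T i g = a12 * g + b12 * S i g" and T2: "T (Suc i) g = a23 * g + b23 * S (Suc i) g" for g
    by (simp_all add: T_alt a b)
  have c1: "a12 * a23 + a13 * a21 = a23 * a13" and c2: "a12 * a13 = a23 * a12 + a13 * a32"
    and c3: "a12 * a12 * a23 + b12 * b21 * a13 = a23 * a23 * a12 + b23 * b32 * a13"
    using braid_coeff[of i "i+1" "i+2"] unfolding a b by simp_all
  \<comment> \<open>Both sides are expanded in the six elements of S_3; the coefficients of the
    three words of length at least two agree term by term.\<close>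
  have L: "T i (T (Suc i) (T i f)) = (a12 * a12 * a23 + b12 * b21 * a13) * f + b12 * (a12 * a23 + a13 * a21) * S i f
     + b23 * (a12 * a13) * S (Suc i) f + a12 * b23 * b13 * S (Suc i) (S i f) + b12 * b13 * a23 * S i (S (Suc i) f) + b12 * b13 * b23 * S i (S (Suc i) (S i f))"
    unfolding T1 T2 S_add S_mult S1 S2 S_invol S_braid[of i f] by (simp add: algebra_simps)
  have R: "T (Suc i) (T i (T (Suc i) f)) = (a23 * a23 * a12 + b23 * b32 * a13) * f + b12 * (a23 * a13) * S i f
     + b23 * (a23 * a12 + a13 * a32) * S (Suc i) f + a12 * b23 * b13 * S (Suc i) (S i f) + b12 * b13 * a23 * S i (S (Suc i) f) + b12 * b13 * b23 * S i (S (Suc i) (S i f))"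
    unfolding T1 T2 S_add S_mult S1 S2 S_invol S_braid[of i f] by (simp add: algebra_simps)
  show ?thesis using L R unfolding c1 c2 c3 by simp
qed

text \<open>The braid relation in the form that moves T_(i+1) across two inverses; expanding
  \<open>Tb\<close> and using the quadratic relation reduces it to \<open>T_braid\<close>.\<close>

lemma Tb_braid: "Tb (Suc i) (Tb i (T (Suc i) f)) = T i (Tb (Suc i) (Tb i f))"
  using T_braid[of i f]
  by (simp add: Tb_def T_diff one_minus_tt T_scal T_quadratic) (simp add: algebra_simps)

text \<open>A cross relation of the affine Hecke algebra: moving the variable past T_k turns T_k
  into t times its inverse, and conversely in \<open>Tb_xvar\<close>.\<close>

lemma T_xvar_Suc: "T k (xvar (Suc k) * f) = xvar k * Tb k f"
  unfolding Tb_def T_def S_mult S_xvar transpose_apply_second by (rule hecke_xvar) simp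

lemma Tb_xvar: "Tb k (xvar k * f) = xvar (Suc k) * T k f"
  unfolding Tb_def T_def S_mult S_xvar transpose_apply_first by (rule hecke_xvar) simp

lemma Tb_xvar_other: "j \<noteq> k \<Longrightarrow> j \<noteq> Suc k \<Longrightarrow> Tb k (xvar j * f) = xvar j * Tb k f"
  and T_xvar_other: "j \<noteq> k \<Longrightarrow> j \<noteq> Suc k \<Longrightarrow> T k (xvar j * f) = xvar j * T k f"
  by (simp_all add: Tb_invariant_mult T_invariant_mult S_xvar transpose_def)

subsection \<open>The affine rotation\<close>

text \<open>The substitution in the second relation of \<open>macdonald_E\<close>.\<close>

definition G :: "nat \<Rightarrow> ratfun \<Rightarrow> ratfun" where
  "G n = rsubst (\<lambda>i. if i \<in> {1..<n} then xvar (Suc i) else if i = n then scal (inverse qK) * xvar 1 else xvar i)"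

definition cyc :: "nat \<Rightarrow> nat \<Rightarrow> nat" where
  "cyc n i = (if i \<in> {1..<n} then Suc i else if i = n then 1 else i)"

lemma cyc_permutes: "n > 0 \<Longrightarrow> cyc n permutes {1..n}"
proof -
  assume n: "n > 0"
  have "bij_betw (cyc n) {1..n} {1..n}"
    by (rule bij_betw_byWitness[where f' = "\<lambda>i. if i = 1 then n else i - 1"]) (use n in \<open>auto simp: cyc_def\<close>)
  then show ?thesis by (rule bij_imp_permutes) (use n in \<open>auto simp: cyc_def\<close>)
qed

context
  fixes n :: nat assumes n: "n > 0"
begin

lemma G_args: "(if i \<in> {1..<n} then xvar (Suc i) else if i = n then scal (inverse qK) * xvar 1 else xvar i)
    = scal (if i = n then inverse qK else 1) * xvar (cyc n i)"
  using n by (auto simp: cyc_def)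

lemma G_cyc: "G n = rsubst (\<lambda>i. scal (if i = n then inverse qK else 1) * xvar (cyc n i))"
  unfolding G_def G_args ..

lemma bij_cyc: "bij (cyc n)"
  using cyc_permutes[OF n] by (rule permutes_bij)

lemma endo_G: "field_endo (G n)"
  unfolding G_cyc by (rule field_endo_rsubst[of _ "\<lambda>i. if i = n then inverse qK else 1" "cyc n"]) (simp_all add: bij_cyc)

lemma G_scal: "G n (scal k) = scal k"
  unfolding G_cyc by (rule rsubst_scal[of _ "\<lambda>i. if i = n then inverse qK else 1" "cyc n"]) (simp_all add: bij_cyc)

lemma G_xvar': "G n (xvar i) = scal (if i = n then inverse qK else 1) * xvar (cyc n i)"
  unfolding G_cyc by (rule rsubst_xvar[of _ "\<lambda>i. if i = n then inverse qK else 1" "cyc n"]) (simp_all add: bij_cyc)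

lemma G_xvar: "1 \<le> i \<Longrightarrow> i < n \<Longrightarrow> G n (xvar i) = xvar (Suc i)" "G n (xvar n) = scal (inverse qK) * xvar 1"
  using n by (simp_all add: G_xvar' cyc_def)

lemma G_xmon: "G n (xmon \<mu>) = scal (qK powi - lk \<mu> n) * xmon (permexp (cyc n) \<mu>)"
proof -
  have "mon (\<lambda>i. if i = n then inverse qK else 1) \<mu> = (\<Prod>i\<in>insert n (keys \<mu>). (if i = n then inverse qK else 1) powi lk \<mu> i)"
    by (rule mon_superset) auto
  also have "\<dots> = (\<Prod>i\<in>{n}. (if i = n then inverse qK else 1) powi lk \<mu> i)"
    by (rule prod.mono_neutral_right) auto
  also have "\<dots> = qK powi - lk \<mu> n" by (simp add: power_int_minus power_int_inverse)
  finally have m: "mon (\<lambda>i. if i = n then inverse qK else 1) \<mu> = qK powi - lk \<mu> n" .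
  have "G n (xmon \<mu>) = mon (\<lambda>i. scal (if i = n then inverse qK else 1) * xvar (cyc n i)) \<mu>"
    by (simp add: field_endo_xmon[OF endo_G] G_xvar')
  also have "\<dots> = scal (mon (\<lambda>i. if i = n then inverse qK else 1) \<mu>) * xmon (permexp (cyc n) \<mu>)"
    by (rule mon_scaled) (simp_all add: bij_cyc)
  finally show ?thesis using m by simp
qed

lemma G_S: "1 \<le> i \<Longrightarrow> Suc i < n \<Longrightarrow> G n (S i f) = S (Suc i) (G n f)"
proof (rule field_endo_eqI[where F = "\<lambda>f. G n (S i f)" and G = "\<lambda>f. S (Suc i) (G n f)"])
  fix j assume i: "1 \<le> i" "Suc i < n"
  have "cyc n (Transposition.transpose i (Suc i) j) = Transposition.transpose (Suc i) (Suc (Suc i)) (cyc n j)"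
    "Transposition.transpose i (Suc i) j = n \<longleftrightarrow> j = n"
    using i by (auto simp: transpose_def cyc_def)
  then show "G n (S i (xvar j)) = S (Suc i) (G n (xvar j))"
    by (simp only: S_xvar G_xvar' S_mult S_scal)
next
  show "field_endo (\<lambda>f. G n (S i f))" by (rule field_endo_comp[OF endo_G endo_S])
  show "field_endo (\<lambda>f. S (Suc i) (G n f))" by (rule field_endo_comp[OF endo_S endo_G])
qed (simp_all only: G_scal S_scal)

text \<open>A single rotation would turn s_(n-1) into an affine reflection; after two rotations it
  becomes s_1, since x_(n-1) and x_n have both picked up one factor q^(-1).\<close>

lemma G_G_S: "2 \<le> n \<Longrightarrow> G n (G n (S (n-1) f)) = S 1 (G n (G n f))"
proof (rule field_endo_eqI[where F = "\<lambda>f. G n (G n (S (n-1) f))" and G = "\<lambda>f. S 1 (G n (G n f))"])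
  fix j assume n2: "2 \<le> n"
  let ?s = "Transposition.transpose (n-1) (Suc (n-1))" and ?c = "\<lambda>i. if i = n then inverse qK else 1"
  have n1: "Suc (n-1) = n" using n2 by simp
  have *: "cyc n (cyc n (?s j)) = Transposition.transpose 1 (Suc 1) (cyc n (cyc n j)) \<and>
      ?c (?s j) * ?c (cyc n (?s j)) = ?c j * ?c (cyc n j)"
  proof -
    consider "j = n - 1" | "j = n" | "j \<noteq> n - 1" "j \<noteq> n" by blast
    then show ?thesis
    proof cases
      case 1
      then have "?s j = n" "cyc n j = n" "cyc n n = 1" "cyc n 1 = 2 \<or> n = 2 \<and> cyc n 1 = 2" "n \<noteq> 1" "j \<noteq> n"
        using n2 n1 by (auto simp: cyc_def)
      then show ?thesis using 1 n1 by (auto simp: transpose_def)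
    next
      case 2
      then have "?s j = n - 1" "cyc n j = 1" "cyc n (n - 1) = n" "cyc n 1 = 2" "cyc n n = 1" "n - 1 \<noteq> n" "n \<noteq> 1"
        using n2 n1 by (auto simp: cyc_def)
      then show ?thesis using 2 n1 by (auto simp: transpose_def)
    next
      case 3
      then have "?s j = j" using n1 by (simp add: transpose_def)
      moreover have "cyc n j \<noteq> n" "cyc n (cyc n j) \<noteq> 1" "cyc n (cyc n j) \<noteq> 2"
        using 3 n2 by (cases "j = 0"; cases "j < n"; simp add: cyc_def)+
      ultimately show ?thesis by (simp add: transpose_def)
    qed
  qed
  show "G n (G n (S (n-1) (xvar j))) = S 1 (G n (G n (xvar j)))"
    by (simp only: S_xvar G_xvar' S_mult S_scal G_scal field_endo_mult[OF endo_G] mult.assoc[symmetric] scal_mult[symmetric] conjunct1[OF *] conjunct2[OF *])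
next
  show "field_endo (\<lambda>f. G n (G n (S (n-1) f)))" by (rule field_endo_comp[OF endo_G field_endo_comp[OF endo_G endo_S]])
  show "field_endo (\<lambda>f. S 1 (G n (G n f)))" by (rule field_endo_comp[OF endo_S field_endo_comp[OF endo_G endo_G]])
qed (simp_all only: G_scal S_scal)

lemmas G_mult = field_endo_mult[OF endo_G] and G_add = field_endo_add[OF endo_G]
  and G_diff = field_endo_diff[OF endo_G] and G_divide = field_endo_divide[OF endo_G]
  and G_1 = field_endo_1[OF endo_G]

lemma G_T: "1 \<le> i \<Longrightarrow> Suc i < n \<Longrightarrow> G n (T i f) = T (Suc i) (G n f)"
  by (simp only: T_def G_mult G_add G_diff G_divide G_1 G_scal G_xvar G_S Suc_lessD Suc_eq_plus1[symmetric])

lemma G_Tb: "1 \<le> i \<Longrightarrow> Suc i < n \<Longrightarrow> G n (Tb i f) = Tb (Suc i) (G n f)"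
  by (simp only: Tb_def G_T G_mult G_diff G_1 G_scal)

lemma G_G_T:
  assumes "2 \<le> n"
  shows "G n (G n (T (n-1) f)) = T 1 (G n (G n f))"
proof -
  define c where "c = scal (inverse qK)"
  have c: "c \<noteq> 0" by (simp add: c_def)
  have n1: "Suc (n-1) = n" using assms by simp
  have 1: "G n (G n (xvar (n-1))) = c * xvar 1" "G n (G n (xvar (Suc (n-1)))) = c * xvar (Suc 1)"
    unfolding n1 using assms G_xvar(1)[of "n-1"] by (auto simp: G_xvar' G_mult G_scal cyc_def c_def)
  have "G n (G n (T (n-1) f)) = ((1 - tt) * (c * xvar 1) * G n (G n f) + (tt * (c * xvar 1) - c * xvar (Suc 1)) * S 1 (G n (G n f))) / (c * xvar 1 - c * xvar (Suc 1))"
    by (simp only: T_def G_mult G_add G_diff G_divide G_1 G_scal 1 G_G_S[OF assms])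
  also have "\<dots> = (c * ((1 - tt) * xvar 1 * G n (G n f) + (tt * xvar 1 - xvar (Suc 1)) * S 1 (G n (G n f)))) / (c * (xvar 1 - xvar (Suc 1)))"
    by (simp add: algebra_simps)
  also have "\<dots> = T 1 (G n (G n f))" using c unfolding T_def by (rule mult_divide_mult_cancel_left)
  finally show ?thesis .
qed

lemma G_G_Tb: "2 \<le> n \<Longrightarrow> G n (G n (Tb (n-1) f)) = Tb 1 (G n (G n f))"
  by (simp only: Tb_def G_mult G_diff G_1 G_scal G_G_T)

end

subsection \<open>Cherednik operators\<close>

text \<open>A product of consecutive operators over a half-open range, A_(m-1) ... A_(i+1) A_i,
  which is the identity for m <= i.\<close>

fun chain :: "(nat \<Rightarrow> 'a \<Rightarrow> 'a) \<Rightarrow> nat \<Rightarrow> nat \<Rightarrow> 'a \<Rightarrow> 'a" where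
  "chain A 0 i f = f"
| "chain A (Suc m) i f = (if i \<le> m then A m (chain A m i f) else f)"

lemma chain_empty: "m \<le> i \<Longrightarrow> chain A m i f = f"
  by (cases m) auto

lemma chain_first: "i < m \<Longrightarrow> chain A m i f = chain A m (Suc i) (A i f)"
proof (induction m)
  case (Suc m)
  then show ?case by (cases "i = m") (simp_all add: chain_empty)
qed simp

lemma chain_commute:
  "(\<And>k g. i \<le> k \<Longrightarrow> k < m \<Longrightarrow> B (A k g) = A k (B g)) \<Longrightarrow> B (chain A m i f) = chain A m i (B f)"
  by (induction m) auto

lemma chain_shift:
  "(\<And>k g. i \<le> k \<Longrightarrow> k < m \<Longrightarrow> B (A k g) = A (Suc k) (B g)) \<Longrightarrow> B (chain A m i f) = chain A (Suc m) (Suc i) (B f)"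
  by (induction m) auto

text \<open>T_(k+1) commutes with T_i, ..., T_(k-1), the braid relation at T_(k+1) T_k turns it into
  T_k, and T_k commutes with the remaining factors.\<close>

lemma chain_T_braid: "i \<le> k \<Longrightarrow> Suc k < m \<Longrightarrow> chain T m i (T (Suc k) f) = T k (chain T m i f)"
proof (induction m)
  case (Suc m)
  have m: "chain T (Suc m) i g = T m (chain T m i g)" for g using Suc.prems by simp
  show ?case
  proof (cases "Suc k = m")
    case True
    have k: "chain T m i g = T k (chain T k i g)" for g using Suc.prems unfolding True[symmetric] by simp
    have "T (Suc k) (chain T k i f) = chain T k i (T (Suc k) f)"
      by (rule chain_commute) (rule T_comm, simp)
    then have "chain T (Suc m) i (T (Suc k) f) = T m (T k (T (Suc k) (chain T k i f)))"
      by (simp only: m k)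
    also have "\<dots> = T k (T m (T k (chain T k i f)))"
      unfolding True[symmetric] by (rule T_braid[symmetric])
    finally show ?thesis by (simp only: m k)
  next
    case False
    then have "chain T m i (T (Suc k) f) = T k (chain T m i f)"
      using Suc by simp
    moreover have "T m (T k (chain T m i f)) = T k (T m (chain T m i f))"
      by (rule T_comm[symmetric]) (use Suc.prems False in simp)
    ultimately show ?thesis by (simp only: m)
  qed
qed simp

text \<open>The same passage through inverses, with \<open>Tb_braid\<close> at the critical
  place.\<close>

lemma chain_Tb_braid: "i \<le> k \<Longrightarrow> Suc k < m \<Longrightarrow> chain Tb m i (T (Suc k) f) = T k (chain Tb m i f)"
proof (induction m)
  case (Suc m)
  have m: "chain Tb (Suc m) i g = Tb m (chain Tb m i g)" for g using Suc.prems by simp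
  show ?case
  proof (cases "Suc k = m")
    case True
    have k: "chain Tb m i g = Tb k (chain Tb k i g)" for g using Suc.prems unfolding True[symmetric] by simp
    have "T (Suc k) (chain Tb k i f) = chain Tb k i (T (Suc k) f)"
      by (rule chain_commute) (rule T_Tb_comm, simp)
    then have "chain Tb (Suc m) i (T (Suc k) f) = Tb m (Tb k (T (Suc k) (chain Tb k i f)))"
      by (simp only: m k)
    also have "\<dots> = T k (Tb m (Tb k (chain Tb k i f)))"
      unfolding True[symmetric] by (rule Tb_braid)
    finally show ?thesis by (simp only: m k)
  next
    case False
    then have "chain Tb m i (T (Suc k) f) = T k (chain Tb m i f)"
      using Suc by simp
    moreover have "Tb m (T k (chain Tb m i f)) = T k (Tb m (chain Tb m i f))"
      by (rule T_Tb_comm[symmetric]) (use Suc.prems False in simp)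
    ultimately show ?thesis by (simp only: m)
  qed
qed simp

lemma chain_add: "(\<And>k f g. A k (f + g) = A k f + A k g) \<Longrightarrow> chain A m i (f + g) = chain A m i f + chain A m i (g::ratfun)"
  by (induction m) auto

lemma chain_scal: "(\<And>k f. A k (scal c * f) = scal c * A k f) \<Longrightarrow> chain A m i (scal c * f) = scal c * chain A m i f"
  by (induction m) auto

lemmas chain_T_add = chain_add[of T, OF T_add] and chain_Tb_add = chain_add[of Tb, OF Tb_add]
  and chain_T_scal = chain_scal[of T, OF T_scal] and chain_Tb_scal = chain_scal[of Tb, OF Tb_scal]

text \<open>The middle part common to two neighbouring Cherednik operators: Y_i = Z_i Tb_i and
  Y_(i+1) = T_i Z_i. The relations between these two and T_i follow from it.\<close>

definition Z :: "nat \<Rightarrow> nat \<Rightarrow> ratfun \<Rightarrow> ratfun" where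
  "Z n i f = chain T i 1 (G n (chain Tb n (Suc i) f))"

text \<open>Using \<open>Tb\<close> in place of inverses rescales the usual Cherednik operator by
  t^(n-i).\<close>

definition Y :: "nat \<Rightarrow> nat \<Rightarrow> ratfun \<Rightarrow> ratfun" where
  "Y n i f = chain T i 1 (G n (chain Tb n i f))"

context
  fixes n :: nat assumes n: "n > 0"
begin

lemma Y_add: "Y n i (f + g) = Y n i f + Y n i g"
  by (simp add: Y_def chain_T_add chain_Tb_add G_add[OF n])

lemma Y_scal: "Y n i (scal c * f) = scal c * Y n i f"
  by (simp add: Y_def chain_T_scal chain_Tb_scal G_mult[OF n] G_scal[OF n])

lemma Z_add: "Z n i (f + g) = Z n i f + Z n i g"
  by (simp add: Z_def chain_T_add chain_Tb_add G_add[OF n])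

lemma Z_scal: "Z n i (scal c * f) = scal c * Z n i f"
  by (simp add: Z_def chain_T_scal chain_Tb_scal G_mult[OF n] G_scal[OF n])

lemma Y_Z: "1 \<le> i \<Longrightarrow> i < n \<Longrightarrow> Y n i f = Z n i (Tb i f)" "1 \<le> i \<Longrightarrow> i < n \<Longrightarrow> Y n (Suc i) f = T i (Z n i f)"
  by (simp_all add: Y_def Z_def chain_first)

text \<open>Y_i T_i = Z_i Tb_i T_i = t Z_i, and Tb_i Y_(i+1) = Tb_i T_i Z_i is the same.\<close>

lemma Y_T_same: "1 \<le> i \<Longrightarrow> i < n \<Longrightarrow> Y n i (T i f) = Tb i (Y n (Suc i) f)"
  by (simp add: Y_Z Tb_T Z_scal del: add_Suc_right)

lemma Y_T_Suc: "1 \<le> i \<Longrightarrow> i < n \<Longrightarrow> Y n (Suc i) (T i f) = T i (Y n i f) + (1 - tt) * Y n (Suc i) f"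
proof -
  assume i: "1 \<le> i" "i < n"
  have "T i f = Tb i f + scal (1 - tK) * f" by (simp add: Tb_def one_minus_tt)
  then have "Z n i (T i f) = Y n i f + scal (1 - tK) * Z n i f" using i by (simp add: Z_add Z_scal Y_Z)
  then show ?thesis unfolding Y_Z(2)[OF i] by (simp add: T_add T_scal one_minus_tt)
qed

text \<open>T_i crosses the three blocks of Y_j with an index shift at the rotation. For j < i the
  chain of \<open>Tb\<close> lowers the index and G raises it back; for j > i+1 G raises it and the
  chain of T lowers it back.\<close>

lemma Y_T_other:
  assumes i: "1 \<le> i" "i < n" and j: "1 \<le> j" "j \<le> n" "j \<noteq> i" "j \<noteq> Suc i"
  shows "Y n j (T i f) = T i (Y n j f)"
proof (cases "j < i")
  case True
  have "chain Tb n j (T i f) = T (i-1) (chain Tb n j f)"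
    using chain_Tb_braid[of j "i-1" n f] i True by simp
  moreover have "G n (T (i-1) g) = T i (G n g)" for g
    using G_T[OF n, of "i-1"] i j True by simp
  moreover have "chain T j 1 (T i g) = T i (chain T j 1 g)" for g
    by (rule chain_commute[symmetric]) (rule T_comm, use True in simp)
  ultimately show ?thesis by (simp only: Y_def)
next
  case False
  have "chain Tb n j (T i f) = T i (chain Tb n j f)"
    by (rule chain_commute[symmetric]) (rule T_Tb_comm, use False j in simp)
  moreover have "G n (T i g) = T (Suc i) (G n g)" for g
    using G_T[OF n, of i] i j False by simp
  moreover have "chain T j 1 (T (Suc i) g) = T i (chain T j 1 g)" for g
    using chain_T_braid[of 1 i j g] i j False by simp
  ultimately show ?thesis by (simp only: Y_def)
qed

text \<open>The operator x_1 G intertwines Y_(i+1) with Y_i. The factor T_1 of Y_(i+1) converts x_2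
  into x_1 and becomes \<open>Tb 1\<close>, which before two rotations is the factor
  \<open>Tb (n-1)\<close> that Y_i has in addition.\<close>

lemma Y_Suc_rotation:
  assumes i: "1 \<le> i" "i < n"
  shows "Y n (Suc i) (xvar 1 * G n f) = xvar 1 * G n (Y n i f)"
proof -
  define h where "h = chain Tb (n-1) i f"
  have n2: "2 \<le> n" using i by simp
  have h1: "chain Tb n (Suc i) (G n f) = G n h"
    using chain_shift[of i "n-1" "G n" Tb f] G_Tb[OF n] i by (simp add: h_def)
  have h2: "Tb (n-1) h = chain Tb n i f"
    using i by (cases n) (simp_all add: h_def)
  have "chain Tb n (Suc i) (xvar 1 * G n f) = xvar 1 * chain Tb n (Suc i) (G n f)"
    by (rule chain_commute[symmetric]) (rule Tb_xvar_other[symmetric], use i in auto)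
  moreover have "G n (xvar 1 * g) = xvar (Suc 1) * G n g" for g
    using G_mult[OF n] G_xvar(1)[OF n, of 1] n2 by simp
  ultimately have "Y n (Suc i) (xvar 1 * G n f) = chain T (Suc i) 1 (xvar (Suc 1) * G n (G n h))"
    by (simp only: Y_def h1)
  also have "\<dots> = chain T (Suc i) (Suc 1) (T 1 (xvar (Suc 1) * G n (G n h)))"
    using chain_first[of 1 "Suc i" T] i by simp
  also have "\<dots> = chain T (Suc i) (Suc 1) (xvar 1 * G n (G n (Tb (n-1) h)))"
    by (simp only: T_xvar_Suc G_G_Tb[OF n n2])
  also have "\<dots> = xvar 1 * chain T (Suc i) (Suc 1) (G n (G n (chain Tb n i f)))"
    unfolding h2 by (rule chain_commute[symmetric]) (rule T_xvar_other[symmetric], auto)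
  also have "chain T (Suc i) (Suc 1) (G n (G n (chain Tb n i f))) = G n (Y n i f)"
    using chain_shift[of 1 i "G n" T "G n (chain Tb n i f)"] G_T[OF n] i by (simp add: Y_def)
  finally show ?thesis .
qed

lemma chain_Tb_xvar: "1 \<le> m \<Longrightarrow> chain Tb m 1 (xvar 1 * f) = xvar m * chain T m 1 f"
proof (induction m)
  case (Suc m)
  show ?case
  proof (cases "m = 0")
    case False
    then have "chain Tb (Suc m) 1 (xvar 1 * f) = Tb m (xvar m * chain T m 1 f)"
      using Suc by simp
    then show ?thesis using False by (simp add: Tb_xvar)
  qed simp
qed simp

text \<open>The variable x_1 crosses the chain of \<open>Tb\<close>, turns every \<open>Tb\<close>
  into T and emerges as x_n, which the rotation returns as q^(-1) x_1.\<close>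

lemma Y_1_rotation: "Y n 1 (xvar 1 * G n f) = scal (inverse qK) * (xvar 1 * G n (Y n n f))"
proof -
  have "Y n 1 (xvar 1 * G n f) = G n (xvar n * chain T n 1 (G n f))"
    using n chain_Tb_xvar[of n] unfolding Y_def by (simp add: chain_empty)
  moreover have "Y n n f = chain T n 1 (G n f)" by (simp add: Y_def chain_empty)
  ultimately show ?thesis by (simp only: G_mult[OF n] G_xvar(2)[OF n] mult.assoc)
qed

end

subsection \<open>Exponent vectors\<close>

lemma lookup_zvec: "lk (zvec n f) i = (if i \<in> {1..n} then f i else 0)"
proof -
  have "lk (zvec n f) i = (\<Sum>j\<in>{1..n}. if j = i then f j else 0)"
    by (simp add: zvec_def lookup_sum lookup_single when_def)
  then show ?thesis by simp
qed

lemma Zn_iff: "\<mu> \<in> Zn n \<longleftrightarrow> (\<forall>i. i \<notin> {1..n} \<longrightarrow> lk \<mu> i = 0)"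
  unfolding Zn_def by (auto simp: in_keys_iff subset_iff)

lemma Zn_eqI: "\<mu> \<in> Zn n \<Longrightarrow> \<nu> \<in> Zn n \<Longrightarrow> (\<And>i. i \<in> {1..n} \<Longrightarrow> lk \<mu> i = lk \<nu> i) \<Longrightarrow> \<mu> = \<nu>"
  by (rule poly_mapping_eqI) (metis Zn_iff)

lemma zvec_Zn: "zvec n f \<in> Zn n"
  by (simp add: Zn_iff lookup_zvec)

section \<open>The three moves on exponents\<close>

definition rot :: "nat \<Rightarrow> (nat \<Rightarrow>\<^sub>0 int) \<Rightarrow> (nat \<Rightarrow>\<^sub>0 int)" where
  "rot n \<mu> = zvec n (\<lambda>i. if i = 1 then lk \<mu> n + 1 else lk \<mu> (i - 1))"

definition swap :: "nat \<Rightarrow> nat \<Rightarrow> (nat \<Rightarrow>\<^sub>0 int) \<Rightarrow> (nat \<Rightarrow>\<^sub>0 int)" where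
  "swap n i \<mu> = vact n (sref i) \<mu>"

definition down :: "nat \<Rightarrow> (nat \<Rightarrow>\<^sub>0 int) \<Rightarrow> (nat \<Rightarrow>\<^sub>0 int)" where
  "down n \<mu> = zvec n (\<lambda>i. lk \<mu> i - 1)"

lemma lookup_swap: "lk (swap n i \<mu>) j = (if j \<in> {1..n} then lk \<mu> (Transposition.transpose i (Suc i) j) else 0)"
  by (simp add: swap_def vact_def lookup_zvec)

lemma lookup_rot: "0 < n \<Longrightarrow> i \<in> {1..n} \<Longrightarrow> lk (rot n \<mu>) (cyc n i) = (if i = n then lk \<mu> n + 1 else lk \<mu> i)"
  by (auto simp: rot_def lookup_zvec cyc_def)

lemma rot_Zn: "rot n \<mu> \<in> Zn n" and swap_Zn: "swap n i \<mu> \<in> Zn n" and down_Zn: "down n \<mu> \<in> Zn n"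
  by (simp_all add: rot_def swap_def down_def vact_def zvec_Zn)

lemma lookup_down: "lk (down n \<mu>) i = (if i \<in> {1..n} then lk \<mu> i - 1 else 0)"
  by (simp add: down_def lookup_zvec)

definition nonneg :: "nat \<Rightarrow> (nat \<Rightarrow>\<^sub>0 int) \<Rightarrow> bool" where
  "nonneg n \<mu> \<longleftrightarrow> (\<forall>j\<in>{1..n}. 0 \<le> lk \<mu> j)"

lemma sum_transpose:
  fixes f :: "nat \<Rightarrow> int"
  assumes "1 \<le> i" "i < n"
  shows "(\<Sum>j\<in>{1..n}. f (Transposition.transpose i (Suc i) j)) = (\<Sum>j\<in>{1..n}. f j)"
  by (rule sum.reindex_bij_betw, rule bij_betw_transpose_iff) (use assms in auto)

text \<open>For nonnegative exponents this is an induction on the total weight: a positive entry is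
  brought to the first position by undoing swaps, and undoing a rotation then lowers the weight.
  Other exponents are obtained by lowering nonnegative ones.\<close>

lemma Zn_induct [consumes 2, case_names zero rot swap down]:
  assumes n: "0 < n" and "\<mu> \<in> Zn n"
    and zero: "P 0"
    and rot: "\<And>\<mu>. \<mu> \<in> Zn n \<Longrightarrow> P \<mu> \<Longrightarrow> P (rot n \<mu>)"
    and swap: "\<And>\<mu> i. \<mu> \<in> Zn n \<Longrightarrow> 1 \<le> i \<Longrightarrow> i < n \<Longrightarrow> nonneg n \<mu> \<Longrightarrow> lk \<mu> (Suc i) < lk \<mu> i \<Longrightarrow> P \<mu> \<Longrightarrow> P (swap n i \<mu>)"
    and down: "\<And>\<mu>. \<mu> \<in> Zn n \<Longrightarrow> P \<mu> \<Longrightarrow> P (down n \<mu>)"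
  shows "P \<mu>"
proof -
  have nn: "P \<mu>" if "\<mu> \<in> Zn n" "nonneg n \<mu>" for \<mu>
    using that
  proof (induction "nat (wt_sum n \<mu>)" arbitrary: \<mu> rule: less_induct)
    case less
    have pos: "P \<nu>" if "p \<in> {1..n}" "0 < lk \<nu> p" "\<nu> \<in> Zn n" "nonneg n \<nu>" "wt_sum n \<nu> = wt_sum n \<mu>" for p \<nu>
      using that
    proof (induction p arbitrary: \<nu>)
      case (Suc p)
      show ?case
      proof (cases "p = 0")
        case True
        \<comment> \<open>The inverse rotation of \<open>\<nu>\<close>; it stays nonnegative because
          the first entry is positive.\<close>
        define \<kappa> where "\<kappa> = zvec n (\<lambda>i. if i = n then lk \<nu> 1 - 1 else lk \<nu> (Suc i))"
        have \<kappa>: "\<kappa> \<in> Zn n" by (simp add: \<kappa>_def zvec_Zn)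
        have pos1: "0 < lk \<nu> 1" using Suc.prems(2) True by simp
        have rn: "rot n \<kappa> = \<nu>"
        proof (rule Zn_eqI[OF rot_Zn Suc.prems(3)])
          fix i assume "i \<in> {1..n}"
          then show "lk (rot n \<kappa>) i = lk \<nu> i" by (auto simp: rot_def lookup_zvec \<kappa>_def)
        qed
        have "nonneg n \<kappa>" using Suc.prems(4) pos1 by (auto simp: nonneg_def \<kappa>_def lookup_zvec)
        moreover have "wt_sum n \<nu> = wt_sum n \<kappa> + 1"
        proof -
          have "wt_sum n \<nu> = (\<Sum>i\<in>{1..n}. lk \<nu> (cyc n i))"
            unfolding wt_sum_def by (rule sum.reindex_bij_betw[symmetric, OF permutes_imp_bij[OF cyc_permutes[OF n]]])
          also have "\<dots> = (\<Sum>i\<in>{1..n}. lk \<kappa> i + (if i = n then 1 else 0))"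
            by (rule sum.cong) (use lookup_rot[OF n, of _ \<kappa>] rn in auto)
          also have "\<dots> = wt_sum n \<kappa> + 1" using n by (simp add: sum.distrib wt_sum_def)
          finally show ?thesis .
        qed
        moreover have "0 \<le> wt_sum n \<kappa>"
          using \<open>nonneg n \<kappa>\<close> unfolding wt_sum_def nonneg_def by (intro sum_nonneg) auto
        ultimately have "P \<kappa>" using less.hyps[of \<kappa>] \<kappa> Suc.prems(5) by simp
        then show ?thesis using rot[OF \<kappa>] rn by simp
      next
        case False
        show ?thesis
        proof (cases "lk \<nu> p > 0")
          case True
          then show ?thesis using Suc False by auto
        next
          case np: False
          have p: "1 \<le> p" "p < n" using Suc.prems(1) False by auto
          \<comment> \<open>The preceding entry is 0, so \<open>\<nu>\<close> arises from its own
            swap at a strict descent, as the swap case demands.\<close>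
          then have p0: "lk \<nu> p = 0" using np Suc.prems(4) by (force simp: nonneg_def)
          let ?\<kappa> = "swap n p \<nu>"
          have "lk ?\<kappa> p > 0" using Suc.prems p by (simp add: lookup_swap)
          moreover have nk: "nonneg n ?\<kappa>"
            using Suc.prems(4) p by (auto simp: nonneg_def lookup_swap transpose_def)
          moreover have "wt_sum n ?\<kappa> = wt_sum n \<nu>"
            using sum_transpose[of p n "lk \<nu>"] p by (simp add: wt_sum_def lookup_swap)
          ultimately have "P ?\<kappa>" using Suc.IH[of ?\<kappa>] p Suc.prems(5) swap_Zn by simp
          then have "P (swap n p ?\<kappa>)"
            using swap[OF swap_Zn p nk] p p0 Suc.prems(1,2) by (simp add: lookup_swap)
          moreover have "swap n p ?\<kappa> = \<nu>"
          proof (rule Zn_eqI[OF swap_Zn Suc.prems(3)])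
            fix i assume "i \<in> {1..n}"
            then show "lk (swap n p ?\<kappa>) i = lk \<nu> i" using p by (auto simp: lookup_swap transpose_def)
          qed
          ultimately show ?thesis by simp
        qed
      qed
    qed simp
    show ?case
    proof (cases "\<exists>p\<in>{1..n}. 0 < lk \<mu> p")
      case True
      then show ?thesis using pos less.prems by blast
    next
      case False
      then have "\<mu> = 0"
        using less.prems(2) by (intro Zn_eqI[OF less.prems(1)]) (force simp: Zn_iff nonneg_def)+
      then show ?thesis using zero by simp
    qed
  qed
  have "P \<mu>" if "\<mu> \<in> Zn n" "\<forall>j\<in>{1..n}. - int k \<le> lk \<mu> j" for k \<mu>
    using that
  proof (induction k arbitrary: \<mu>)
    case 0
    then show ?case using nn by (simp add: nonneg_def)
  next
    case (Suc k)
    let ?\<nu> = "zvec n (\<lambda>i. lk \<mu> i + 1)"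
    have "P ?\<nu>" using Suc.prems(2) by (intro Suc.IH) (auto simp: zvec_Zn lookup_zvec)
    moreover have "down n ?\<nu> = \<mu>"
      by (rule Zn_eqI[OF down_Zn Suc.prems(1)]) (simp add: lookup_down lookup_zvec)
    ultimately show ?case using down[OF zvec_Zn, of "\<lambda>i. lk \<mu> i + 1"] by simp
  qed
  moreover have "\<exists>k. \<forall>j\<in>{1..n}. - int k \<le> lk \<mu> j"
  proof -
    have "- int (\<Sum>j\<in>{1..n}. nat \<bar>lk \<mu> j\<bar>) \<le> lk \<mu> j" if "j \<in> {1..n}" for j
    proof -
      have "nat \<bar>lk \<mu> j\<bar> \<le> (\<Sum>j\<in>{1..n}. nat \<bar>lk \<mu> j\<bar>)" using that by (intro member_le_sum) auto
      then show ?thesis by linarith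
    qed
    then show ?thesis by blast
  qed
  ultimately show ?thesis using assms(2) by blast
qed

subsection \<open>The sorting permutation\<close>

text \<open>Order by value, ties by position. The closed formula of \<open>vperm\<close> is the rank
  in this total order.\<close>

definition vleq :: "(nat \<Rightarrow>\<^sub>0 int) \<Rightarrow> nat \<Rightarrow> nat \<Rightarrow> bool" where
  "vleq \<mu> a b \<longleftrightarrow> lk \<mu> a < lk \<mu> b \<or> lk \<mu> a = lk \<mu> b \<and> a \<le> b"

lemma vperm_rank:
  assumes "r \<in> {1..n}"
  shows "vperm n \<mu> r = card {a \<in> {1..n}. vleq \<mu> a r}"
proof -
  let ?A = "{a \<in> {1..n}. a < r \<and> lk \<mu> a \<le> lk \<mu> r}" and ?B = "{a \<in> {1..n}. a > r \<and> lk \<mu> a < lk \<mu> r}"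
  have "{a \<in> {1..n}. vleq \<mu> a r} = insert r (?A \<union> ?B)"
    using assms by (auto simp: vleq_def)
  then have "card {a \<in> {1..n}. vleq \<mu> a r} = Suc (card (?A \<union> ?B))" by simp
  also have "card (?A \<union> ?B) = card ?A + card ?B"
    by (rule card_Un_disjoint) auto
  finally show ?thesis using assms by (simp add: vperm_def)
qed

text \<open>Ranks are carried along by any order-preserving bijection of positions; this serves both
  rotation and swap.\<close>

lemma vperm_transport:
  assumes \<sigma>: "bij_betw \<sigma> {1..n} {1..n}"
    and eq: "\<And>a b. a \<in> {1..n} \<Longrightarrow> b \<in> {1..n} \<Longrightarrow> vleq \<nu> (\<sigma> a) (\<sigma> b) \<longleftrightarrow> vleq \<mu> a b"
    and r: "r \<in> {1..n}"
  shows "vperm n \<nu> (\<sigma> r) = vperm n \<mu> r"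
proof -
  have r': "\<sigma> r \<in> {1..n}" using \<sigma> r by (auto simp: bij_betw_def)
  have "{a \<in> {1..n}. vleq \<nu> a (\<sigma> r)} = \<sigma> ` {a \<in> {1..n}. vleq \<mu> a r}"
  proof -
    have "{a \<in> {1..n}. vleq \<nu> a (\<sigma> r)} = {a \<in> \<sigma> ` {1..n}. vleq \<nu> a (\<sigma> r)}"
      using \<sigma> by (simp add: bij_betw_def)
    also have "\<dots> = \<sigma> ` {a \<in> {1..n}. vleq \<mu> a r}" using eq[OF _ r] by auto
    finally show ?thesis .
  qed
  moreover have "inj_on \<sigma> {a \<in> {1..n}. vleq \<mu> a r}"
    using \<sigma> by (auto simp: bij_betw_def intro: inj_on_subset)
  ultimately show ?thesis using r r' by (simp add: vperm_rank card_image)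
qed

lemma vperm_less_iff:
  assumes "a \<in> {1..n}" "b \<in> {1..n}"
  shows "vperm n \<mu> a < vperm n \<mu> b \<longleftrightarrow> vleq \<mu> a b \<and> a \<noteq> b"
proof -
  have *: "vperm n \<mu> a < vperm n \<mu> b" if "a \<in> {1..n}" "b \<in> {1..n}" "vleq \<mu> a b" "a \<noteq> b" for a b
  proof -
    have "b \<in> {c \<in> {1..n}. vleq \<mu> c b}" "b \<notin> {c \<in> {1..n}. vleq \<mu> c a}"
      using that by (auto simp: vleq_def)
    moreover have "{c \<in> {1..n}. vleq \<mu> c a} \<subseteq> {c \<in> {1..n}. vleq \<mu> c b}"
      using that by (auto simp: vleq_def)
    ultimately have "{c \<in> {1..n}. vleq \<mu> c a} \<subset> {c \<in> {1..n}. vleq \<mu> c b}" by blast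
    then show ?thesis using that by (simp add: vperm_rank psubset_card_mono)
  qed
  have "vleq \<mu> a b \<or> vleq \<mu> b a" by (auto simp: vleq_def)
  then show ?thesis using *[of a b] *[of b a] assms by (cases "a = b") (auto simp: vleq_def)
qed

lemma vperm_permutes: "vperm n \<mu> permutes {1..n}"
proof -
  have "vperm n \<mu> r \<in> {1..n}" if "r \<in> {1..n}" for r
  proof -
    have "{a \<in> {1..n}. vleq \<mu> a r} \<noteq> {}" using that by (auto simp: vleq_def)
    moreover have "card {a \<in> {1..n}. vleq \<mu> a r} \<le> card {1..n}" by (rule card_mono) auto
    ultimately show ?thesis using that by (simp add: vperm_rank card_gt_0_iff Suc_le_eq)
  qed
  moreover have "inj_on (vperm n \<mu>) {1..n}"
  proof (rule inj_onI, rule ccontr)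
    fix a b assume ab: "a \<in> {1..n}" "b \<in> {1..n}" "vperm n \<mu> a = vperm n \<mu> b" "a \<noteq> b"
    have "vleq \<mu> a b \<or> vleq \<mu> b a" by (auto simp: vleq_def)
    then show False using vperm_less_iff[of a n b \<mu>] vperm_less_iff[of b n a \<mu>] ab by auto
  qed
  ultimately have "bij_betw (vperm n \<mu>) {1..n} {1..n}"
    by (simp add: bij_betw_def endo_inj_surj image_subset_iff)
  then show ?thesis by (rule bij_imp_permutes) (auto simp: vperm_def)
qed

text \<open>The rotated entry grows by one and moves to the front: as the last entry it won all
  ties, and now it is strictly larger than the entries it was tied with.\<close>

lemma vperm_rot: "0 < n \<Longrightarrow> r \<in> {1..n} \<Longrightarrow> vperm n (rot n \<mu>) (cyc n r) = vperm n \<mu> r"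
proof (rule vperm_transport)
  assume n: "0 < n"
  show "bij_betw (cyc n) {1..n} {1..n}" by (rule permutes_imp_bij[OF cyc_permutes[OF n]])
  fix a b assume "a \<in> {1..n}" "b \<in> {1..n}"
  then show "vleq (rot n \<mu>) (cyc n a) (cyc n b) = vleq \<mu> a b"
    using n by (auto simp: vleq_def lookup_rot) (auto simp: cyc_def)
qed

text \<open>The two exchanged entries differ, so no tie is resolved differently.\<close>

lemma vperm_swap:
  assumes i: "1 \<le> i" "i < n" and desc: "lk \<mu> (Suc i) < lk \<mu> i" and r: "r \<in> {1..n}"
  shows "vperm n (swap n i \<mu>) (Transposition.transpose i (Suc i) r) = vperm n \<mu> r"
proof (rule vperm_transport[OF _ _ r])
  show "bij_betw (Transposition.transpose i (Suc i)) {1..n} {1..n}"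
    by (rule bij_betw_transpose_iff) (use i in auto)
  fix a b assume ab: "a \<in> {1..n}" "b \<in> {1..n}"
  let ?s = "Transposition.transpose i (Suc i)"
  have s: "lk (swap n i \<mu>) (?s c) = lk \<mu> c" if "c \<in> {1..n}" for c
    using that i by (auto simp: lookup_swap transpose_def)
  have "?s a \<le> ?s b \<longleftrightarrow> a \<le> b" if "lk \<mu> a = lk \<mu> b"
  proof -
    have "\<not> (a = i \<and> b = Suc i)" "\<not> (a = Suc i \<and> b = i)" using that desc by auto
    then show ?thesis by (auto simp: transpose_def)
  qed
  then show "vleq (swap n i \<mu>) (?s a) (?s b) = vleq \<mu> a b" using ab by (auto simp: vleq_def s)
qed

lemma vperm_down: "vperm n (down n \<mu>) r = vperm n \<mu> r"
proof (cases "r \<in> {1..n}")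
  case True
  then show ?thesis
    by (auto simp: vperm_rank vleq_def lookup_down intro!: arg_cong[of _ _ card])
next
  case False
  then show ?thesis by (simp only: vperm_def if_False)
qed

lemma vperm_zero: "r \<in> {1..n} \<Longrightarrow> vperm n 0 r = r"
proof -
  assume r: "r \<in> {1..n}"
  then have "{a \<in> {1..n}. vleq 0 a r} = {1..r}" by (auto simp: vleq_def)
  then show ?thesis using r by (simp add: vperm_rank)
qed

subsection \<open>Macdonald polynomials are eigenvectors of the Cherednik operators\<close>

text \<open>Moving negative exponents to the other side reduces this to comparing monomials of
  C[q][t^(1/2)]. The denominators that occur after evaluation are nonzero by this fact.\<close>

lemma q_t_independent:
  assumes "qK powi m * thalf powi k = 1"
  shows "m = 0 \<and> k = 0"
proof -
  have nat: "a = b \<and> c = d" if "qK ^ a * thalf ^ c = qK ^ b * thalf ^ d" for a b c d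
  proof -
    have "qK ^ a * thalf ^ c = to_fract (monom (monom 1 a) c)" for a c
    proof -
      have q: "[:[:0, 1 :: complex:]:] ^ a = [:monom 1 a:]" for a
        by (simp add: poly_const_pow monom_altdef)
      have h: "[:0, 1 :: complex poly:] ^ c = monom 1 c" for c
        by (simp add: monom_altdef)
      have p: "to_fract (p ^ j) = to_fract p ^ j" for p :: "complex poly poly" and j
        by (induction j) simp_all
      have "qK ^ a * thalf ^ c = to_fract ([:monom 1 a:] * monom 1 c)"
        by (simp add: qK_def thalf_def flip: p q h)
      then show ?thesis by (simp add: smult_monom)
    qed
    then have "monom (monom (1::complex) a) c = monom (monom 1 b) d" using that by simp
    then show ?thesis by (simp add: monom_eq_iff')
  qed
  have pw: "x powi j = x ^ nat j / x ^ nat (- j)" if "x \<noteq> 0" for x :: K and j :: int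
    using that by (simp add: power_int_def power_inverse divide_inverse)
  have "qK ^ nat m * thalf ^ nat k = qK ^ nat (- m) * thalf ^ nat (- k)"
    using assms unfolding pw[OF qK_nonzero] pw[OF thalf_nonzero] by (simp add: field_simps)
  then have "nat m = nat (- m) \<and> nat k = nat (- k)" by (rule nat)
  then show ?thesis by auto
qed

lemma tK_powi: "tK powi k = thalf powi (2 * k)"
  by (simp add: tK_def power_int_mult)

lemma q_t_ne_1: "m \<noteq> 0 \<or> d \<noteq> 0 \<Longrightarrow> qK powi m * tK powi d \<noteq> 1"
  using q_t_independent[of m "2 * d"] by (auto simp: tK_powi)

text \<open>The eigenvalue of \<open>Y n j\<close> on E_mu. At mu = 0 it is t^(n-j), one factor t
  for each \<open>Tb\<close> in \<open>Y n j\<close>.\<close>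

definition yval :: "nat \<Rightarrow> (nat \<Rightarrow>\<^sub>0 int) \<Rightarrow> nat \<Rightarrow> K" where
  "yval n \<mu> j = qK powi (- lk \<mu> j) * tK powi (int n - int (vperm n \<mu> j))"

text \<open>The scalar a of the second relation; by \<open>yval_Suc\<close> it is also the quotient
  of two neighbouring eigenvalues.\<close>

definition aval :: "nat \<Rightarrow> (nat \<Rightarrow>\<^sub>0 int) \<Rightarrow> nat \<Rightarrow> K" where
  "aval n \<mu> i = qK powi (lk \<mu> i - lk \<mu> (Suc i)) * tK powi (int (vperm n \<mu> i) - int (vperm n \<mu> (Suc i)))"

lemma yval_Suc: "yval n \<mu> (Suc i) = aval n \<mu> i * yval n \<mu> i"
  by (simp add: yval_def aval_def power_int_diff power_int_minus field_simps)

lemma aval_ne_1: "lk \<mu> (Suc i) < lk \<mu> i \<Longrightarrow> aval n \<mu> i \<noteq> 1"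
  unfolding aval_def by (rule q_t_ne_1) simp

definition bval :: "nat \<Rightarrow> (nat \<Rightarrow>\<^sub>0 int) \<Rightarrow> nat \<Rightarrow> K" where
  "bval n \<mu> i = (1 - tK) * aval n \<mu> i / (1 - aval n \<mu> i)"

lemma ddiff_T: "ddiff i (xvar i * f) - scal tK * xvar i * ddiff i f = T i f"
proof -
  have "ddiff i (xvar i * f) - scal tK * xvar i * ddiff i f
      = (xvar i * f - xvar (Suc i) * S i f - tt * xvar i * (f - S i f)) / (xvar i - xvar (Suc i))"
    by (simp add: ddiff_def S_mult S_xvar diff_divide_distrib right_diff_distrib)
  also have "xvar i * f - xvar (Suc i) * S i f - tt * xvar i * (f - S i f)
      = (1 - tt) * xvar i * f + (tt * xvar i - xvar (Suc i)) * S i f" by (simp add: algebra_simps)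
  finally show ?thesis by (simp only: T_def)
qed

context
  fixes n :: nat and E :: "(nat \<Rightarrow>\<^sub>0 int) \<Rightarrow> ratfun"
  assumes n: "0 < n" and E: "macdonald_E n E"
begin

lemma E_Laurent: "\<mu> \<in> Zn n \<Longrightarrow> E \<mu> \<in> laurent_polys n" and E_zero: "E 0 = 1"
  using E by (auto simp: macdonald_E_def)

lemma E_rot: "\<mu> \<in> Zn n \<Longrightarrow> E (rot n \<mu>) = scal (qK powi lk \<mu> n) * (xvar 1 * G n (E \<mu>))"
  using E unfolding macdonald_E_def rot_def G_def mult.assoc Suc_eq_plus1 by blast

lemma E_swap:
  assumes "\<mu> \<in> Zn n" "1 \<le> i" "i < n" "nonneg n \<mu>" "lk \<mu> (Suc i) < lk \<mu> i"
  shows "E (swap n i \<mu>) = T i (E \<mu>) + scal (bval n \<mu> i) * E \<mu>"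
proof -
  have "E (swap n i \<mu>) = ddiff i (xvar i * E \<mu>) - scal tK * xvar i * ddiff i (E \<mu>) + scal (bval n \<mu> i) * E \<mu>"
    using E assms unfolding macdonald_E_def nonneg_def swap_def bval_def aval_def by (simp add: Let_def)
  then show ?thesis by (simp only: ddiff_T)
qed

lemma E_down: "\<mu> \<in> Zn n \<Longrightarrow> E (down n \<mu>) = (\<Prod>i\<in>{1..n}. inverse (xvar i)) * E \<mu>"
  using E unfolding macdonald_E_def down_def by blast

lemma Y_1: "1 \<le> j \<Longrightarrow> j \<le> n \<Longrightarrow> Y n j 1 = scal (tK ^ (n - j))"
proof -
  assume j: "1 \<le> j" "j \<le> n"
  have b: "Tb k (scal c) = scal (tK * c)" for k c
    using Tb_scal[of k c 1] by (simp add: Tb_def T_1 scal_mult mult.commute)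
  have c1: "chain Tb m j 1 = scal (tK ^ (m - j))" for m
    by (induction m) (auto simp: b Suc_diff_le)
  have c2: "chain T m 1 (scal c) = scal c" for m c
  proof (induction m)
    case (Suc m)
    then show ?case using T_scal[of m c 1] by (simp add: T_1)
  qed simp
  show ?thesis by (simp add: Y_def c1 G_scal[OF n] c2[unfolded One_nat_def])
qed

text \<open>The product of the inverse variables is symmetric, hence passes through all T_k with 1
  <= k < n, and the rotation multiplies it by q.\<close>

lemma Y_inverse_xvars: "1 \<le> j \<Longrightarrow> j \<le> n \<Longrightarrow>
  Y n j ((\<Prod>i\<in>{1..n}. inverse (xvar i)) * f) = scal qK * ((\<Prod>i\<in>{1..n}. inverse (xvar i)) * Y n j f)"
proof -
  assume j: "1 \<le> j" "j \<le> n"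
  define p where "p = (\<Prod>i\<in>{1..n}. inverse (xvar i))"
  have Sp: "S k p = p" if "1 \<le> k" "k < n" for k
  proof -
    have "S k p = (\<Prod>i\<in>{1..n}. inverse (xvar (Transposition.transpose k (Suc k) i)))"
      unfolding p_def field_endo_prod[OF endo_S] field_endo_inverse[OF endo_S] S_xvar ..
    also have "\<dots> = p" unfolding p_def
      by (rule prod.reindex_bij_betw, rule bij_betw_transpose_iff) (use that in auto)
    finally show ?thesis .
  qed
  have Gp: "G n p = scal qK * p"
  proof -
    have "G n p = (\<Prod>i\<in>{1..n}. inverse (scal (if i = n then inverse qK else 1)) * inverse (xvar (cyc n i)))"
      unfolding p_def field_endo_prod[OF endo_G[OF n]] field_endo_inverse[OF endo_G[OF n]] G_xvar'[OF n] inverse_mult_distrib ..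
    also have "\<dots> = (\<Prod>i\<in>{1..n}. inverse (scal (if i = n then inverse qK else 1))) * (\<Prod>i\<in>{1..n}. inverse (xvar (cyc n i)))"
      by (rule prod.distrib)
    also have "(\<Prod>i\<in>{1..n}. inverse (xvar (cyc n i))) = p" unfolding p_def
      by (rule prod.reindex_bij_betw[OF permutes_imp_bij[OF cyc_permutes[OF n]]])
    also have "(\<Prod>i\<in>{1..n}. inverse (scal (if i = n then inverse qK else 1))) = (\<Prod>i\<in>{1..n}. if i = n then scal qK else 1)"
      by (rule prod.cong) (simp_all add: scal_inverse)
    also have "\<dots> = scal qK" using n by simp
    finally show ?thesis .
  qed
  have 1: "chain Tb n j (p * f) = p * chain Tb n j f" for f
    by (rule chain_commute[symmetric]) (rule Tb_invariant_mult[symmetric], rule Sp, use j in auto)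
  have 2: "chain T j 1 (p * f) = p * chain T j 1 f" for f
    by (rule chain_commute[symmetric]) (rule T_invariant_mult[symmetric], rule Sp, use j in auto)
  have "Y n j (p * f) = scal qK * (p * Y n j f)"
    unfolding Y_def 1 G_mult[OF n] Gp mult.assoc chain_T_scal 2 ..
  then show ?thesis by (simp only: p_def)
qed

lemma E_eigenvector: "\<mu> \<in> Zn n \<Longrightarrow> \<forall>j\<in>{1..n}. Y n j (E \<mu>) = scal (yval n \<mu> j) * E \<mu>"
  using n
proof (induction \<mu> rule: Zn_induct)
  case zero
  show ?case by (auto simp: E_zero Y_1 yval_def vperm_zero of_nat_diff simp flip: power_int_of_nat)
next
  case (rot \<mu>)
  show ?case
  proof
    fix j assume j: "j \<in> {1..n}"
    let ?c = "scal (qK powi lk \<mu> n)"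
    show "Y n j (E (rot n \<mu>)) = scal (yval n (rot n \<mu>) j) * E (rot n \<mu>)"
    proof (cases "j = 1")
      case True
      have v: "yval n (rot n \<mu>) j = inverse qK * yval n \<mu> n"
        using n vperm_rot[of n n \<mu>] lookup_rot[of n n \<mu>]
        by (simp add: yval_def True cyc_def power_int_diff power_int_minus power_int_add field_simps)
      have "Y n n (E \<mu>) = scal (yval n \<mu> n) * E \<mu>" using rot n by simp
      then show ?thesis
        unfolding E_rot[OF rot.hyps] True Y_scal[OF n] Y_1_rotation[OF n] v[unfolded True] scal_mult
        by (simp only: G_mult[OF n] G_scal[OF n]) (simp add: mult_ac)
    next
      case False
      then obtain i where i: "j = Suc i" "1 \<le> i" "i < n" using j by (cases j) auto
      have ci: "cyc n i = j" using i by (simp add: cyc_def)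
      have v: "yval n (rot n \<mu>) j = yval n \<mu> i"
        using n i vperm_rot[of n i \<mu>] lookup_rot[of n i \<mu>] by (simp add: yval_def ci)
      have "Y n i (E \<mu>) = scal (yval n \<mu> i) * E \<mu>" using rot i by simp
      then show ?thesis
        unfolding E_rot[OF rot.hyps] Y_scal[OF n] v unfolding i(1) Y_Suc_rotation[OF n i(2,3)]
        by (simp only: G_mult[OF n] G_scal[OF n]) (simp add: mult_ac)
    qed
  qed
next
  case (swap \<mu> i)
  note i = swap.hyps(2,3)
  let ?f = "E \<mu>" and ?a = "aval n \<mu> i" and ?b = "bval n \<mu> i" and ?s = "Transposition.transpose i (Suc i)"
  let ?y = "yval n \<mu> i" and ?y' = "yval n \<mu> (Suc i)"
  have Yi: "Y n i ?f = scal ?y * ?f" "Y n (Suc i) ?f = scal ?y' * ?f" using swap.IH i by auto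
  \<comment> \<open>The identity that determines b: it absorbs the multiples of E_mu arising from
    the commutation of T_i with Y_i and Y_(i+1), so that T_i E_mu + b E_mu is again an
    eigenvector.\<close>
  have b: "?b = ?a * ?b + (1 - tK) * ?a"
    using aval_ne_1[OF swap.hyps(5), of n] by (simp add: bval_def field_simps)
  have v: "yval n (swap n i \<mu>) j = yval n \<mu> (?s j)" if "j \<in> {1..n}" for j
  proof -
    have "?s j \<in> {1..n}" using that i by (auto simp: transpose_def)
    then show ?thesis
      using that vperm_swap[OF i swap.hyps(5), of "?s j"] by (simp add: yval_def lookup_swap)
  qed
  have Es: "E (swap n i \<mu>) = T i ?f + scal ?b * ?f" by (rule E_swap[OF swap.hyps])
  show ?case
  proof
    fix j assume j: "j \<in> {1..n}"
    consider "j = i" | "j = Suc i" | "j \<noteq> i" "j \<noteq> Suc i" by blast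
    then show "Y n j (E (swap n i \<mu>)) = scal (yval n (swap n i \<mu>) j) * E (swap n i \<mu>)"
    proof cases
      case 1
      have "?b * ?y = ?y' * ?b + (1 - tK) * ?y'"
        using arg_cong[OF b, of "\<lambda>x. x * ?y"] unfolding yval_Suc by (simp add: algebra_simps)
      then have c: "scal ?b * scal ?y = scal ?y' * scal ?b + scal (1 - tK) * scal ?y'"
        by (simp only: scal_mult[symmetric] scal_add[symmetric])
      have "Y n i (E (swap n i \<mu>)) = scal ?y' * Tb i ?f + scal ?b * scal ?y * ?f"
        unfolding Es Y_add[OF n] Y_scal[OF n] Y_T_same[OF n i] Yi Tb_scal by (simp only: mult.assoc)
      also have "\<dots> = scal ?y' * (T i ?f + scal ?b * ?f)"
        unfolding c Tb_def one_minus_tt by (simp add: algebra_simps)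
      finally show ?thesis unfolding 1 v[OF j[unfolded 1]] Es by simp
    next
      case 2
      have "?b * ?y' + (1 - tK) * ?y' = ?y * ?b"
        using arg_cong[OF b, of "\<lambda>x. x * ?y"] unfolding yval_Suc by (simp add: algebra_simps)
      then have c: "scal ?b * scal ?y' + scal (1 - tK) * scal ?y' = scal ?y * scal ?b"
        by (simp only: scal_mult[symmetric] scal_add[symmetric])
      have "Y n (Suc i) (E (swap n i \<mu>)) = scal ?y * T i ?f + (scal ?b * scal ?y' + scal (1 - tK) * scal ?y') * ?f"
        unfolding Es Y_add[OF n] Y_scal[OF n] Y_T_Suc[OF n i] Yi T_scal one_minus_tt by (simp add: algebra_simps)
      also have "\<dots> = scal ?y * (T i ?f + scal ?b * ?f)"
        unfolding c by (simp add: algebra_simps)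
      finally show ?thesis unfolding 2 v[OF j[unfolded 2]] Es by simp
    next
      case 3
      then have Yj: "Y n j ?f = scal (yval n \<mu> j) * ?f" and s: "?s j = j"
        using swap.IH j by (auto simp: transpose_def)
      have "Y n j (T i ?f) = T i (Y n j ?f)"
        by (rule Y_T_other[OF n i]) (use j 3 in auto)
      then show ?thesis
        unfolding v[OF j] s Es Y_add[OF n] Y_scal[OF n] Yj T_scal by (simp add: algebra_simps)
    qed
  qed
next
  case (down \<mu>)
  show ?case
  proof
    fix j assume j: "j \<in> {1..n}"
    have "yval n (down n \<mu>) j = qK * yval n \<mu> j"
      using j by (simp add: yval_def lookup_down vperm_down power_int_diff power_int_minus field_simps)
    moreover have "Y n j (E \<mu>) = scal (yval n \<mu> j) * E \<mu>" using down.IH j by simp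
    ultimately show "Y n j (E (down n \<mu>)) = scal (yval n (down n \<mu>) j) * E (down n \<mu>)"
      unfolding E_down[OF down.hyps] using Y_inverse_xvars[of j "E \<mu>"] j
      by (simp only: scal_mult mult_ac atLeastAtMost_iff)
  qed
qed

end

subsection \<open>Laurent polynomials inside the rational functions\<close>

definition Lau :: "ratfun set" where "Lau = range to_fract"

lemma Lau_add: "f \<in> Lau \<Longrightarrow> g \<in> Lau \<Longrightarrow> f + g \<in> Lau"
  unfolding Lau_def by (auto simp flip: to_fract_add)

lemma Lau_mult: "f \<in> Lau \<Longrightarrow> g \<in> Lau \<Longrightarrow> f * g \<in> Lau"
  unfolding Lau_def by (auto simp flip: to_fract_mult)

lemma Lau_diff: "f \<in> Lau \<Longrightarrow> g \<in> Lau \<Longrightarrow> f - g \<in> Lau"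
  unfolding Lau_def by (auto simp flip: to_fract_diff)

lemma Lau_0: "0 \<in> Lau" and Lau_1: "1 \<in> Lau"
  unfolding Lau_def by (metis rangeI to_fract_0, metis rangeI to_fract_1)

lemma Lau_sum: "(\<And>a. a \<in> A \<Longrightarrow> f a \<in> Lau) \<Longrightarrow> (\<Sum>a\<in>A. f a) \<in> Lau"
  by (induction A rule: infinite_finite_induct) (auto simp: Lau_0 Lau_add)

lemma Lau_prod: "(\<And>a. a \<in> A \<Longrightarrow> f a \<in> Lau) \<Longrightarrow> (\<Prod>a\<in>A. f a) \<in> Lau"
  by (induction A rule: infinite_finite_induct) (auto simp: Lau_1 Lau_mult)

lemma Lau_scal: "scal c \<in> Lau" and Lau_xmon: "xmon \<mu> \<in> Lau"
  by (simp_all add: Lau_def scal_def xmon_def)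

lemma Lau_xvar: "xvar i \<in> Lau"
  by (simp add: xvar_xmon Lau_xmon)

lemma Lau_linear_image:
  assumes "f \<in> Lau" and add: "\<And>f g. F (f + g) = F f + F g" and sc: "\<And>c f. F (scal c * f) = scal c * F f"
    and mono: "\<And>\<mu>. F (xmon \<mu>) \<in> Lau"
  shows "F f \<in> Lau"
proof -
  obtain p where p: "f = to_fract p" using assms(1) by (auto simp: Lau_def)
  have "F 0 = 0" using sc[of 0 0] by simp
  then have sum: "F (\<Sum>\<mu>\<in>A. h \<mu>) = (\<Sum>\<mu>\<in>A. F (h \<mu>))" for A :: "(nat \<Rightarrow>\<^sub>0 int) set" and h
    by (induction A rule: infinite_finite_induct) (simp_all add: add)
  show ?thesis unfolding p to_fract_expand sum sc
    by (intro Lau_sum Lau_mult Lau_scal mono)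
qed

lemma Lau_act: "bij w \<Longrightarrow> f \<in> Lau \<Longrightarrow> act w f \<in> Lau"
  by (rule Lau_linear_image)
    (simp_all add: field_endo_add[OF field_endo_act] field_endo_mult[OF field_endo_act] act_scal act_xmon Lau_xmon)

lemma Lau_G: "0 < n \<Longrightarrow> f \<in> Lau \<Longrightarrow> G n f \<in> Lau"
  by (rule Lau_linear_image) (simp_all add: G_add G_mult G_scal G_xmon Lau_xmon Lau_mult Lau_scal)

text \<open>\<open>sg i j\<close> is \<open>j\<close> times the simple root \<open>\<epsilon>\<^sub>i - \<epsilon>\<^sub>i\<^sub>+\<^sub>1\<close>.\<close>

definition sg :: "nat \<Rightarrow> nat \<Rightarrow> (nat \<Rightarrow>\<^sub>0 int)" where
  "sg i j = single i (int j) - single (Suc i) (int j)"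

lemma lookup_sg: "lk (sg i j) k = (if k = i then int j else if k = Suc i then - int j else 0)"
  by (auto simp: sg_def lookup_minus lookup_single)

lemma sg_Suc: "sg i (Suc j) = sg i j + single i 1 - single (Suc i) 1"
  by (rule poly_mapping_eqI) (auto simp: lookup_sg lookup_add lookup_minus lookup_single)

lemma hecke_geometric:
  fixes x y f g s t :: "'a::field"
  assumes "x \<noteq> y" "s * (x - y) = x * (f - g)"
  shows "((1 - t) * x * f + (t * x - y) * g) / (x - y) = g + (1 - t) * s"
proof -
  have "(1 - t) * x * f + (t * x - y) * g = g * (x - y) + (1 - t) * (x * (f - g))"
    by (simp add: algebra_simps)
  also have "\<dots> = (g + (1 - t) * s) * (x - y)" unfolding assms(2)[symmetric] by (simp add: algebra_simps)
  finally show ?thesis using assms(1) by simp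
qed

text \<open>The divided difference of a monomial is a geometric sum. The endpoint s_i \<nu>, which
  would be j = m, is left out of the sum and has coefficient 1 instead of 1 - t.\<close>

lemma T_xmon:
  assumes "lk \<nu> i - lk \<nu> (Suc i) = int m"
  shows "T i (xmon \<nu>) = xmon (permexp (Transposition.transpose i (Suc i)) \<nu>) + (1 - tt) * (\<Sum>j<m. xmon (\<nu> - sg i j))"
proof -
  have step: "xvar (Suc i) * xmon (\<nu> - sg i j) = xvar i * xmon (\<nu> - sg i (Suc j))" for j
  proof -
    have "single (Suc i) 1 + (\<nu> - sg i j) = single i 1 + (\<nu> - sg i (Suc j))"
      by (simp add: sg_Suc)
    then show ?thesis unfolding xvar_xmon by (simp only: xmon_add[symmetric])
  qed
  have tele: "(\<Sum>j<k. xmon (\<nu> - sg i j)) * (xvar i - xvar (Suc i)) = xvar i * (xmon \<nu> - xmon (\<nu> - sg i k))" for k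
  proof (induction k)
    case 0
    have "sg i 0 = 0" by (simp add: sg_def)
    then show ?case by simp
  next
    case (Suc k)
    have "(\<Sum>j<Suc k. xmon (\<nu> - sg i j)) * (xvar i - xvar (Suc i))
      = xvar i * (xmon \<nu> - xmon (\<nu> - sg i k)) + xmon (\<nu> - sg i k) * (xvar i - xvar (Suc i))"
      using Suc by (simp add: distrib_right)
    also have "\<dots> = xvar i * xmon \<nu> - xvar (Suc i) * xmon (\<nu> - sg i k)" by (simp add: algebra_simps)
    finally show ?case unfolding step by (simp only: right_diff_distrib)
  qed
  have perm: "\<nu> - sg i m = permexp (Transposition.transpose i (Suc i)) \<nu>"
    using assms by (intro poly_mapping_eqI) (auto simp: lookup_permexp lookup_minus lookup_sg transpose_def)
  show ?thesis
    unfolding T_def act_xmon[OF bij_transpose]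
    by (rule hecke_geometric) (use tele[of m] in \<open>simp_all add: perm\<close>)
qed

lemma permexp_transpose_invol:
  "permexp (Transposition.transpose i j) (permexp (Transposition.transpose i j) \<nu>) = \<nu>"
  by (rule poly_mapping_eqI) (simp add: lookup_permexp)

text \<open>The sum of a monomial and its reflection is s_i-invariant and so fixed by T_i; this
  yields ascending exponents from descending ones.\<close>

lemma T_xmon_swap:
  "T i (xmon (permexp (Transposition.transpose i (Suc i)) \<nu>)) =
    xmon \<nu> + xmon (permexp (Transposition.transpose i (Suc i)) \<nu>) - T i (xmon \<nu>)"
proof -
  let ?\<nu> = "permexp (Transposition.transpose i (Suc i)) \<nu>"
  have "T i (xmon \<nu> + xmon ?\<nu>) = xmon \<nu> + xmon ?\<nu>"
    by (rule T_invariant) (simp add: S_add act_xmon permexp_transpose_invol)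
  then have "T i (xmon \<nu>) + T i (xmon ?\<nu>) = xmon \<nu> + xmon ?\<nu>" by (simp only: T_add)
  then show ?thesis by (simp add: algebra_simps)
qed

lemma Lau_T: "f \<in> Lau \<Longrightarrow> T i f \<in> Lau"
proof (rule Lau_linear_image[where F = "T i"])
  show "f \<in> Lau \<Longrightarrow> f \<in> Lau" .
  show "T i (f + g) = T i f + T i g" "T i (scal c * f) = scal c * T i f" for f g c
    by (rule T_add, rule T_scal)
  fix \<nu>
  have pos: "T i (xmon \<nu>) \<in> Lau" if "lk \<nu> i \<ge> lk \<nu> (Suc i)" for \<nu>
    using T_xmon[of \<nu> i "nat (lk \<nu> i - lk \<nu> (Suc i))"] that
    by (simp add: Lau_add Lau_mult Lau_diff Lau_1 Lau_scal Lau_xmon Lau_sum)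
  show "T i (xmon \<nu>) \<in> Lau"
  proof (cases "lk \<nu> i \<ge> lk \<nu> (Suc i)")
    case False
    let ?\<nu> = "permexp (Transposition.transpose i (Suc i)) \<nu>"
    have "T i (xmon ?\<nu>) \<in> Lau" using False by (intro pos) (simp add: lookup_permexp)
    moreover have "T i (xmon \<nu>) = xmon ?\<nu> + xmon \<nu> - T i (xmon ?\<nu>)"
      using T_xmon_swap[of i ?\<nu>] by (simp only: permexp_transpose_invol)
    ultimately show ?thesis by (simp add: Lau_add Lau_diff Lau_xmon)
  qed (rule pos)
qed

lemma Lau_chain_T: "f \<in> Lau \<Longrightarrow> chain T m i f \<in> Lau"
  by (induction m) (auto simp: Lau_T)

subsection \<open>The principal specialization\<close>

text \<open>Truncated subtraction gives x_0 = 1; the locale asks for a nonzero value at every index,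
  including those outside 1..n.\<close>

interpretation princ: evaluation "\<lambda>c. c" "\<lambda>i. tK ^ (i - 1)"
  by unfold_locales simp_all

lemma eval_princ_eqI: "princ.has_value f c \<Longrightarrow> eval_princ f = c"
  unfolding eval_princ_def eval_at_def by (rule princ.feval_eq)

lemma has_value_Lau: "f \<in> Lau \<Longrightarrow> princ.has_value f (eval_princ f)"
proof -
  assume "f \<in> Lau"
  then obtain p where "princ.has_value f (leval (\<lambda>c. c) (\<lambda>i. tK ^ (i - 1)) p)"
    using princ.has_value_to_fract by (auto simp: Lau_def)
  then show ?thesis using eval_princ_eqI by simp
qed

lemma eval_princ_add: "f \<in> Lau \<Longrightarrow> g \<in> Lau \<Longrightarrow> eval_princ (f + g) = eval_princ f + eval_princ g"
  and eval_princ_diff: "f \<in> Lau \<Longrightarrow> g \<in> Lau \<Longrightarrow> eval_princ (f - g) = eval_princ f - eval_princ g"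
  and eval_princ_mult: "f \<in> Lau \<Longrightarrow> g \<in> Lau \<Longrightarrow> eval_princ (f * g) = eval_princ f * eval_princ g"
  by (rule eval_princ_eqI, intro princ.has_value_add princ.has_value_diff princ.has_value_mult has_value_Lau; assumption)+

lemma eval_princ_scal: "eval_princ (scal c) = c" and eval_princ_xvar: "eval_princ (xvar i) = tK ^ (i - 1)"
  and eval_princ_1: "eval_princ 1 = 1"
  by (rule eval_princ_eqI, rule princ.has_value_scal princ.has_value_xvar princ.has_value_1)+

lemma tK_power_ne_1: "d \<noteq> 0 \<Longrightarrow> tK ^ d \<noteq> 1"
  using q_t_ne_1[of 0 "int d"] by simp

lemma tK_power_eq_iff: "tK ^ a = tK ^ b \<longleftrightarrow> a = b"
proof
  have *: "a = b" if "tK ^ a = tK ^ b" "a \<le> b" for a b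
  proof -
    have "tK ^ b = tK ^ a * tK ^ (b - a)" using that(2) by (simp flip: power_add)
    then have "tK ^ (b - a) = 1" using that(1) by simp
    then show ?thesis using tK_power_ne_1[of "b - a"] that(2) by force
  qed
  show "tK ^ a = tK ^ b \<Longrightarrow> a = b"
    using *[of a b] *[of b a] by (cases "a \<le> b") auto
qed simp

text \<open>As a Laurent polynomial T_i f has a value, and this is determined after multiplying by
  x_i - x_(i+1), which is nonzero at the point. For i = 0 that difference would vanish, x_0 and x_1
  both being 1.\<close>

lemma eval_princ_T:
  assumes "f \<in> Lau" "1 \<le> i"
  shows "eval_princ (T i f) = eval_princ f"
proof -
  let ?N = "(1 - tt) * xvar i * f + (tt * xvar i - xvar (Suc i)) * S i f"
  have Sf: "S i f \<in> Lau" by (rule Lau_act[OF bij_transpose assms(1)])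
  have "T i f * (xvar i - xvar (Suc i)) = ?N" by (simp add: T_def)
  then have "eval_princ (T i f * (xvar i - xvar (Suc i))) = eval_princ ?N" by (rule arg_cong)
  also have "eval_princ ?N = (1 - tK) * tK ^ (i - 1) * eval_princ f + (tK * tK ^ (i - 1) - tK ^ i) * eval_princ (S i f)"
    using assms Sf by (simp add: eval_princ_add eval_princ_mult eval_princ_diff eval_princ_xvar eval_princ_scal eval_princ_1
        Lau_xvar Lau_diff Lau_mult Lau_scal Lau_1)
  finally have 1: "eval_princ (T i f * (xvar i - xvar (Suc i))) = (1 - tK) * tK ^ (i - 1) * eval_princ f + (tK * tK ^ (i - 1) - tK ^ i) * eval_princ (S i f)" .
  have 2: "eval_princ (T i f * (xvar i - xvar (Suc i))) = eval_princ (T i f) * (tK ^ (i - 1) - tK ^ i)"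
    using assms by (simp add: eval_princ_mult eval_princ_diff eval_princ_xvar Lau_T Lau_xvar Lau_diff)
  have t: "tK ^ i = tK * tK ^ (i - 1)" using assms(2) by (cases i) auto
  have "eval_princ (T i f) * (tK ^ (i - 1) - tK ^ i) = eval_princ f * (tK ^ (i - 1) - tK ^ i)"
    using 1 unfolding 2 t by (simp add: algebra_simps)
  moreover have "tK ^ (i - 1) - tK ^ i \<noteq> 0" using assms(2) by (simp add: tK_power_eq_iff)
  ultimately show ?thesis by simp
qed

lemma eval_princ_chain_T: "f \<in> Lau \<Longrightarrow> 1 \<le> i \<Longrightarrow> eval_princ (chain T m i f) = eval_princ f"
  by (induction m) (auto simp: eval_princ_T Lau_chain_T)

lemma eval_princ_prod: "(\<And>a. a \<in> A \<Longrightarrow> f a \<in> Lau) \<Longrightarrow> eval_princ (\<Prod>a\<in>A. f a) = (\<Prod>a\<in>A. eval_princ (f a))"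
  by (induction A rule: infinite_finite_induct) (simp_all add: eval_princ_1 eval_princ_mult Lau_prod)

section \<open>A closed form of the evaluation, indexed by pairs of positions\<close>

definition Hf :: "int \<Rightarrow> int \<Rightarrow> K" where
  "Hf M d = (\<Prod>m\<in>{1..M}. (1 - qK powi m * tK powi (d + 1)) / (1 - qK powi m * tK powi d))"

lemma Hf_nonpos: "M \<le> 0 \<Longrightarrow> Hf M d = 1"
  by (simp add: Hf_def)

lemma Hf_step: "0 \<le> M \<Longrightarrow> Hf (M + 1) d = Hf M d * ((1 - qK powi (M + 1) * tK powi (d + 1)) / (1 - qK powi (M + 1) * tK powi d))"
proof -
  assume "0 \<le> M"
  then have "{1..M + 1} = insert (M + 1) {1..M}" by auto
  then show ?thesis by (simp add: Hf_def mult.commute)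
qed

abbreviation Pn :: "nat \<Rightarrow> (nat \<times> nat) set" where "Pn n \<equiv> {1..n} \<times> {1..n}"

text \<open>One factor \<open>Hf\<close> for each ordered pair: its upper bound counts the
  inversions of u_mu that belong to the pair, and its second argument is the power of t to which the
  corresponding quotient of Y variables evaluates.\<close>

definition GH :: "nat \<Rightarrow> (nat \<Rightarrow>\<^sub>0 int) \<Rightarrow> K" where
  "GH n \<mu> = (\<Prod>(a, b)\<in>Pn n. Hf (lk \<mu> a - lk \<mu> b - of_bool (a < b)) (int (vperm n \<mu> a) - int (vperm n \<mu> b)))"

text \<open>The length of t_mu, summed over ordered pairs. It collects the powers of t^(1/2) coming
  from the c-factors and from v_mu.\<close>

definition desc :: "nat \<Rightarrow> (nat \<Rightarrow>\<^sub>0 int) \<Rightarrow> int" where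
  "desc n \<mu> = (\<Sum>(a, b)\<in>Pn n. max 0 (lk \<mu> a - lk \<mu> b))"

text \<open>The value of E_mu expressed through positions of mu, so that the moves act by reindexing
  pairs; \<open>Gval_eq_ev0_t\<close> translates it into inversions.\<close>

definition Gval :: "nat \<Rightarrow> (nat \<Rightarrow>\<^sub>0 int) \<Rightarrow> K" where
  "Gval n \<mu> = thalf powi ((int n - 1) * wt_sum n \<mu> - desc n \<mu>) * GH n \<mu>"

lemma bij_betw_pairs: "bij_betw \<sigma> A A \<Longrightarrow> bij_betw (map_prod \<sigma> \<sigma>) (A \<times> A) (A \<times> A)"
  by (rule bij_betw_map_prod)

lemma wt_sum_rot: "0 < n \<Longrightarrow> wt_sum n (rot n \<mu>) = wt_sum n \<mu> + 1"
proof -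
  assume n: "0 < n"
  have "wt_sum n (rot n \<mu>) = (\<Sum>i\<in>{1..n}. lk (rot n \<mu>) (cyc n i))"
    unfolding wt_sum_def by (rule sum.reindex_bij_betw[symmetric, OF permutes_imp_bij[OF cyc_permutes[OF n]]])
  also have "\<dots> = (\<Sum>i\<in>{1..n}. lk \<mu> i + (if i = n then 1 else 0))"
    by (rule sum.cong) (use lookup_rot[OF n, of _ \<mu>] in auto)
  also have "\<dots> = wt_sum n \<mu> + 1" using n by (simp add: sum.distrib wt_sum_def)
  finally show ?thesis .
qed

lemma desc_rot:
  assumes n: "0 < n"
  shows "desc n (rot n \<mu>) = desc n \<mu> + 2 * int (vperm n \<mu> n) - int n - 1"
proof -
  \<comment> \<open>Only pairs containing n change: raising the last entry adds one for each b with
    mu_b <= mu_n and removes one for each a with mu_a > mu_n.\<close>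
  let ?\<delta> = "\<lambda>a b. if a = n \<and> b \<noteq> n then of_bool (lk \<mu> b \<le> lk \<mu> n) else if a \<noteq> n \<and> b = n then - of_bool (lk \<mu> n < lk \<mu> a) else (0::int)"
  have "desc n (rot n \<mu>) = (\<Sum>p\<in>Pn n. case map_prod (cyc n) (cyc n) p of (a, b) \<Rightarrow> max 0 (lk (rot n \<mu>) a - lk (rot n \<mu>) b))"
    unfolding desc_def
    by (rule sum.reindex_bij_betw[symmetric, OF bij_betw_pairs[OF permutes_imp_bij[OF cyc_permutes[OF n]]]])
  also have "\<dots> = (\<Sum>(a, b)\<in>Pn n. max 0 (lk \<mu> a - lk \<mu> b) + ?\<delta> a b)"
    by (rule sum.cong) (auto simp: lookup_rot n)
  also have "\<dots> = desc n \<mu> + (\<Sum>(a, b)\<in>Pn n. ?\<delta> a b)"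
    by (simp add: desc_def sum.distrib case_prod_unfold)
  also have "(\<Sum>(a, b)\<in>Pn n. ?\<delta> a b) = (\<Sum>a\<in>insert n {1..<n}. \<Sum>b\<in>insert n {1..<n}. ?\<delta> a b)"
  proof -
    have "insert n {1..<n} = {1..n}" using n by auto
    then show ?thesis by (simp add: sum.cartesian_product)
  qed
  also have "\<dots> = (\<Sum>b\<in>{1..<n}. of_bool (lk \<mu> b \<le> lk \<mu> n)) - (\<Sum>b\<in>{1..<n}. of_bool (lk \<mu> n < lk \<mu> b))"
    by (simp add: sum_negf)
  also have "(\<Sum>b\<in>{1..<n}. of_bool (lk \<mu> n < lk \<mu> b)) = (\<Sum>b\<in>{1..<n}. 1 - of_bool (lk \<mu> b \<le> lk \<mu> n) :: int)"
    by (rule sum.cong) auto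
  also have "\<dots> = int n - 1 - (\<Sum>b\<in>{1..<n}. of_bool (lk \<mu> b \<le> lk \<mu> n))"
    using n by (simp add: sum_subtractf of_nat_diff)
  \<comment> \<open>The last position wins all ties, so its rank minus one counts exactly these
    entries.\<close>
  also have "(\<Sum>b\<in>{1..<n}. of_bool (lk \<mu> b \<le> lk \<mu> n)) = int (vperm n \<mu> n) - 1"
  proof -
    have "{a \<in> {1..n}. vleq \<mu> a n} = insert n {b \<in> {1..<n}. lk \<mu> b \<le> lk \<mu> n}"
      using n by (auto simp: vleq_def)
    then have "vperm n \<mu> n = Suc (card {b \<in> {1..<n}. lk \<mu> b \<le> lk \<mu> n})" using n by (simp add: vperm_rank)
    moreover have "(\<Sum>b\<in>{1..<n}. of_bool (lk \<mu> b \<le> lk \<mu> n)) = int (card {b \<in> {1..<n}. lk \<mu> b \<le> lk \<mu> n})"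
      by (simp add: of_bool_def sum.If_cases Int_def)
    ultimately show ?thesis by simp
  qed
  finally show ?thesis by simp
qed

text \<open>The term \<open>of_bool (a < b)\<close> absorbs the increment of the last entry, which
  passes from behind all others to the front.\<close>

lemma GH_rot: assumes n: "0 < n" shows "GH n (rot n \<mu>) = GH n \<mu>"
proof -
  have "GH n (rot n \<mu>) = (\<Prod>p\<in>Pn n. case map_prod (cyc n) (cyc n) p of (a, b) \<Rightarrow>
      Hf (lk (rot n \<mu>) a - lk (rot n \<mu>) b - of_bool (a < b)) (int (vperm n (rot n \<mu>) a) - int (vperm n (rot n \<mu>) b)))"
    unfolding GH_def
    by (rule prod.reindex_bij_betw[symmetric, OF bij_betw_pairs[OF permutes_imp_bij[OF cyc_permutes[OF n]]]])
  also have "\<dots> = GH n \<mu>"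
    unfolding GH_def
  proof (rule prod.cong[OF refl], clarify)
    fix a b assume ab: "a \<in> {1..n}" "b \<in> {1..n}"
    have "lk (rot n \<mu>) (cyc n a) - lk (rot n \<mu>) (cyc n b) - of_bool (cyc n a < cyc n b) = lk \<mu> a - lk \<mu> b - of_bool (a < b)"
      using ab by (auto simp: lookup_rot n) (auto simp: cyc_def)
    then show "(case map_prod (cyc n) (cyc n) (a, b) of (a, b) \<Rightarrow>
      Hf (lk (rot n \<mu>) a - lk (rot n \<mu>) b - of_bool (a < b)) (int (vperm n (rot n \<mu>) a) - int (vperm n (rot n \<mu>) b)))
      = Hf (lk \<mu> a - lk \<mu> b - of_bool (a < b)) (int (vperm n \<mu> a) - int (vperm n \<mu> b))"
      using ab by (simp add: vperm_rot n)
  qed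
  finally show ?thesis .
qed

context
  fixes n i :: nat and \<mu> :: "nat \<Rightarrow>\<^sub>0 int"
  assumes i: "1 \<le> i" "i < n" and des: "lk \<mu> (Suc i) < lk \<mu> i"
begin

lemma transpose_bij_betw: "bij_betw (Transposition.transpose i (Suc i)) {1..n} {1..n}"
  by (rule bij_betw_transpose_iff) (use i in auto)

lemma lookup_swap_transpose: "a \<in> {1..n} \<Longrightarrow> lk (swap n i \<mu>) (Transposition.transpose i (Suc i) a) = lk \<mu> a"
  using i by (auto simp: lookup_swap transpose_def)

lemma desc_swap: "desc n (swap n i \<mu>) = desc n \<mu>"
proof -
  let ?s = "Transposition.transpose i (Suc i)"
  have "desc n (swap n i \<mu>) = (\<Sum>p\<in>Pn n. case map_prod ?s ?s p of (a, b) \<Rightarrow> max 0 (lk (swap n i \<mu>) a - lk (swap n i \<mu>) b))"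
    unfolding desc_def by (rule sum.reindex_bij_betw[symmetric, OF bij_betw_pairs[OF transpose_bij_betw]])
  also have "\<dots> = desc n \<mu>"
    unfolding desc_def by (rule sum.cong) (auto simp: lookup_swap_transpose)
  finally show ?thesis .
qed

lemma wt_sum_swap: "wt_sum n (swap n i \<mu>) = wt_sum n \<mu>"
  using sum_transpose[OF i, of "lk \<mu>"] by (simp add: wt_sum_def lookup_swap)

text \<open>Only the pair (i, i+1) matters: its indicator drops from 1 to 0, which adds one factor
  to \<open>Hf\<close>. The reversed pair has a nonpositive bound before and after.\<close>

lemma GH_swap: "GH n (swap n i \<mu>) = GH n \<mu> * ((1 - tK * aval n \<mu> i) / (1 - aval n \<mu> i))"
proof -
  let ?s = "Transposition.transpose i (Suc i)"
  define F where "F = (\<lambda>(a, b). Hf (lk \<mu> a - lk \<mu> b - of_bool (a < b)) (int (vperm n \<mu> a) - int (vperm n \<mu> b)))"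
  define F' where "F' = (\<lambda>(a, b). Hf (lk \<mu> a - lk \<mu> b - of_bool (?s a < ?s b)) (int (vperm n \<mu> a) - int (vperm n \<mu> b)))"
  have "GH n (swap n i \<mu>) = (\<Prod>p\<in>Pn n. case map_prod ?s ?s p of (a, b) \<Rightarrow>
      Hf (lk (swap n i \<mu>) a - lk (swap n i \<mu>) b - of_bool (a < b)) (int (vperm n (swap n i \<mu>) a) - int (vperm n (swap n i \<mu>) b)))"
    unfolding GH_def by (rule prod.reindex_bij_betw[symmetric, OF bij_betw_pairs[OF transpose_bij_betw]])
  also have "\<dots> = (\<Prod>p\<in>Pn n. F' p)"
    by (rule prod.cong) (auto simp: F'_def lookup_swap_transpose vperm_swap[OF i des])
  also have "\<dots> = F' (i, Suc i) * (\<Prod>p\<in>Pn n - {(i, Suc i)}. F' p)"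
    by (rule prod.remove) (use i in auto)
  also have "(\<Prod>p\<in>Pn n - {(i, Suc i)}. F' p) = (\<Prod>p\<in>Pn n - {(i, Suc i)}. F p)"
  proof (rule prod.cong[OF refl])
    fix p assume p: "p \<in> Pn n - {(i, Suc i)}"
    obtain a b where ab: "p = (a, b)" by (cases p)
    show "F' p = F p"
    proof (cases "a = Suc i \<and> b = i")
      case True
      then show ?thesis using des by (simp add: F_def F'_def ab Hf_nonpos)
    next
      case False
      have "?s a < ?s b \<longleftrightarrow> a < b" using False p ab by (auto simp: transpose_def)
      then show ?thesis by (simp add: F_def F'_def ab)
    qed
  qed
  also have "F' (i, Suc i) = F (i, Suc i) * ((1 - tK * aval n \<mu> i) / (1 - aval n \<mu> i))"
  proof -
    define M where "M = lk \<mu> i - lk \<mu> (Suc i) - 1"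
    define d where "d = int (vperm n \<mu> i) - int (vperm n \<mu> (Suc i))"
    have a: "aval n \<mu> i = qK powi (M + 1) * tK powi d" by (simp add: aval_def M_def d_def)
    have "F' (i, Suc i) = Hf (M + 1) d" "F (i, Suc i) = Hf M d"
      by (simp_all add: F_def F'_def M_def d_def)
    moreover have "0 \<le> M" using des by (simp add: M_def)
    ultimately show ?thesis
      by (simp add: Hf_step a power_int_add mult_ac)
  qed
  also have "F (i, Suc i) * ((1 - tK * aval n \<mu> i) / (1 - aval n \<mu> i)) * (\<Prod>p\<in>Pn n - {(i, Suc i)}. F p)
      = (F (i, Suc i) * (\<Prod>p\<in>Pn n - {(i, Suc i)}. F p)) * ((1 - tK * aval n \<mu> i) / (1 - aval n \<mu> i))"
    by (simp only: mult_ac)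
  also have "F (i, Suc i) * (\<Prod>p\<in>Pn n - {(i, Suc i)}. F p) = (\<Prod>p\<in>Pn n. F p)"
    by (rule prod.remove[symmetric]) (use i in auto)
  also have "\<dots> = GH n \<mu>" by (simp add: GH_def F_def)
  finally show ?thesis .
qed

end

lemma Gval_zero: "Gval n 0 = 1"
proof -
  have "GH n 0 = 1" unfolding GH_def by (rule prod.neutral) (auto simp: Hf_nonpos)
  then show ?thesis by (simp add: Gval_def desc_def wt_sum_def)
qed

lemma Gval_down: "Gval n (down n \<mu>) = thalf powi (- ((int n - 1) * int n)) * Gval n \<mu>"
proof -
  have "desc n (down n \<mu>) = desc n \<mu>"
    unfolding desc_def by (rule sum.cong) (auto simp: lookup_down)
  moreover have "GH n (down n \<mu>) = GH n \<mu>"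
    unfolding GH_def by (rule prod.cong) (auto simp: lookup_down vperm_down)
  moreover have "wt_sum n (down n \<mu>) = wt_sum n \<mu> - int n"
    by (simp add: wt_sum_def lookup_down sum_subtractf)
  moreover have "(int n - 1) * (w - int n) - d = - ((int n - 1) * int n) + ((int n - 1) * w - d)" for w d :: int
    by (simp add: algebra_simps)
  ultimately show ?thesis unfolding Gval_def by (simp only: power_int_add thalf_nonzero disjI1 mult.assoc simp_thms)
qed

lemma Lau_inverse_xvar: "inverse (xvar i) \<in> Lau"
  unfolding xvar_xmon xmon_uminus[symmetric] by (rule Lau_xmon)

lemma eval_princ_inverse_xvar: "eval_princ (inverse (xvar i)) = inverse (tK ^ (i - 1))"
  by (rule eval_princ_eqI, rule princ.has_value_inverse, rule princ.has_value_xvar) simp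

lemma laurent_polys_Lau: "f \<in> laurent_polys n \<Longrightarrow> f \<in> Lau"
  by (auto simp: laurent_polys_def Lau_def)

lemma eval_princ_E:
  assumes n: "0 < n" and E: "macdonald_E n E"
  shows "\<mu> \<in> Zn n \<Longrightarrow> eval_princ (E \<mu>) = Gval n \<mu>"
  using n
proof (induction \<mu> rule: Zn_induct)
  case zero
  show ?case by (simp add: E_zero[OF n E] eval_princ_1 Gval_zero)
next
  case (rot \<mu>)
  have EL: "E \<mu> \<in> Lau" by (rule laurent_polys_Lau[OF E_Laurent[OF n E rot.hyps]])
  have GL: "G n (E \<mu>) \<in> Lau" by (rule Lau_G[OF n EL])
  \<comment> \<open>Y_n contains no \<open>Tb\<close>, and the remaining T_k do not affect the
    evaluation.\<close>
  have "Y n n (E \<mu>) = chain T n 1 (G n (E \<mu>))" by (simp add: Y_def chain_empty)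
  then have "eval_princ (Y n n (E \<mu>)) = eval_princ (G n (E \<mu>))" using GL by (simp add: eval_princ_chain_T)
  moreover have "Y n n (E \<mu>) = scal (yval n \<mu> n) * E \<mu>"
    using E_eigenvector[OF n E rot.hyps] n by simp
  ultimately have "eval_princ (G n (E \<mu>)) = yval n \<mu> n * eval_princ (E \<mu>)"
    using EL by (simp add: eval_princ_mult eval_princ_scal Lau_scal)
  then have "eval_princ (E (rot n \<mu>)) = qK powi lk \<mu> n * yval n \<mu> n * Gval n \<mu>"
    using GL rot.IH by (simp add: E_rot[OF n E rot.hyps] eval_princ_mult eval_princ_scal eval_princ_xvar Lau_mult Lau_scal Lau_xvar)
  also have "qK powi lk \<mu> n * yval n \<mu> n = tK powi (int n - int (vperm n \<mu> n))"
    by (simp add: yval_def power_int_minus)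
  also have "\<dots> * Gval n \<mu> = Gval n (rot n \<mu>)"
  proof -
    have "(int n - 1) * wt_sum n (rot n \<mu>) - desc n (rot n \<mu>)
        = 2 * (int n - int (vperm n \<mu> n)) + ((int n - 1) * wt_sum n \<mu> - desc n \<mu>)"
      unfolding wt_sum_rot[OF n] desc_rot[OF n] by (simp add: algebra_simps)
    then show ?thesis
      unfolding Gval_def GH_rot[OF n] tK_powi
      by (simp only: power_int_add thalf_nonzero disjI1 mult.assoc simp_thms)
  qed
  finally show ?case .
next
  case (swap \<mu> i)
  have EL: "E \<mu> \<in> Lau" by (rule laurent_polys_Lau[OF E_Laurent[OF n E swap.hyps(1)]])
  have "eval_princ (E (swap n i \<mu>)) = Gval n \<mu> + bval n \<mu> i * Gval n \<mu>"
    using EL swap.IH swap.hyps(2)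
    by (simp add: E_swap[OF n E swap.hyps] eval_princ_add eval_princ_mult eval_princ_scal eval_princ_T Lau_T Lau_mult Lau_scal)
  \<comment> \<open>1 + b = (1 - t a) / (1 - a), the factor by which \<open>GH\<close>
    grows.\<close>
  also have "\<dots> = Gval n \<mu> * ((1 - tK * aval n \<mu> i) / (1 - aval n \<mu> i))"
    using aval_ne_1[OF swap.hyps(5), of n] by (simp add: bval_def field_simps)
  also have "\<dots> = Gval n (swap n i \<mu>)"
    unfolding Gval_def desc_swap[OF swap.hyps(2,3,5)] wt_sum_swap[OF swap.hyps(2,3,5)] GH_swap[OF swap.hyps(2,3,5)]
    by (simp only: mult.assoc)
  finally show ?case .
next
  case (down \<mu>)
  have EL: "E \<mu> \<in> Lau" by (rule laurent_polys_Lau[OF E_Laurent[OF n E down.hyps]])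
  have "eval_princ (E (down n \<mu>)) = (\<Prod>i\<in>{1..n}. inverse (tK ^ (i - 1))) * Gval n \<mu>"
    unfolding E_down[OF n E down.hyps]
    using EL down.IH by (simp only: eval_princ_mult Lau_prod Lau_inverse_xvar eval_princ_prod eval_princ_inverse_xvar)
  also have "(\<Prod>i\<in>{1..n}. inverse (tK ^ (i - 1))) = thalf powi (- ((int n - 1) * int n))"
  proof -
    have "(\<Prod>i\<in>{1..m}. inverse (tK ^ (i - 1))) = thalf powi (- ((int m - 1) * int m))" for m
    proof (induction m)
      case (Suc m)
      have "inverse (tK ^ m) = thalf powi (- 2 * int m)"
        using tK_powi[of "- int m"] by (simp add: power_int_minus)
      then have "(\<Prod>i\<in>{1..Suc m}. inverse (tK ^ (i - 1))) = thalf powi (- 2 * int m) * thalf powi (- ((int m - 1) * int m))"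
        using Suc by (simp add: mult.commute)
      also have "\<dots> = thalf powi (- 2 * int m + - ((int m - 1) * int m))"
        by (rule power_int_add[symmetric]) simp
      also have "- 2 * int m + - ((int m - 1) * int m) = - ((int (Suc m) - 1) * int (Suc m))"
        by (simp add: algebra_simps)
      finally show ?case .
    qed simp
    then show ?thesis .
  qed
  finally show ?case unfolding Gval_down .
qed

subsection \<open>Inversion sets\<close>

context
  fixes n :: nat assumes n: "0 < n"
begin

lemma res_quot:
  assumes "j \<in> {1..n}"
  shows "res_ix n (int j + int n * m) = j" "quot_ix n (int j + int n * m) = m"
proof -
  have eq: "int j + int n * m - 1 = int (j - 1) + int n * m" using assms by (simp add: of_nat_diff)
  have l: "0 \<le> int (j - 1)" "int (j - 1) < int n" using assms n by auto
  have md: "(int (j - 1) + int n * m) mod int n = int (j - 1)" using l by simp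
  show "res_ix n (int j + int n * m) = j"
    unfolding res_ix_def eq md nat_int using assms by simp
  show "quot_ix n (int j + int n * m) = m"
    unfolding quot_ix_def eq using l n by simp
qed

lemma residue_decomposition: obtains j m where "j \<in> {1..n}" "k = int j + int n * m"
proof
  show "res_ix n k \<in> {1..n}" using n nat_less_iff[of "(k - 1) mod int n" n] by (simp add: res_ix_def Suc_le_eq)
  have "(k - 1) mod int n + int n * ((k - 1) div int n) = k - 1" by simp
  then show "k = int (res_ix n k) + int n * quot_ix n k" using n by (simp add: res_ix_def quot_ix_def)
qed

lemma periodic_ext_apply: "j \<in> {1..n} \<Longrightarrow> periodic_ext n f (int j + int n * m) = f j + int n * m"
  by (simp add: periodic_ext_def res_quot)

lemma residue_less_iff:
  assumes "a \<in> {1..n}" "b \<in> {1..n}"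
  shows "int b + int n * m < int a \<longleftrightarrow> m < 0 \<or> m = 0 \<and> b < a"
    and "int a < int b + int n * m \<longleftrightarrow> 0 < m \<or> m = 0 \<and> a < b"
proof -
  have pos: "int n \<le> int n * m" if "m > 0" using that n by simp
  have neg: "int n * m \<le> - int n" if "m < 0"
    using mult_left_mono[of m "-1" "int n"] that by simp
  have ab: "1 \<le> int a" "int a \<le> int n" "1 \<le> int b" "int b \<le> int n" using assms by auto
  consider "0 < m" | "m = 0" | "m < 0" by linarith
  then have "(int b + int n * m < int a \<longleftrightarrow> m < 0 \<or> m = 0 \<and> b < a) \<and> (int a < int b + int n * m \<longleftrightarrow> 0 < m \<or> m = 0 \<and> a < b)"
  proof cases
    case 1
    then have "int b + int n * m > int a" using pos[OF 1] ab by linarith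
    then show ?thesis using 1 by simp
  next
    case 2
    then show ?thesis by simp
  next
    case 3
    then have "int b + int n * m < int a" using neg[OF 3] ab by linarith
    then show ?thesis using 3 by simp
  qed
  then show "int b + int n * m < int a \<longleftrightarrow> m < 0 \<or> m = 0 \<and> b < a"
    and "int a < int b + int n * m \<longleftrightarrow> 0 < m \<or> m = 0 \<and> a < b"
    by simp_all
qed

lemma residue_eq_iff:
  assumes "a \<in> {1..n}" "b \<in> {1..n}"
  shows "int a + int n * m = int b + int n * k \<longleftrightarrow> a = b \<and> m = k"
  using res_quot[OF assms(1), of m] res_quot[OF assms(2), of k] by metis

lemma inv_ext_perm:
  assumes v: "v permutes {1..n}" and a: "a \<in> {1..n}"
  shows "inv (ext_perm n v) (int (v a) + int n * m) = int a + int n * m"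
proof (rule inv_f_eq)
  show "inj (ext_perm n v)"
  proof (rule injI)
    fix k l assume eq: "ext_perm n v k = ext_perm n v l"
    obtain c m where c: "c \<in> {1..n}" "k = int c + int n * m" by (rule residue_decomposition)
    obtain d m' where d: "d \<in> {1..n}" "l = int d + int n * m'" by (rule residue_decomposition)
    have "v c \<in> {1..n}" "v d \<in> {1..n}" using c(1) d(1) permutes_in_image[OF v] by blast+
    then have "v c = v d \<and> m = m'"
      using eq c d by (simp add: periodic_ext_apply residue_eq_iff)
    then show "k = l" using c d permutes_inj[OF v] by (simp add: inj_eq)
  qed
  show "ext_perm n v (int a + int n * m) = int (v a) + int n * m"
    using a by (simp add: periodic_ext_apply)
qed

lemma Inv_ext_perm:
  assumes w: "w permutes {1..n}"
  shows "Inv n (ext_perm n w) = (\<lambda>(i, j). (int i, int j)) ` {(i, j) \<in> Pn n. i < j \<and> w j < w i}"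
proof (intro equalityI subsetI)
  fix p assume "p \<in> Inv n (ext_perm n w)"
  then obtain i k where p: "p = (i, k)" "i \<in> {1..int n}" "i < k" "ext_perm n w i > ext_perm n w k"
    by (auto simp: Inv_def)
  define a where "a = nat i"
  have a: "a \<in> {1..n}" "i = int a + int n * 0" using p(2) by (auto simp: a_def)
  obtain b m where b: "b \<in> {1..n}" "k = int b + int n * m" by (rule residue_decomposition)
  have "w a \<in> {1..n}" "w b \<in> {1..n}" using a(1) b(1) permutes_in_image[OF w] by blast+
  moreover have "int (w b) + int n * m < int (w a)"
    using p(4) unfolding a(2) b(2) periodic_ext_apply[OF a(1)] periodic_ext_apply[OF b(1)] by simp
  ultimately have "m < 0 \<or> m = 0 \<and> w b < w a" by (simp add: residue_less_iff)
  moreover have "0 < m \<or> m = 0 \<and> a < b"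
    using p(3) a b residue_less_iff(2)[OF a(1) b(1), of m] by simp
  ultimately show "p \<in> (\<lambda>(i, j). (int i, int j)) ` {(i, j) \<in> Pn n. i < j \<and> w j < w i}"
    using a b p(1) by (auto simp: image_iff)
next
  fix p assume "p \<in> (\<lambda>(i, j). (int i, int j)) ` {(i, j) \<in> Pn n. i < j \<and> w j < w i}"
  then obtain a b where ab: "p = (int a, int b)" "a \<in> {1..n}" "b \<in> {1..n}" "a < b" "w b < w a" by auto
  have "ext_perm n w (int c) = int (w c)" if "c \<in> {1..n}" for c
    using periodic_ext_apply[OF that, of _ 0] by simp
  then show "p \<in> Inv n (ext_perm n w)" using ab by (auto simp: Inv_def)
qed

lemma len_eq_card: "w permutes {1..n} \<Longrightarrow> len n w = card {(i, j) \<in> Pn n. i < j \<and> w j < w i}"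
  unfolding len_def Inv_ext_perm by (rule card_image) (auto simp: inj_on_def)

definition Mexp :: "(nat \<Rightarrow>\<^sub>0 int) \<Rightarrow> nat \<times> nat \<Rightarrow> int" where
  "Mexp \<mu> = (\<lambda>(a, b). lk \<mu> a - lk \<mu> b - of_bool (a < b))"

lemma Inv_uperm:
  fixes \<mu>
  defines "v \<equiv> vperm n \<mu>"
  shows "Inv n (uperm n \<mu>) = (\<lambda>((a, b), m). (int (v a), int (v b) + int n * m)) ` (SIGMA p : Pn n. {1..Mexp \<mu> p})"
    (is "_ = ?R")
proof -
  have v: "v permutes {1..n}" unfolding v_def by (rule vperm_permutes)
  have vin: "v c \<in> {1..n}" if "c \<in> {1..n}" for c using permutes_in_image[OF v] that by blast
  have u: "uperm n \<mu> (int (v a) + int n * m) = int a + int n * (lk \<mu> a + m)" if "a \<in> {1..n}" for a m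
    unfolding uperm_def v_def[symmetric] o_apply inv_ext_perm[OF v that] transl_def periodic_ext_apply[OF that]
    by (simp add: algebra_simps)
  have key: "int (v a) < int (v b) + int n * m \<and> int b + int n * (lk \<mu> b + m) < int a + int n * lk \<mu> a
      \<longleftrightarrow> m \<in> {1..Mexp \<mu> (a, b)}" if ab: "a \<in> {1..n}" "b \<in> {1..n}" for a b m
  proof -
    have "int b + int n * (lk \<mu> b + m) < int a + int n * lk \<mu> a \<longleftrightarrow> int b + int n * (lk \<mu> b + m - lk \<mu> a) < int a"
      by (simp add: algebra_simps)
    also have "\<dots> \<longleftrightarrow> lk \<mu> b + m < lk \<mu> a \<or> lk \<mu> b + m = lk \<mu> a \<and> b < a"
      using residue_less_iff(1)[OF ab, of "lk \<mu> b + m - lk \<mu> a"] by auto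
    finally have 1: "int b + int n * (lk \<mu> b + m) < int a + int n * lk \<mu> a \<longleftrightarrow> lk \<mu> b + m < lk \<mu> a \<or> lk \<mu> b + m = lk \<mu> a \<and> b < a" .
    have 2: "int (v a) < int (v b) + int n * m \<longleftrightarrow> 0 < m \<or> m = 0 \<and> vleq \<mu> a b \<and> a \<noteq> b"
      using residue_less_iff(2)[OF vin[OF ab(1)] vin[OF ab(2)], of m] vperm_less_iff[OF ab, of \<mu>] by (simp add: v_def)
    show ?thesis unfolding 1 2
      by (cases a b rule: linorder_cases) (auto simp: Mexp_def vleq_def)
  qed
  show ?thesis
  proof (intro equalityI subsetI)
    fix p assume "p \<in> Inv n (uperm n \<mu>)"
    then obtain i k where p: "p = (i, k)" "i \<in> {1..int n}" "i < k" "uperm n \<mu> k < uperm n \<mu> i"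
      by (auto simp: Inv_def)
    have "nat i \<in> v ` {1..n}" using p(2) permutes_image[OF v] by auto
    then obtain a where a: "a \<in> {1..n}" "i = int (v a) + int n * 0" using p(2) by auto
    obtain c m where c: "c \<in> {1..n}" "k = int c + int n * m" by (rule residue_decomposition)
    have "c \<in> v ` {1..n}" using c(1) permutes_image[OF v] by auto
    then obtain b where b: "b \<in> {1..n}" "k = int (v b) + int n * m" using c by auto
    have "int b + int n * (lk \<mu> b + m) < int a + int n * lk \<mu> a"
      using p(4) unfolding a(2) b(2) u[OF a(1)] u[OF b(1)] by simp
    then have "m \<in> {1..Mexp \<mu> (a, b)}" using key[OF a(1) b(1), of m] p(3) a b by simp
    then show "p \<in> ?R" using a b p(1) by (auto intro!: image_eqI[where x = "((a, b), m)"])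
  next
    fix p assume "p \<in> ?R"
    then obtain a b m where ab: "a \<in> {1..n}" "b \<in> {1..n}" "m \<in> {1..Mexp \<mu> (a, b)}"
      "p = (int (v a), int (v b) + int n * m)" by auto
    then have "int (v a) < int (v b) + int n * m" "uperm n \<mu> (int (v b) + int n * m) < uperm n \<mu> (int (v a) + int n * 0)"
      using key[OF ab(1,2), of m] unfolding u[OF ab(1)] u[OF ab(2)] by auto
    then show "p \<in> Inv n (uperm n \<mu>)" using ab vin[OF ab(1)] by (simp add: Inv_def)
  qed
qed

text \<open>In contrast to u_mu, the value m = 0 occurs here and m = lam_i - lam_j does not.
  Dominance excludes pairs with j < i.\<close>

lemma Inv_transl:
  assumes dom: "\<And>i j. i \<in> {1..n} \<Longrightarrow> j \<in> {1..n} \<Longrightarrow> i \<le> j \<Longrightarrow> lk lam j \<le> lk lam i"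
  shows "Inv n (transl n lam) = (\<lambda>((i, j), m). (int i, int j + int n * m)) ` (SIGMA (i, j) : pairs n. {0..<lk lam i - lk lam j})"
    (is "_ = ?R")
proof -
  have u: "transl n lam (int a + int n * m) = int a + int n * (lk lam a + m)" if "a \<in> {1..n}" for a m
    unfolding transl_def periodic_ext_apply[OF that] by (simp add: algebra_simps)
  have key: "int a < int b + int n * m \<and> int b + int n * (lk lam b + m) < int a + int n * lk lam a
      \<longleftrightarrow> a < b \<and> m \<in> {0..<lk lam a - lk lam b}" if ab: "a \<in> {1..n}" "b \<in> {1..n}" for a b m
  proof -
    have "int b + int n * (lk lam b + m) < int a + int n * lk lam a \<longleftrightarrow> int b + int n * (lk lam b + m - lk lam a) < int a"
      by (simp add: algebra_simps)
    also have "\<dots> \<longleftrightarrow> lk lam b + m < lk lam a \<or> lk lam b + m = lk lam a \<and> b < a"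
      using residue_less_iff(1)[OF ab, of "lk lam b + m - lk lam a"] by auto
    finally have 1: "int b + int n * (lk lam b + m) < int a + int n * lk lam a \<longleftrightarrow> lk lam b + m < lk lam a \<or> lk lam b + m = lk lam a \<and> b < a" .
    have "b < a \<Longrightarrow> lk lam a \<le> lk lam b" "a < b \<Longrightarrow> lk lam b \<le> lk lam a" using dom ab by simp_all
    then show ?thesis unfolding 1 residue_less_iff(2)[OF ab]
      by (cases a b rule: linorder_cases) auto
  qed
  show ?thesis
  proof (intro equalityI subsetI)
    fix p assume "p \<in> Inv n (transl n lam)"
    then obtain i k where p: "p = (i, k)" "i \<in> {1..int n}" "i < k" "transl n lam k < transl n lam i"
      by (auto simp: Inv_def)
    define a where "a = nat i"
    have a: "a \<in> {1..n}" "i = int a + int n * 0" using p(2) by (auto simp: a_def)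
    obtain b m where b: "b \<in> {1..n}" "k = int b + int n * m" by (rule residue_decomposition)
    have "int b + int n * (lk lam b + m) < int a + int n * lk lam a"
      using p(4) unfolding a(2) b(2) u[OF a(1)] u[OF b(1)] by simp
    then have "a < b \<and> m \<in> {0..<lk lam a - lk lam b}" using key[OF a(1) b(1), of m] p(3) a b by simp
    then show "p \<in> ?R" using a b p(1) by (auto simp: pairs_def intro!: image_eqI[where x = "((a, b), m)"])
  next
    fix p assume "p \<in> ?R"
    then obtain a b m where ab: "a \<in> {1..n}" "b \<in> {1..n}" "a < b" "m \<in> {0..<lk lam a - lk lam b}"
      "p = (int a, int b + int n * m)" by (auto simp: pairs_def)
    then have "int a < int b + int n * m" "transl n lam (int b + int n * m) < transl n lam (int a + int n * 0)"
      using key[OF ab(1,2), of m] unfolding u[OF ab(1)] u[OF ab(2)] by auto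
    then show "p \<in> Inv n (transl n lam)" using ab by (simp add: Inv_def)
  qed
qed

subsection \<open>Evaluating the c-functions\<close>

text \<open>The sign e merges the two evaluations: -1 for the one at t, 1 for the one at
  1/t.\<close>

definition pts :: "int \<Rightarrow> nat \<Rightarrow> K" where
  "pts e i = thalf powi (e * (2 * (int i - 1) - (int n - 1)))"

lemma evaluation_pts: "evaluation (\<lambda>c. c) (pts e)"
  by unfold_locales (simp_all add: pts_def)

lemma ev0_t_eq: "ev0_t n r = eval_at (pts (-1)) r" and ev0_tinv_eq: "ev0_tinv n r = eval_at (pts 1) r"
proof -
  have "(\<lambda>i. thalf powi (- 2 * (int i - 1) + (int n - 1))) = pts (-1)"
    "(\<lambda>i. thalf powi (2 * (int i - 1) - (int n - 1))) = pts 1"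
    by (simp_all add: fun_eq_iff pts_def algebra_simps)
  then show "ev0_t n r = eval_at (pts (-1)) r" "ev0_tinv n r = eval_at (pts 1) r"
    by (simp_all only: ev0_t_def ev0_tinv_def)
qed

definition cval :: "int \<Rightarrow> int \<Rightarrow> K" where
  "cval m d = inverse thalf * ((1 - qK powi m * tK powi (d + 1)) / (1 - qK powi m * tK powi d))"

lemma pts_ratio: "inverse (pts e i) * pts e j = tK powi (e * (int j - int i))"
proof -
  have "inverse (pts e i) * pts e j = thalf powi (- (e * (2 * (int i - 1) - (int n - 1)))) * thalf powi (e * (2 * (int j - 1) - (int n - 1)))"
    by (simp add: pts_def power_int_minus)
  also have "\<dots> = thalf powi (- (e * (2 * (int i - 1) - (int n - 1))) + e * (2 * (int j - 1) - (int n - 1)))"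
    by (rule power_int_add[symmetric]) simp
  finally show ?thesis by (simp add: tK_powi algebra_simps)
qed

lemma c_fun_value:
  assumes "i \<in> {1..n}" "j \<in> {1..n}" "m \<noteq> 0 \<or> i \<noteq> j" "e \<noteq> 0"
  shows "evaluation.has_value (\<lambda>c. c) (pts e) (c_fun n (int i, int j + int n * m)) (cval m (e * (int j - int i)))"
proof -
  interpret evaluation "\<lambda>c. c" "pts e" by (rule evaluation_pts)
  let ?d = "e * (int j - int i)"
  have ne: "qK powi m * tK powi ?d \<noteq> 1" using assms by (intro q_t_ne_1) auto
  have r: "qK powi m * tK * inverse (pts e i) * pts e j = qK powi m * tK powi (?d + 1)"
    "qK powi m * inverse (pts e i) * pts e j = qK powi m * tK powi ?d"
    using pts_ratio[of e i j] by (simp_all add: power_int_add mult_ac)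
  have den: "1 - qK powi m * inverse (pts e i) * pts e j \<noteq> 0" unfolding r using ne by simp
  have "c_fun n (int i, int j + int n * m) = scal (inverse thalf) *
     ((1 - scal (qK powi m) * scal tK * inverse (xvar i) * xvar j) / (1 - scal (qK powi m) * inverse (xvar i) * xvar j))"
    by (simp add: c_fun_def Let_def res_quot[OF assms(2)])
  moreover have "has_value (scal (inverse thalf) *
     ((1 - scal (qK powi m) * scal tK * inverse (xvar i) * xvar j) / (1 - scal (qK powi m) * inverse (xvar i) * xvar j)))
     (inverse thalf * ((1 - qK powi m * tK * inverse (pts e i) * pts e j) / (1 - qK powi m * inverse (pts e i) * pts e j)))"
    by (intro has_value_mult has_value_divide has_value_diff has_value_1 has_value_scal has_value_inverse has_value_xvar)
      (rule den x_nonzero)+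
  ultimately show ?thesis by (simp only: cval_def r)
qed

text \<open>Any injective parametrization \<open>h\<close> of the inversions turns the value of
  \<open>c_prod\<close> into a product of \<open>cval\<close>. An inversion never has i = j with m =
  0, so no denominator degenerates to 1 - 1.\<close>

lemma c_prod_value:
  assumes "Inv n w = h ` A" "inj_on h A" "e \<noteq> 0"
    and "\<And>x. x \<in> A \<Longrightarrow> \<exists>i j m. h x = (int i, int j + int n * m) \<and> i \<in> {1..n} \<and> j \<in> {1..n} \<and> f x = cval m (e * (int j - int i))"
  shows "eval_at (pts e) (c_prod n w) = (\<Prod>x\<in>A. f x)"
proof -
  interpret evaluation "\<lambda>c. c" "pts e" by (rule evaluation_pts)
  have "has_value (c_fun n (h x)) (f x)" if x: "x \<in> A" for x
  proof -
    obtain i j m where ijm: "h x = (int i, int j + int n * m)" "i \<in> {1..n}" "j \<in> {1..n}" "f x = cval m (e * (int j - int i))"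
      using assms(4)[OF x] by blast
    have "(int i, int j + int n * m) \<in> Inv n w" using x assms(1) ijm(1) by force
    then have "m \<noteq> 0 \<or> i \<noteq> j" by (auto simp: Inv_def)
    then show ?thesis unfolding ijm(1,4) using ijm(2,3) assms(3) by (intro c_fun_value)
  qed
  then have "has_value (\<Prod>x\<in>A. c_fun n (h x)) (\<Prod>x\<in>A. f x)" by (rule has_value_prod)
  moreover have "c_prod n w = (\<Prod>x\<in>A. c_fun n (h x))"
    unfolding c_prod_def assms(1) using prod.reindex[OF assms(2)] by simp
  ultimately show ?thesis unfolding eval_at_def by (simp add: feval_eq)
qed

lemma prod_cval: "(\<Prod>m\<in>{1..M}. cval m d) = thalf powi (- max 0 M) * Hf M d"
proof -
  have "thalf powi (- max 0 M) = inverse thalf ^ nat M"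
    by (cases "0 \<le> M") (simp_all add: power_int_minus power_int_def power_inverse)
  then show ?thesis unfolding cval_def Hf_def prod.distrib prod_constant by simp
qed

lemma prod_thalf_powi: "(\<Prod>a\<in>A. thalf powi f a) = thalf powi (\<Sum>a\<in>A. f a)"
  by (induction A rule: infinite_finite_induct) (simp_all add: power_int_add)

lemma ev0_t_uperm: "ev0_t n (c_prod n (uperm n \<mu>)) = thalf powi (- (\<Sum>p\<in>Pn n. max 0 (Mexp \<mu> p))) * GH n \<mu>"
proof -
  let ?v = "vperm n \<mu>"
  have v: "?v permutes {1..n}" by (rule vperm_permutes)
  have vin: "?v c \<in> {1..n}" if "c \<in> {1..n}" for c using permutes_in_image[OF v] that by blast
  have "ev0_t n (c_prod n (uperm n \<mu>)) = (\<Prod>((a, b), m)\<in>(SIGMA p : Pn n. {1..Mexp \<mu> p}). cval m (int (?v a) - int (?v b)))"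
    unfolding ev0_t_eq
  \<comment> \<open>With e = -1 the quotient of Y at v(b) by Y at v(a) takes the value t^(v(a) -
    v(b)).\<close>
  proof (rule c_prod_value[OF Inv_uperm, where e = "-1" and f = "\<lambda>((a, b), m). cval m (int (?v a) - int (?v b))"], goal_cases)
    case 1
    show ?case
    proof (rule inj_onI, clarsimp)
      fix a b m a' b' m'
      assume "Suc 0 \<le> b" "b \<le> n" "Suc 0 \<le> b'" "b' \<le> n" and va: "?v a = ?v a'"
        and eq: "int (?v b) + int n * m = int (?v b') + int n * m'"
      then have "?v b \<in> {1..n}" "?v b' \<in> {1..n}" using vin by simp_all
      then have "?v b = ?v b' \<and> m = m'" using eq residue_eq_iff by blast
      then show "a = a' \<and> b = b' \<and> m = m'" using va permutes_inj[OF v] by (simp add: inj_eq)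
    qed
  next
    case 2
    show ?case by simp
  next
    case (3 x)
    then obtain a b m where x: "x = ((a, b), m)" "a \<in> {1..n}" "b \<in> {1..n}" by auto
    show ?case
      by (rule exI[of _ "?v a"], rule exI[of _ "?v b"], rule exI[of _ m]) (use x vin in simp)
  qed
  also have "\<dots> = (\<Prod>p\<in>Pn n. \<Prod>m\<in>{1..Mexp \<mu> p}. cval m (int (?v (fst p)) - int (?v (snd p))))"
    by (subst prod.Sigma) (auto simp: case_prod_unfold)
  also have "\<dots> = (\<Prod>p\<in>Pn n. thalf powi (- max 0 (Mexp \<mu> p))) * (\<Prod>p\<in>Pn n. Hf (Mexp \<mu> p) (int (?v (fst p)) - int (?v (snd p))))"
    unfolding prod_cval by (rule prod.distrib)
  also have "(\<Prod>p\<in>Pn n. Hf (Mexp \<mu> p) (int (?v (fst p)) - int (?v (snd p)))) = GH n \<mu>"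
    unfolding GH_def by (rule prod.cong) (auto simp: Mexp_def)
  finally show ?thesis unfolding prod_thalf_powi by (simp add: sum_negf)
qed

text \<open>The length formula l(t_mu) = l(u_mu) + l(v_mu). Inversions of the inverse of v_mu
  correspond to pairs a < b with mu_a > mu_b, and these are the pairs for which \<open>Mexp\<close>
  falls short of the positive difference by one.\<close>

lemma len_inv_vperm: "int (len n (inv (vperm n \<mu>))) = desc n \<mu> - (\<Sum>p\<in>Pn n. max 0 (Mexp \<mu> p))"
proof -
  let ?v = "vperm n \<mu>"
  have v: "?v permutes {1..n}" by (rule vperm_permutes)
  let ?D = "{(a, b) \<in> Pn n. a < b \<and> lk \<mu> b < lk \<mu> a}"
  have "{(i, j) \<in> Pn n. i < j \<and> inv ?v j < inv ?v i} = (\<lambda>(a, b). (?v b, ?v a)) ` ?D"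
  proof (intro equalityI subsetI)
    fix p assume "p \<in> {(i, j) \<in> Pn n. i < j \<and> inv ?v j < inv ?v i}"
    then obtain i j where p: "p = (i, j)" "i \<in> {1..n}" "j \<in> {1..n}" "i < j" "inv ?v j < inv ?v i" by auto
    define a b where "a = inv ?v j" "b = inv ?v i"
    have ab: "a \<in> {1..n}" "b \<in> {1..n}" using p(2,3) permutes_in_image[OF permutes_inv[OF v]] unfolding a_b_def by blast+
    have "?v a = j" "?v b = i" using permutes_inverses(1)[OF v] by (simp_all add: a_b_def)
    moreover have "lk \<mu> b < lk \<mu> a"
      using p vperm_less_iff[OF ab(2,1), of \<mu>] calculation by (auto simp: vleq_def a_b_def)
    ultimately show "p \<in> (\<lambda>(a, b). (?v b, ?v a)) ` ?D"
      using ab p by (auto simp: a_b_def intro!: image_eqI[where x = "(a, b)"])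
  next
    fix p assume "p \<in> (\<lambda>(a, b). (?v b, ?v a)) ` ?D"
    then obtain a b where ab: "p = (?v b, ?v a)" "a \<in> {1..n}" "b \<in> {1..n}" "a < b" "lk \<mu> b < lk \<mu> a" by auto
    moreover have "?v a \<in> {1..n}" "?v b \<in> {1..n}" using ab permutes_in_image[OF v] by blast+
    moreover have "?v b < ?v a" using vperm_less_iff[OF ab(3,2), of \<mu>] ab by (auto simp: vleq_def)
    ultimately show "p \<in> {(i, j) \<in> Pn n. i < j \<and> inv ?v j < inv ?v i}"
      using permutes_inverses(2)[OF v] by simp
  qed
  moreover have "inj_on (\<lambda>(a, b). (?v b, ?v a)) ?D"
    using permutes_inj[OF v] by (auto simp: inj_on_def)
  ultimately have "len n (inv ?v) = card ?D"
    unfolding len_eq_card[OF permutes_inv[OF v]] by (simp add: card_image)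
  also have "int (card ?D) = (\<Sum>(a, b)\<in>Pn n. of_bool (a < b \<and> lk \<mu> b < lk \<mu> a))"
  proof -
    have "?D = {p \<in> Pn n. case p of (a, b) \<Rightarrow> a < b \<and> lk \<mu> b < lk \<mu> a}" by auto
    then show ?thesis by (simp add: case_prod_unfold of_bool_def sum.If_cases Int_def)
  qed
  also have "\<dots> = (\<Sum>p\<in>Pn n. (case p of (a, b) \<Rightarrow> max 0 (lk \<mu> a - lk \<mu> b)) - max 0 (Mexp \<mu> p))"
    by (rule sum.cong) (auto simp: Mexp_def)
  also have "\<dots> = desc n \<mu> - (\<Sum>p\<in>Pn n. max 0 (Mexp \<mu> p))"
    by (simp add: sum_subtractf desc_def)
  finally show ?thesis .
qed

lemma Gval_eq_ev0_t:
  "Gval n \<mu> = thalf powi ((int n - 1) * wt_sum n \<mu>) * thalf powi (- int (len n (inv (vperm n \<mu>)))) * ev0_t n (c_prod n (uperm n \<mu>))"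
proof -
  have "(int n - 1) * wt_sum n \<mu> - desc n \<mu>
     = (int n - 1) * wt_sum n \<mu> + (- int (len n (inv (vperm n \<mu>)))) + (- (\<Sum>p\<in>Pn n. max 0 (Mexp \<mu> p)))"
    unfolding len_inv_vperm by simp
  then show ?thesis
    unfolding Gval_def ev0_t_uperm by (simp only: power_int_add thalf_nonzero disjI1 mult.assoc simp_thms)
qed

text \<open>The alternating sum is a Laurent polynomial and so has some value; the vanishing comes
  from the prefactor, none of whose denominators is zero at the point.\<close>

lemma eval_princ_A:
  assumes E: "macdonald_E n E" and n2: "2 \<le> n" and lam: "lam \<in> Zn n"
  shows "eval_princ (macdonald_A n E lam) = 0"
proof -
  have rho: "lam + rho n \<in> Zn n"
    using lam by (simp add: Zn_iff rho_def lookup_add lookup_zvec)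
  let ?s = "\<Sum>w | w permutes {1..n}. (-1) ^ len n w * act w (E (lam + rho n))"
  have "(-1) ^ len n w * act w (E (lam + rho n)) \<in> Lau" if "w permutes {1..n}" for w
  proof -
    have "(-1) ^ k = scal ((-1) ^ k)" for k by (simp add: scal_power scal_uminus)
    then show ?thesis
      using laurent_polys_Lau[OF E_Laurent[OF n E rho]] permutes_bij[OF that] by (simp add: Lau_mult Lau_scal Lau_act)
  qed
  then have "?s \<in> Lau" by (intro Lau_sum) simp
  then have s: "princ.has_value ?s (eval_princ ?s)" by (rule has_value_Lau)
  let ?c = "\<lambda>(i, j). (tK ^ (j - 1) - tK * tK ^ (i - 1)) / (tK ^ (i - 1) - tK ^ (j - 1))"
  have "princ.has_value (case p of (i, j) \<Rightarrow> (xvar j - scal tK * xvar i) / (xvar i - xvar j)) (?c p)" if "p \<in> pairs n" for p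
  proof -
    obtain i j where p: "p = (i, j)" "1 \<le> i" "i < j" using \<open>p \<in> pairs n\<close> by (auto simp: pairs_def)
    have "tK ^ (i - 1) - tK ^ (j - 1) \<noteq> 0" using p by (auto simp: tK_power_eq_iff)
    then show ?thesis unfolding p(1) prod.case
      by (intro princ.has_value_divide princ.has_value_diff princ.has_value_mult princ.has_value_scal princ.has_value_xvar)
  qed
  then have "princ.has_value (\<Prod>p\<in>pairs n. case p of (i, j) \<Rightarrow> (xvar j - scal tK * xvar i) / (xvar i - xvar j)) (\<Prod>p\<in>pairs n. ?c p)"
    by (rule princ.has_value_prod)
  then have "princ.has_value (macdonald_A n E lam) ((\<Prod>p\<in>pairs n. ?c p) * eval_princ ?s)"
    unfolding macdonald_A_def using s by (rule princ.has_value_mult)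
  moreover have "(\<Prod>p\<in>pairs n. ?c p) = 0"
  proof (rule prod_zero)
    have "pairs n \<subseteq> Pn n" by (auto simp: pairs_def)
    then show "finite (pairs n)" by (rule finite_subset) simp
    \<comment> \<open>At (1, 2) the numerator is t - t; this pair exists only for n >= 2.\<close>
    show "\<exists>p\<in>pairs n. ?c p = 0"
      by (rule bexI[of _ "(1, 2)"]) (use n2 in \<open>simp_all add: pairs_def\<close>)
  qed
  ultimately show ?thesis using eval_princ_eqI by simp
qed

end

subsection \<open>Triangularity\<close>

text \<open>\<open>below n\<close> plays the role of the Bruhat order on exponent vectors, in a form that is
  visibly stable under the rotation, under the descents \<open>swap\<close> and under passing to
  convex combinations of \<open>\<nu>\<close> and \<open>s\<^sub>i\<nu>\<close>.\<close>

definition Nf :: "nat \<Rightarrow> (nat \<Rightarrow>\<^sub>0 int) \<Rightarrow> nat \<Rightarrow> int \<Rightarrow> int" where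
  "Nf n \<nu> r k = (\<Sum>j\<in>{1..n}. max 0 (lk \<nu> j - k - of_bool (j < r)))"

definition below :: "nat \<Rightarrow> (nat \<Rightarrow>\<^sub>0 int) \<Rightarrow> (nat \<Rightarrow>\<^sub>0 int) \<Rightarrow> bool" where
  "below n \<nu> \<mu> \<longleftrightarrow> (\<forall>r\<in>{1..n+1}. \<forall>k. Nf n \<nu> r k \<le> Nf n \<mu> r k)"

lemma belowD: "below n \<nu> \<mu> \<Longrightarrow> 1 \<le> r \<Longrightarrow> r \<le> n + 1 \<Longrightarrow> Nf n \<nu> r k \<le> Nf n \<mu> r k"
  by (simp add: below_def)

lemma Nf_down: "Nf n (down n \<mu>) r k = Nf n \<mu> r (k + 1)"
  unfolding Nf_def by (rule sum.cong) (auto simp: lookup_down algebra_simps)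

lemma below_down: "below n \<nu> \<mu> \<Longrightarrow> below n (down n \<nu>) (down n \<mu>)"
  by (simp add: below_def Nf_down)

text \<open>The index r is cyclic: one rotation lowers it by one, and r = 1 wraps to n with the
  level k lowered by one.\<close>

lemma Nf_rot:
  assumes n: "0 < n" and r: "1 \<le> r" "r \<le> n + 1"
  shows "Nf n (rot n \<mu>) r k = (if r = 1 then Nf n \<mu> n (k - 1) else Nf n \<mu> (r - 1) k)"
proof -
  have "Nf n (rot n \<mu>) r k = (\<Sum>j\<in>{1..n}. max 0 (lk (rot n \<mu>) (cyc n j) - k - of_bool (cyc n j < r)))"
    unfolding Nf_def
    by (rule sum.reindex_bij_betw[symmetric, OF permutes_imp_bij[OF cyc_permutes[OF n]]])
  also have "\<dots> = (\<Sum>j\<in>{1..n}. if r = 1 then max 0 (lk \<mu> j - (k - 1) - of_bool (j < n)) else max 0 (lk \<mu> j - k - of_bool (j < r - 1)))"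
  proof (rule sum.cong[OF refl])
    fix j assume j: "j \<in> {1..n}"
    have "cyc n j < r \<longleftrightarrow> (if j = n then 1 < r else j < r - 1)" using n r j by (auto simp: cyc_def)
    then show "max 0 (lk (rot n \<mu>) (cyc n j) - k - of_bool (cyc n j < r))
      = (if r = 1 then max 0 (lk \<mu> j - (k - 1) - of_bool (j < n)) else max 0 (lk \<mu> j - k - of_bool (j < r - 1)))"
      unfolding lookup_rot[OF n j] using r j by (cases "r = 1"; cases "j = n") auto
  qed
  finally show ?thesis by (simp add: Nf_def)
qed

lemma below_rot: "0 < n \<Longrightarrow> below n \<nu> \<mu> \<Longrightarrow> below n (rot n \<nu>) (rot n \<mu>)"
proof -
  assume n: "0 < n" and b: "below n \<nu> \<mu>"
  show ?thesis unfolding below_def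
  proof (intro ballI allI)
    fix r k assume r: "r \<in> {1..n+1}"
    then have r': "1 \<le> r" "r \<le> n + 1" by auto
    show "Nf n (rot n \<nu>) r k \<le> Nf n (rot n \<mu>) r k"
      unfolding Nf_rot[OF n r'] using belowD[OF b, of n "k - 1"] belowD[OF b, of "r - 1" k] n r' by auto
  qed
qed

text \<open>The lattice points on the segment from \<open>\<nu>\<close> to \<open>s\<^sub>i\<nu>\<close>.\<close>

definition segm :: "nat \<Rightarrow> (nat \<Rightarrow>\<^sub>0 int) \<Rightarrow> (nat \<Rightarrow>\<^sub>0 int) \<Rightarrow> bool" where
  "segm i \<nu> \<kappa> \<longleftrightarrow> (\<forall>j. j \<noteq> i \<and> j \<noteq> Suc i \<longrightarrow> lk \<kappa> j = lk \<nu> j) \<and> lk \<kappa> i + lk \<kappa> (Suc i) = lk \<nu> i + lk \<nu> (Suc i) \<and>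
    min (lk \<nu> i) (lk \<nu> (Suc i)) \<le> lk \<kappa> i \<and> lk \<kappa> i \<le> max (lk \<nu> i) (lk \<nu> (Suc i))"

lemma segm_refl: "segm i \<nu> \<nu>"
  by (auto simp: segm_def)

text \<open>Convexity of the excess \<open>max 0 (z - k)\<close>: moving two entries of fixed sum
  towards each other does not increase the total.\<close>

lemma convex_pair:
  fixes a b c d k :: int
  assumes "c + d = a + b" "min a b \<le> c" "c \<le> max a b"
  shows "max 0 (c - k) + max 0 (d - k) \<le> max 0 (a - k) + max 0 (b - k)"
  using assms by (simp add: max_def min_def split: if_splits)

text \<open>Two uniform levels control the mixed one. For b <= k the right-hand side is that of the
  first bound; for b > k it is one more than that of the second, while the left-hand side grows by
  at most one.\<close>

lemma descent_pair:
  fixes a b c d k R S :: int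
  assumes "b < a"
    and "R + (max 0 (c - k) + max 0 (d - k)) \<le> S + (max 0 (a - k) + max 0 (b - k))"
    and "R + (max 0 (c - k - 1) + max 0 (d - k - 1)) \<le> S + (max 0 (a - k - 1) + max 0 (b - k - 1))"
  shows "R + (max 0 (c - k - 1) + max 0 (d - k)) \<le> S + (max 0 (b - k - 1) + max 0 (a - k))"
  using assms by (simp add: max_def split: if_splits)

context
  fixes n i :: nat assumes i: "1 \<le> i" "i < n"
begin

definition Nrest :: "(nat \<Rightarrow>\<^sub>0 int) \<Rightarrow> nat \<Rightarrow> int \<Rightarrow> int" where
  "Nrest \<nu> r k = (\<Sum>j\<in>{1..n} - {i, Suc i}. max 0 (lk \<nu> j - k - of_bool (j < r)))"

lemma Nf_split:
  "Nf n \<nu> r k = Nrest \<nu> r k + (max 0 (lk \<nu> i - k - of_bool (i < r)) + max 0 (lk \<nu> (Suc i) - k - of_bool (Suc i < r)))"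
proof -
  have "Nf n \<nu> r k = Nrest \<nu> r k + (\<Sum>j\<in>{i, Suc i}. max 0 (lk \<nu> j - k - of_bool (j < r)))"
    unfolding Nf_def Nrest_def by (rule sum.subset_diff) (use i in auto)
  then show ?thesis by simp
qed

lemma Nrest_cong: "(\<And>j. j \<noteq> i \<Longrightarrow> j \<noteq> Suc i \<Longrightarrow> lk \<kappa> j = lk \<nu> j) \<Longrightarrow> Nrest \<kappa> r k = Nrest \<nu> r k"
  unfolding Nrest_def by (rule sum.cong) auto

lemma Nrest_Suc: "Nrest \<nu> i k = Nrest \<nu> (Suc i) k" "Nrest \<nu> (Suc (Suc i)) k = Nrest \<nu> (Suc i) k"
  unfolding Nrest_def by (rule sum.cong; auto)+

lemma Nrest_swap: "Nrest (swap n i \<mu>) r k = Nrest \<mu> r k"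
  unfolding Nrest_def by (rule sum.cong) (auto simp: lookup_swap transpose_def)

lemma lookup_swap_pair: "lk (swap n i \<mu>) i = lk \<mu> (Suc i)" "lk (swap n i \<mu>) (Suc i) = lk \<mu> i"
  using i by (simp_all add: lookup_swap)

lemma Nf_swap: "r \<noteq> Suc i \<Longrightarrow> Nf n (swap n i \<mu>) r k = Nf n \<mu> r k"
  by (auto simp: Nf_split Nrest_swap lookup_swap_pair)

lemma Nf_segm:
  assumes "segm i \<nu> \<kappa>" "r \<noteq> Suc i" shows "Nf n \<kappa> r k \<le> Nf n \<nu> r k"
proof -
  have "Nrest \<kappa> r k = Nrest \<nu> r k" by (rule Nrest_cong) (use assms in \<open>simp add: segm_def\<close>)
  moreover have "i < r \<longleftrightarrow> Suc i < r" using assms by auto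
  ultimately show ?thesis
    using convex_pair[of "lk \<kappa> i" "lk \<kappa> (Suc i)" "lk \<nu> i" "lk \<nu> (Suc i)" "k + of_bool (i < r)"] assms(1)
    by (simp add: Nf_split segm_def algebra_simps)
qed

text \<open>For r other than i+1 the positions i and i+1 have the same level, so swapping changes
  nothing and convexity applies. For r = i+1 the bound follows from those for r = i and r = i+2 by
  \<open>descent_pair\<close>.\<close>

lemma below_swap:
  assumes "lk \<mu> (Suc i) < lk \<mu> i" "below n \<nu> \<mu>" "segm i \<nu> \<kappa>"
  shows "below n \<kappa> (swap n i \<mu>)"
  unfolding below_def
proof (intro ballI allI)
  fix r k assume r: "r \<in> {1..n+1}"
  have other: "Nf n \<kappa> r k \<le> Nf n \<mu> r k" if "r \<noteq> Suc i" "1 \<le> r" "r \<le> n + 1" for r k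
    using Nf_segm[OF assms(3) that(1), of k] belowD[OF assms(2) that(2,3), of k] by simp
  show "Nf n \<kappa> r k \<le> Nf n (swap n i \<mu>) r k"
  proof (cases "r = Suc i")
    case True
    have "Nf n \<kappa> i k \<le> Nf n \<mu> i k" "Nf n \<kappa> (Suc (Suc i)) k \<le> Nf n \<mu> (Suc (Suc i)) k"
      using other[of i k] other[of "Suc (Suc i)" k] i by simp_all
    then have "Nrest \<kappa> (Suc i) k + (max 0 (lk \<kappa> i - k) + max 0 (lk \<kappa> (Suc i) - k))
        \<le> Nrest \<mu> (Suc i) k + (max 0 (lk \<mu> i - k) + max 0 (lk \<mu> (Suc i) - k))"
      "Nrest \<kappa> (Suc i) k + (max 0 (lk \<kappa> i - k - 1) + max 0 (lk \<kappa> (Suc i) - k - 1))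
        \<le> Nrest \<mu> (Suc i) k + (max 0 (lk \<mu> i - k - 1) + max 0 (lk \<mu> (Suc i) - k - 1))"
      by (simp_all add: Nf_split Nrest_Suc)
    then have "Nrest \<kappa> (Suc i) k + (max 0 (lk \<kappa> i - k - 1) + max 0 (lk \<kappa> (Suc i) - k))
        \<le> Nrest \<mu> (Suc i) k + (max 0 (lk \<mu> (Suc i) - k - 1) + max 0 (lk \<mu> i - k))"
      by (rule descent_pair[OF assms(1)])
    then show ?thesis unfolding True by (simp add: Nf_split Nrest_swap lookup_swap_pair)
  next
    case False
    then show ?thesis using other[OF False] r Nf_swap[OF False] by simp
  qed
qed

text \<open>Guarantees that the leading coefficient at s_i mu comes from mu alone. The entries of
  \<open>\<nu>\<close> at i and i+1 must enclose those of mu, while \<open>below\<close> caps them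
  by mu_i; so \<open>\<nu>\<close> is mu or s_i mu, and the latter is not below mu.\<close>

lemma segm_swap_below_imp_eq:
  assumes des: "lk \<mu> (Suc i) < lk \<mu> i" and b: "below n \<nu> \<mu>" and s: "segm i \<nu> (swap n i \<mu>)"
    and Z: "\<nu> \<in> Zn n" "\<mu> \<in> Zn n"
  shows "\<nu> = \<mu>"
proof -
  let ?\<kappa> = "swap n i \<mu>" and ?a = "lk \<mu> i" and ?b = "lk \<mu> (Suc i)"
  have rest: "lk \<nu> j = lk \<mu> j" if "j \<noteq> i" "j \<noteq> Suc i" for j
  proof -
    have "lk ?\<kappa> j = lk \<mu> j" using that Z(2) by (auto simp: lookup_swap transpose_def Zn_iff)
    moreover have "lk ?\<kappa> j = lk \<nu> j" using s that unfolding segm_def by blast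
    ultimately show ?thesis by simp
  qed
  have R: "Nrest \<nu> r k = Nrest \<mu> r k" for r k by (rule Nrest_cong) (rule rest)
  \<comment> \<open>At level mu_i the two positions contribute 0 on the side of mu, so neither entry
    of \<open>\<nu>\<close> exceeds mu_i.\<close>
  have "Nf n \<nu> i ?a \<le> Nf n \<mu> i ?a" by (rule belowD[OF b]) (use i in auto)
  then have "lk \<nu> i \<le> ?a" "lk \<nu> (Suc i) \<le> ?a" using des by (simp_all add: Nf_split R)
  moreover have sum: "?b + ?a = lk \<nu> i + lk \<nu> (Suc i)" and "min (lk \<nu> i) (lk \<nu> (Suc i)) \<le> ?b"
    using s by (auto simp: segm_def lookup_swap_pair)
  ultimately have "lk \<nu> i = ?a \<and> lk \<nu> (Suc i) = ?b \<or> lk \<nu> i = ?b \<and> lk \<nu> (Suc i) = ?a" by linarith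
  moreover have "\<not> (lk \<nu> i = ?b \<and> lk \<nu> (Suc i) = ?a)"
  proof
    assume h: "lk \<nu> i = ?b \<and> lk \<nu> (Suc i) = ?a"
    \<comment> \<open>For s_i mu the two positions give mu_i - mu_(i+1), for mu one less.\<close>
    have "Nf n \<nu> (Suc i) ?b \<le> Nf n \<mu> (Suc i) ?b" by (rule belowD[OF b]) (use i in auto)
    then show False using des h by (simp add: Nf_split R)
  qed
  ultimately show ?thesis using rest by (intro poly_mapping_eqI) metis
qed

lemma segm_Zn: "segm i \<nu> \<kappa> \<Longrightarrow> \<nu> \<in> Zn n \<Longrightarrow> \<kappa> \<in> Zn n"
  using i by (auto simp: segm_def Zn_iff)

end

lemma T_xmon_keys:
  obtains p where "T i (xmon \<nu>) = to_fract p" "\<And>\<kappa>. \<kappa> \<in> keys p \<Longrightarrow> segm i \<nu> \<kappa>"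
    "lk \<nu> (Suc i) < lk \<nu> i \<Longrightarrow> lk p (permexp (Transposition.transpose i (Suc i)) \<nu>) = 1"
proof -
  let ?s = "permexp (Transposition.transpose i (Suc i))"
  have ls: "lk (?s \<nu>) j = lk \<nu> (Transposition.transpose i (Suc i) j)" for \<nu> j by (simp add: lookup_permexp)
  define q where "q = (\<lambda>\<nu>. single (?s \<nu>) 1 + (\<Sum>j<nat (lk \<nu> i - lk \<nu> (Suc i)). single (\<nu> - sg i j) (1 - tK)))"
  have Tq: "T i (xmon \<nu>) = to_fract (q \<nu>)" if "lk \<nu> (Suc i) \<le> lk \<nu> i" for \<nu>
  proof -
    have "T i (xmon \<nu>) = xmon (?s \<nu>) + (1 - tt) * (\<Sum>j<nat (lk \<nu> i - lk \<nu> (Suc i)). xmon (\<nu> - sg i j))"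
      by (rule T_xmon) (use that in simp)
    then show ?thesis by (simp add: q_def to_fract_single scal_diff sum_distrib_left)
  qed
  have kq: "segm i \<nu> \<kappa>" if "\<kappa> \<in> keys (q \<nu>)" "lk \<nu> (Suc i) \<le> lk \<nu> i" for \<nu> \<kappa>
  proof -
    have "lk (q \<nu>) \<kappa> \<noteq> 0" using that by (simp add: in_keys_iff)
    then have "\<kappa> = ?s \<nu> \<or> (\<exists>j<nat (lk \<nu> i - lk \<nu> (Suc i)). \<kappa> = \<nu> - sg i j)"
      unfolding q_def lookup_add lookup_sum lookup_single when_def
      by (rule contrapos_np) (auto intro!: sum.neutral)
    then show ?thesis
    proof
      assume "\<kappa> = ?s \<nu>"
      then show ?thesis by (auto simp: segm_def ls transpose_def)
    next
      assume "\<exists>j<nat (lk \<nu> i - lk \<nu> (Suc i)). \<kappa> = \<nu> - sg i j"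
      then show ?thesis by (auto simp: segm_def lookup_minus lookup_sg)
    qed
  qed
  show ?thesis
  proof (cases "lk \<nu> (Suc i) \<le> lk \<nu> i")
    case True
    have "lk (q \<nu>) (?s \<nu>) = 1" if "lk \<nu> (Suc i) < lk \<nu> i"
    proof -
      have "lk (single (\<nu> - sg i j) (1 - tK)) (?s \<nu>) = 0" if "j < nat (lk \<nu> i - lk \<nu> (Suc i))" for j
      proof -
        have "lk (\<nu> - sg i j) i \<noteq> lk (?s \<nu>) i" using that by (simp add: lookup_minus lookup_sg ls)
        then have "\<nu> - sg i j \<noteq> ?s \<nu>" by metis
        then show ?thesis by (simp add: lookup_single)
      qed
      then show ?thesis by (simp add: q_def lookup_add lookup_sum)
    qed
    then show ?thesis using that[of "q \<nu>"] Tq[OF True] kq[OF _ True] by blast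
  next
    case False
    have d: "lk (?s \<nu>) (Suc i) \<le> lk (?s \<nu>) i" using False by (simp add: ls)
    let ?p = "single (?s \<nu>) 1 + single \<nu> 1 - q (?s \<nu>)"
    have "T i (xmon \<nu>) = xmon (?s \<nu>) + xmon \<nu> - T i (xmon (?s \<nu>))"
      using T_xmon_swap[of i "?s \<nu>"] by (simp only: permexp_transpose_invol)
    then have 1: "T i (xmon \<nu>) = to_fract ?p" by (simp add: Tq[OF d] to_fract_single)
    have seg: "segm i (?s \<nu>) \<kappa> \<Longrightarrow> segm i \<nu> \<kappa>" for \<kappa>
      by (auto simp: segm_def ls transpose_def min.commute max.commute)
    have "segm i \<nu> \<kappa>" if "\<kappa> \<in> keys ?p" for \<kappa>
    proof -
      have "\<kappa> = ?s \<nu> \<or> \<kappa> = \<nu> \<or> \<kappa> \<in> keys (q (?s \<nu>))"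
        using that by (auto simp: in_keys_iff lookup_add lookup_minus lookup_single when_def split: if_splits)
      moreover have "segm i (?s \<nu>) (?s \<nu>)" by (rule segm_refl)
      ultimately show ?thesis using seg kq[OF _ d] segm_refl by blast
    qed
    then show ?thesis using that[of ?p] 1 False by auto
  qed
qed

section \<open>Triangularity of the Macdonald polynomials\<close>

definition triangular :: "nat \<Rightarrow> (nat \<Rightarrow>\<^sub>0 int) \<Rightarrow> ratfun \<Rightarrow> bool" where
  "triangular n \<mu> f \<longleftrightarrow> (\<exists>p. f = to_fract p \<and> (\<forall>\<nu>\<in>keys p. \<nu> \<in> Zn n \<and> below n \<nu> \<mu>) \<and> lk p \<mu> = 1)"

lemma keys_scaled: "keys (single 0 c * p) \<subseteq> keys p" for p :: laurent
proof
  fix \<kappa> assume "\<kappa> \<in> keys (single 0 c * p)"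
  then have "\<kappa> \<in> {a + b | a b. a \<in> keys (single 0 c) \<and> b \<in> keys p}" using keys_mult by blast
  then show "\<kappa> \<in> keys p" by (auto split: if_splits)
qed

lemma lookup_scaled: "lk (single 0 c * p) \<kappa> = c * lk p \<kappa>" for p :: laurent
proof -
  have "lk (Poly_Mapping.map ((*) c) p) \<kappa> = c * lk p \<kappa>"
    by (simp add: Poly_Mapping.map.rep_eq when_def)
  then show ?thesis by (simp only: mult_map_scale_conv_mult)
qed

lemma scal_to_fract: "scal c * to_fract p = to_fract (single 0 c * p)"
  by (simp add: scal_def)

text \<open>A linear map preserves triangularity if it sends monomials below the old exponent to
  terms below the new one and only the old leading monomial reaches the new leading one. Each of the
  three moves uses this.\<close>

lemma triangular_image:
  assumes tri: "triangular n \<mu> f"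
    and add: "\<And>f g. F (f + g) = F f + F g" and sc: "\<And>c f. F (scal c * f) = scal c * F f"
    and mono: "\<And>\<nu>. \<nu> \<in> Zn n \<Longrightarrow> F (xmon \<nu>) = to_fract (q \<nu>)"
    and keys: "\<And>\<nu> \<kappa>. \<nu> \<in> Zn n \<Longrightarrow> below n \<nu> \<mu> \<Longrightarrow> \<kappa> \<in> keys (q \<nu>) \<Longrightarrow> \<kappa> \<in> Zn n \<and> below n \<kappa> \<mu>'"
    and lead: "lk (q \<mu>) \<mu>' = 1"
    and other: "\<And>\<nu>. \<nu> \<in> Zn n \<Longrightarrow> below n \<nu> \<mu> \<Longrightarrow> \<nu> \<noteq> \<mu> \<Longrightarrow> lk (q \<nu>) \<mu>' = 0"
  shows "triangular n \<mu>' (F f)"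
proof -
  obtain p where p: "f = to_fract p" "\<And>\<nu>. \<nu> \<in> keys p \<Longrightarrow> \<nu> \<in> Zn n \<and> below n \<nu> \<mu>" "lk p \<mu> = 1"
    using tri by (auto simp: triangular_def)
  have "F 0 = 0" using sc[of 0 0] by simp
  then have sum: "F (\<Sum>\<nu>\<in>A. h \<nu>) = (\<Sum>\<nu>\<in>A. F (h \<nu>))" for A :: "(nat \<Rightarrow>\<^sub>0 int) set" and h
    by (induction A rule: infinite_finite_induct) (simp_all add: add)
  let ?r = "\<Sum>\<nu>\<in>keys p. single 0 (lk p \<nu>) * q \<nu>"
  have "F f = (\<Sum>\<nu>\<in>keys p. scal (lk p \<nu>) * F (xmon \<nu>))"
    unfolding p(1) to_fract_expand sum sc ..
  also have "\<dots> = (\<Sum>\<nu>\<in>keys p. to_fract (single 0 (lk p \<nu>) * q \<nu>))"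
    by (rule sum.cong) (use p(2) mono in \<open>simp_all only: scal_to_fract\<close>)
  finally have 1: "F f = to_fract ?r" by (simp only: to_fract_sum)
  have 2: "\<kappa> \<in> Zn n \<and> below n \<kappa> \<mu>'" if "\<kappa> \<in> keys ?r" for \<kappa>
  proof -
    have "(\<Sum>\<nu>\<in>keys p. lk (single 0 (lk p \<nu>) * q \<nu>) \<kappa>) \<noteq> 0" using that by (simp add: in_keys_iff lookup_sum)
    then obtain \<nu> where "\<nu> \<in> keys p" "lk (single 0 (lk p \<nu>) * q \<nu>) \<kappa> \<noteq> 0"
      by (rule sum.not_neutral_contains_not_neutral)
    then show ?thesis using keys[of \<nu> \<kappa>] p(2)[of \<nu>] by (simp add: lookup_scaled in_keys_iff)
  qed
  have \<mu>: "\<mu> \<in> keys p" using p(3) by (simp add: in_keys_iff)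
  have "lk ?r \<mu>' = (\<Sum>\<nu>\<in>keys p. if \<nu> = \<mu> then 1 else 0)"
    unfolding lookup_sum lookup_scaled
    by (rule sum.cong) (use p(2,3) lead other in auto)
  then have "lk ?r \<mu>' = 1" using \<mu> by simp
  then show ?thesis unfolding triangular_def using 1 2 by blast
qed

lemma permexp_cyc: "0 < n \<Longrightarrow> \<nu> \<in> Zn n \<Longrightarrow> permexp (cyc n) \<nu> + single 1 1 = rot n \<nu>"
proof (rule poly_mapping_eqI)
  fix j assume n: "0 < n" and \<nu>: "\<nu> \<in> Zn n"
  obtain c where c: "j = cyc n c" using bij_cyc[OF n] by (metis bij_pointE)
  have "inv (cyc n) j = c" using bij_cyc[OF n] c by (simp add: bij_is_inj)
  then have "lk (permexp (cyc n) \<nu> + single 1 1) j = lk \<nu> c + (if j = 1 then 1 else 0)"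
    using bij_cyc[OF n] by (simp add: lookup_add lookup_permexp lookup_single when_def)
  also have "\<dots> = lk (rot n \<nu>) j"
  proof (cases "c \<in> {1..n}")
    case True
    then show ?thesis unfolding c lookup_rot[OF n True] by (auto simp: cyc_def)
  next
    case False
    then have "j = c" "j \<notin> {1..n}" unfolding c using n by (auto simp: cyc_def)
    then show ?thesis using \<nu> False n by (auto simp: rot_def lookup_zvec Zn_iff)
  qed
  finally show "lk (permexp (cyc n) \<nu> + single 1 1) j = lk (rot n \<nu>) j" .
qed

lemma rot_eq_iff: "0 < n \<Longrightarrow> \<nu> \<in> Zn n \<Longrightarrow> \<mu> \<in> Zn n \<Longrightarrow> rot n \<nu> = rot n \<mu> \<longleftrightarrow> \<nu> = \<mu>"
  using permexp_cyc[of n \<nu>] permexp_cyc[of n \<mu>] permexp_eq_iff[OF bij_cyc, of n \<nu> \<mu>] by (metis add_right_cancel)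

lemma permexp_swap:
  assumes "1 \<le> i" "i < n" "\<mu> \<in> Zn n"
  shows "permexp (Transposition.transpose i (Suc i)) \<mu> = swap n i \<mu>"
proof (rule poly_mapping_eqI)
  fix j
  have "Transposition.transpose i (Suc i) j \<notin> {1..n}" if "j \<notin> {1..n}" using that assms by (auto simp: transpose_def)
  then show "lk (permexp (Transposition.transpose i (Suc i)) \<mu>) j = lk (swap n i \<mu>) j"
    using assms by (auto simp: lookup_permexp lookup_swap Zn_iff)
qed

lemma triangular_add_lower:
  assumes f: "triangular n \<mu>' f" and g: "g = to_fract p" "\<And>\<nu>. \<nu> \<in> keys p \<Longrightarrow> \<nu> \<in> Zn n \<and> below n \<nu> \<mu>'" "lk p \<mu>' = 0"
  shows "triangular n \<mu>' (f + g)"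
proof -
  obtain q where q: "f = to_fract q" "\<And>\<nu>. \<nu> \<in> keys q \<Longrightarrow> \<nu> \<in> Zn n \<and> below n \<nu> \<mu>'" "lk q \<mu>' = 1"
    using f by (auto simp: triangular_def)
  have "f + g = to_fract (q + p)" by (simp add: q(1) g(1))
  moreover have "\<forall>\<nu>\<in>keys (q + p). \<nu> \<in> Zn n \<and> below n \<nu> \<mu>'"
    using Poly_Mapping.keys_add[of q p] q(2) g(2) by blast
  moreover have "lk (q + p) \<mu>' = 1" by (simp add: lookup_add q(3) g(3))
  ultimately show ?thesis unfolding triangular_def by blast
qed

lemma E_triangular:
  assumes n: "0 < n" and E: "macdonald_E n E"
  shows "\<mu> \<in> Zn n \<Longrightarrow> triangular n \<mu> (E \<mu>)"
  using n
proof (induction \<mu> rule: Zn_induct)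
  case zero
  have "keys (1 :: laurent) = {0}" by simp
  then show ?case unfolding E_zero[OF n E] triangular_def
    by (intro exI[of _ 1]) (auto simp: below_def Zn_iff lookup_one)
next
  case (rot \<mu>)
  show ?case unfolding E_rot[OF n E rot.hyps]
  proof (rule triangular_image[OF rot.IH, where F = "\<lambda>f. scal (qK powi lk \<mu> n) * (xvar 1 * G n f)"
        and q = "\<lambda>\<nu>. single (rot n \<nu>) (qK powi (lk \<mu> n) * qK powi (- lk \<nu> n))"])
    fix \<nu> assume Z: "\<nu> \<in> Zn n"
    have "scal (qK powi lk \<mu> n) * (xvar 1 * G n (xmon \<nu>))
        = scal (qK powi lk \<mu> n * qK powi - lk \<nu> n) * (xmon (permexp (cyc n) \<nu>) * xmon (single 1 1))"
      unfolding G_xmon[OF n] xvar_xmon scal_mult by (simp only: mult_ac)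
    also have "\<dots> = to_fract (single (rot n \<nu>) (qK powi lk \<mu> n * qK powi - lk \<nu> n))"
      unfolding xmon_add[symmetric] permexp_cyc[OF n Z] to_fract_single ..
    finally show "scal (qK powi lk \<mu> n) * (xvar 1 * G n (xmon \<nu>)) = to_fract (single (rot n \<nu>) (qK powi lk \<mu> n * qK powi - lk \<nu> n))" .
  next
    fix \<nu> \<kappa> assume "\<nu> \<in> Zn n" "below n \<nu> \<mu>" "\<kappa> \<in> keys (single (rot n \<nu>) (qK powi lk \<mu> n * qK powi - lk \<nu> n))"
    then have "\<kappa> = rot n \<nu>" by (simp split: if_splits)
    then show "\<kappa> \<in> Zn n \<and> below n \<kappa> (rot n \<mu>)" using \<open>below n \<nu> \<mu>\<close> by (simp add: rot_Zn below_rot n)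
  next
    show "lk (single (rot n \<mu>) (qK powi lk \<mu> n * qK powi - lk \<mu> n)) (rot n \<mu>) = 1" by (simp add: power_int_minus)
    show "lk (single (rot n \<nu>) (qK powi lk \<mu> n * qK powi - lk \<nu> n)) (rot n \<mu>) = 0"
      if "\<nu> \<in> Zn n" "\<nu> \<noteq> \<mu>" for \<nu>
      using that rot_eq_iff[OF n that(1) rot.hyps] by (simp add: lookup_single)
  qed (simp_all only: G_add[OF n] G_mult[OF n] G_scal[OF n] distrib_left mult.left_commute)
next
  case (swap \<mu> i)
  note i = swap.hyps(2,3) and des = swap.hyps(5)
  have ps: "permexp (Transposition.transpose i (Suc i)) \<mu> = swap n i \<mu>"
    by (rule permexp_swap[OF i swap.hyps(1)])
  have "\<exists>p. T i (xmon \<nu>) = to_fract p \<and> (\<forall>\<kappa>\<in>keys p. segm i \<nu> \<kappa>) \<and>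
      (lk \<nu> (Suc i) < lk \<nu> i \<longrightarrow> lk p (permexp (Transposition.transpose i (Suc i)) \<nu>) = 1)" for \<nu>
    by (rule T_xmon_keys[of i \<nu>], rule exI, intro conjI ballI impI)
  then have "\<forall>\<nu>. \<exists>p. T i (xmon \<nu>) = to_fract p \<and> (\<forall>\<kappa>\<in>keys p. segm i \<nu> \<kappa>) \<and>
      (lk \<nu> (Suc i) < lk \<nu> i \<longrightarrow> lk p (permexp (Transposition.transpose i (Suc i)) \<nu>) = 1)" by (rule allI)
  then have "\<exists>q. \<forall>\<nu>. T i (xmon \<nu>) = to_fract (q \<nu>) \<and> (\<forall>\<kappa>\<in>keys (q \<nu>). segm i \<nu> \<kappa>) \<and>
      (lk \<nu> (Suc i) < lk \<nu> i \<longrightarrow> lk (q \<nu>) (permexp (Transposition.transpose i (Suc i)) \<nu>) = 1)"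
    by (rule choice)
  then obtain q where q: "\<And>\<nu>. T i (xmon \<nu>) = to_fract (q \<nu>)" "\<And>\<nu> \<kappa>. \<kappa> \<in> keys (q \<nu>) \<Longrightarrow> segm i \<nu> \<kappa>"
    "\<And>\<nu>. lk \<nu> (Suc i) < lk \<nu> i \<Longrightarrow> lk (q \<nu>) (permexp (Transposition.transpose i (Suc i)) \<nu>) = 1"
    by blast
  have T: "triangular n (swap n i \<mu>) (T i (E \<mu>))"
  proof (rule triangular_image[OF swap.IH, where F = "T i" and q = q])
    show "\<kappa> \<in> Zn n \<and> below n \<kappa> (swap n i \<mu>)" if "\<nu> \<in> Zn n" "below n \<nu> \<mu>" "\<kappa> \<in> keys (q \<nu>)" for \<nu> \<kappa>
      using q(2)[OF that(3)] that below_swap[OF i des that(2)] segm_Zn[OF i] by blast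
    show "lk (q \<mu>) (swap n i \<mu>) = 1" using q(3)[OF des] by (simp only: ps)
    show "lk (q \<nu>) (swap n i \<mu>) = 0" if "\<nu> \<in> Zn n" "below n \<nu> \<mu>" "\<nu> \<noteq> \<mu>" for \<nu>
      using segm_swap_below_imp_eq[OF i des that(2) q(2) that(1) swap.hyps(1)] that(3)
      by (auto simp: in_keys_iff)
  qed (simp_all only: T_add T_scal q(1))
  obtain p where p: "E \<mu> = to_fract p" "\<And>\<nu>. \<nu> \<in> keys p \<Longrightarrow> \<nu> \<in> Zn n \<and> below n \<nu> \<mu>"
    using swap.IH by (auto simp: triangular_def)
  have ne: "swap n i \<mu> \<noteq> \<mu>" using des lookup_swap_pair(1)[OF i, of \<mu>] by auto
  show ?case unfolding E_swap[OF n E swap.hyps]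
  proof (rule triangular_add_lower[OF T])
    show "scal (bval n \<mu> i) * E \<mu> = to_fract (single 0 (bval n \<mu> i) * p)" by (simp only: p(1) scal_to_fract)
    show "\<nu> \<in> Zn n \<and> below n \<nu> (swap n i \<mu>)" if "\<nu> \<in> keys (single 0 (bval n \<mu> i) * p)" for \<nu>
      using that keys_scaled p(2)[of \<nu>] below_swap[OF i des _ segm_refl, of \<nu>] by blast
    \<comment> \<open>The correction term b E_mu does not contain s_i mu, which is not below
      mu.\<close>
    have "swap n i \<mu> \<notin> keys p"
      using segm_swap_below_imp_eq[OF i des _ segm_refl swap_Zn swap.hyps(1)] p(2)[of "swap n i \<mu>"] ne by blast
    then show "lk (single 0 (bval n \<mu> i) * p) (swap n i \<mu>) = 0" by (simp add: lookup_scaled in_keys_iff)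
  qed
next
  case (down \<mu>)
  define e where "e = (\<Sum>i\<in>{1..n}. single i (1::int))"
  have le: "lk e j = (if j \<in> {1..n} then 1 else 0)" for j
    unfolding e_def by (simp add: lookup_sum lookup_single when_def)
  have d: "down n \<nu> = \<nu> - e" if "\<nu> \<in> Zn n" for \<nu>
    using that by (intro poly_mapping_eqI) (auto simp: lookup_down lookup_minus le Zn_iff)
  have xs: "xmon (\<Sum>i\<in>A. single i 1) = (\<Prod>i\<in>A. xvar i)" if "finite A" for A
    using that by induction (simp_all add: xmon_add xvar_xmon)
  have pe: "(\<Prod>i\<in>{1..n}. inverse (xvar i)) = inverse (xmon e)"
    unfolding e_def xs[OF finite_atLeastAtMost] by (induction n) (simp_all add: mult.commute)
  show ?case unfolding E_down[OF n E down.hyps] pe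
  proof (rule triangular_image[OF down.IH, where F = "\<lambda>f. inverse (xmon e) * f" and q = "\<lambda>\<nu>. single (down n \<nu>) 1"])
    fix \<nu> assume Z: "\<nu> \<in> Zn n"
    show "inverse (xmon e) * xmon \<nu> = to_fract (single (down n \<nu>) 1)"
      unfolding d[OF Z] to_fract_single xmon_diff scal_1 by (simp add: divide_inverse mult.commute)
  next
    fix \<nu> \<kappa> assume "\<nu> \<in> Zn n" "below n \<nu> \<mu>" "\<kappa> \<in> keys (single (down n \<nu>) (1::K))"
    then show "\<kappa> \<in> Zn n \<and> below n \<kappa> (down n \<mu>)" by (simp add: down_Zn below_down)
  next
    show "lk (single (down n \<nu>) (1::K)) (down n \<mu>) = 0" if "\<nu> \<in> Zn n" "\<nu> \<noteq> \<mu>" for \<nu>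
      using that down.hyps by (simp add: d lookup_single)
  qed (simp_all only: distrib_left mult.left_commute lookup_single_eq)
qed

subsection \<open>Dominant exponents\<close>

definition dominant :: "nat \<Rightarrow> (nat \<Rightarrow>\<^sub>0 int) \<Rightarrow> bool" where
  "dominant n lam \<longleftrightarrow> lam \<in> Zn n \<and> (\<forall>i\<in>{1..n}. \<forall>j\<in>{1..n}. i \<le> j \<longrightarrow> lk lam j \<le> lk lam i)"

lemma dominantI:
  assumes "lam \<in> Zn n" "\<forall>i\<in>{1..<n}. lk lam (i + 1) \<le> lk lam i"
  shows "dominant n lam"
proof -
  have "lk lam (i + d) \<le> lk lam i" if "1 \<le> i" "i + d \<le> n" for i d
    using that
  proof (induction d)
    case (Suc d)
    then have "lk lam (Suc (i + d)) \<le> lk lam (i + d)" using assms(2) by simp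
    then show ?case using Suc by simp
  qed simp
  then have "lk lam j \<le> lk lam i" if "i \<in> {1..n}" "j \<in> {1..n}" "i \<le> j" for i j
    using that le_add_diff_inverse[OF that(3)] by (metis atLeastAtMost_iff)
  then show ?thesis using assms(1) by (simp add: dominant_def)
qed

lemma dominant_zero: "dominant n 0"
  by (simp add: dominant_def Zn_iff)

text \<open>The order on exponents is lexicographic with the first position most significant. If
  \<open>\<kappa>\<close> first exceeds \<open>lam\<close> at p, the earlier entries agree, the
  later entries of \<open>lam\<close> contribute nothing at level lam_p, and so
  \<open>\<kappa>\<close> has the larger excess.\<close>

lemma le_dominant:
  assumes lam: "dominant n lam" and \<kappa>: "\<kappa> \<in> Zn n" and le: "\<And>k. Nf n \<kappa> 1 k \<le> Nf n lam 1 k"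
  shows "\<kappa> \<le> lam"
proof (rule ccontr)
  assume "\<not> \<kappa> \<le> lam"
  then have "lam < \<kappa>" by simp
  then obtain p where p: "lk lam p < lk \<kappa> p" "\<And>j. j < p \<Longrightarrow> lk lam j = lk \<kappa> j"
    by (auto simp: less_poly_mapping.rep_eq less_fun_def)
  have pn: "p \<in> {1..n}" using p(1) lam \<kappa> by (metis Zn_iff dominant_def less_irrefl)
  have lamD: "lk lam j \<le> lk lam i" if "i \<in> {1..n}" "j \<in> {1..n}" "i \<le> j" for i j
    using lam that by (simp add: dominant_def)
  have "Nf n lam 1 (lk lam p) < Nf n \<kappa> 1 (lk lam p)"
    unfolding Nf_def
  proof (rule sum_strict_mono_ex1)
    show "\<forall>j\<in>{1..n}. max 0 (lk lam j - lk lam p - of_bool (j < 1)) \<le> max 0 (lk \<kappa> j - lk lam p - of_bool (j < 1))"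
    proof
      fix j assume j: "j \<in> {1..n}"
      show "max 0 (lk lam j - lk lam p - of_bool (j < 1)) \<le> max 0 (lk \<kappa> j - lk lam p - of_bool (j < 1))"
        using p(2)[of j] lamD[OF pn j] j by (cases "j < p") auto
    qed
    show "\<exists>j\<in>{1..n}. max 0 (lk lam j - lk lam p - of_bool (j < 1)) < max 0 (lk \<kappa> j - lk lam p - of_bool (j < 1))"
      using p(1) pn by (intro bexI[of _ p]) auto
  qed simp
  then show False using le[of "lk lam p"] by simp
qed

lemma Nf_permexp:
  assumes w: "w permutes {1..n}"
  shows "Nf n (permexp w \<nu>) 1 k = Nf n \<nu> 1 k"
proof -
  have "Nf n (permexp w \<nu>) 1 k = (\<Sum>j\<in>{1..n}. max 0 (lk (permexp w \<nu>) (w j) - k))"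
    using sum.reindex_bij_betw[OF permutes_imp_bij[OF w], of "\<lambda>j. max 0 (lk (permexp w \<nu>) j - k)"]
    by (auto simp: Nf_def intro!: sum.cong)
  also have "\<dots> = Nf n \<nu> 1 k"
    unfolding Nf_def by (rule sum.cong) (use w in \<open>auto simp: lookup_permexp permutes_bij permutes_inverses\<close>)
  finally show ?thesis .
qed

lemma permexp_Zn: "w permutes {1..n} \<Longrightarrow> \<nu> \<in> Zn n \<Longrightarrow> permexp w \<nu> \<in> Zn n"
  using permutes_not_in[OF permutes_inv, of w "{1..n}"] by (auto simp: Zn_iff lookup_permexp permutes_bij)

lemma permexp_le_dominant:
  assumes "dominant n lam" "w permutes {1..n}" "\<nu> \<in> Zn n" "below n \<nu> lam"
  shows "permexp w \<nu> \<le> lam"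
proof (rule le_dominant[OF assms(1) permexp_Zn[OF assms(2,3)]])
  show "Nf n (permexp w \<nu>) 1 k \<le> Nf n lam 1 k" for k
    using belowD[OF assms(4), of 1 k] Nf_permexp[OF assms(2), of \<nu> k] by simp
qed

text \<open>Equal multisets give equal \<open>Nf\<close> at r = 1, so \<open>below\<close> compares
  how many of the first j entries exceed a level. At level lam_j - 1 all of those of
  \<open>lam\<close> do, which forces \<open>\<nu>\<close> to be entrywise at least
  \<open>lam\<close>; the sums agree.\<close>

lemma below_dominant_orbit:
  assumes lam: "dominant n lam" and w: "w permutes {1..n}" and \<nu>: "\<nu> \<in> Zn n" and b: "below n \<nu> lam" and eq: "permexp w \<nu> = lam"
  shows "\<nu> = lam"
proof -
  have N1: "Nf n \<nu> 1 k = Nf n lam 1 k" for k using Nf_permexp[OF w, of \<nu> k] eq by simp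
  have Nr: "Nf n \<kappa> (Suc j) k = Nf n \<kappa> 1 k - int (card {i \<in> {1..j}. k < lk \<kappa> i})" if "j \<le> n" for \<kappa> j k
  proof -
    have "Nf n \<kappa> (Suc j) k = (\<Sum>i\<in>{1..n}. max 0 (lk \<kappa> i - k) - of_bool (i \<le> j \<and> k < lk \<kappa> i))"
      unfolding Nf_def by (rule sum.cong) auto
    also have "\<dots> = Nf n \<kappa> 1 k - (\<Sum>i\<in>{1..n}. of_bool (i \<le> j \<and> k < lk \<kappa> i))"
      by (simp add: sum_subtractf Nf_def)
    also have "(\<Sum>i\<in>{1..n}. of_bool (i \<le> j \<and> k < lk \<kappa> i)) = int (card {i \<in> {1..n}. i \<le> j \<and> k < lk \<kappa> i})"
      by (simp add: of_bool_def sum.If_cases Int_def)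
    also have "{i \<in> {1..n}. i \<le> j \<and> k < lk \<kappa> i} = {i \<in> {1..j}. k < lk \<kappa> i}" using that by auto
    finally show ?thesis .
  qed
  have ge: "lk lam j \<le> lk \<nu> j" if j: "j \<in> {1..n}" for j
  proof -
    have "{i \<in> {1..j}. lk lam j - 1 < lk lam i} = {1..j}"
    proof -
      have "lk lam j \<le> lk lam i" if "i \<in> {1..j}" for i using lam j that by (simp add: dominant_def)
      then have "lk lam j - 1 < lk lam i" if "i \<in> {1..j}" for i using that by fastforce
      then show ?thesis by blast
    qed
    then have "j \<le> card {i \<in> {1..j}. lk lam j - 1 < lk \<nu> i}"
      using belowD[OF b, of "Suc j" "lk lam j - 1"] j N1[of "lk lam j - 1"]
        Nr[of j \<nu> "lk lam j - 1"] Nr[of j lam "lk lam j - 1"] by simp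
    then have "{i \<in> {1..j}. lk lam j - 1 < lk \<nu> i} = {1..j}" by (intro card_seteq) auto
    then have "j \<in> {i \<in> {1..j}. lk lam j - 1 < lk \<nu> i}" using j by simp
    then show ?thesis by simp
  qed
  have "(\<Sum>j\<in>{1..n}. lk \<nu> j) = (\<Sum>j\<in>{1..n}. lk lam (w j))"
  proof (rule sum.cong[OF refl])
    fix j
    show "lk \<nu> j = lk lam (w j)"
      unfolding eq[symmetric] lookup_permexp[OF permutes_bij[OF w]] permutes_inverses(2)[OF w] ..
  qed
  also have "\<dots> = (\<Sum>j\<in>{1..n}. lk lam j)" by (rule sum.reindex_bij_betw[OF permutes_imp_bij[OF w]])
  finally have s: "(\<Sum>j\<in>{1..n}. lk lam j) = (\<Sum>j\<in>{1..n}. lk \<nu> j)" by simp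
  have "lk lam j = lk \<nu> j" if "j \<in> {1..n}" for j
    using sum_mono_inv[OF s ge that] by simp
  then show ?thesis using \<nu> lam by (intro Zn_eqI[of \<nu> n lam]) (auto simp: dominant_def)
qed

subsection \<open>Divisibility by differences of variables\<close>

text \<open>The specialization x_k := x_l. It is not injective, so unlike \<open>act\<close> it is
  applied to Laurent polynomials only.\<close>

definition spec :: "nat \<Rightarrow> nat \<Rightarrow> ratfun \<Rightarrow> ratfun" where
  "spec k l = feval scal (xvar(k := xvar l))"

context
  fixes k l :: nat assumes kl: "k \<noteq> l"
begin

interpretation sp: evaluation scal "xvar(k := xvar l)"
  by (rule evaluation_scal) simp

lemma has_value_spec: "f \<in> Lau \<Longrightarrow> sp.has_value f (spec k l f)"
proof -
  assume "f \<in> Lau"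
  then obtain p where p: "f = to_fract p" by (auto simp: Lau_def)
  show ?thesis unfolding p spec_def sp.feval_eq[OF sp.has_value_to_fract] by (rule sp.has_value_to_fract)
qed

lemma spec_eqI: "sp.has_value f c \<Longrightarrow> spec k l f = c"
  unfolding spec_def by (rule sp.feval_eq)

lemma spec_mult: "f \<in> Lau \<Longrightarrow> g \<in> Lau \<Longrightarrow> spec k l (f * g) = spec k l f * spec k l g"
  by (rule spec_eqI[OF sp.has_value_mult[OF has_value_spec has_value_spec]])

lemma spec_uminus: "f \<in> Lau \<Longrightarrow> spec k l (- f) = - spec k l f"
  by (rule spec_eqI[OF sp.has_value_uminus[OF has_value_spec]])

lemma spec_to_fract: "spec k l (to_fract p) = (\<Sum>\<nu>\<in>keys p. scal (lk p \<nu>) * mon (xvar(k := xvar l)) \<nu>)"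
  unfolding spec_eqI[OF sp.has_value_to_fract] by (rule sp.leval_mon)

lemma spec_xmon: "spec k l (xmon \<nu>) = mon (xvar(k := xvar l)) \<nu>"
  unfolding xmon_def spec_eqI[OF sp.has_value_to_fract] sp.leval_single by simp

lemma mon_spec_add: "mon (xvar(k := xvar l)) (\<mu> + \<nu>) = mon (xvar(k := xvar l)) \<mu> * mon (xvar(k := xvar l)) \<nu>"
  by (rule mon_add) simp

lemma Lau_powi: "xvar i powi m \<in> Lau"
  unfolding xmon_single[symmetric] by (rule Lau_xmon)

lemma powi_difference: "\<exists>g\<in>Lau. xvar k powi m - xvar l powi m = (xvar k - xvar l) * g"
proof -
  have nat: "\<exists>g\<in>Lau. xvar k ^ m - xvar l ^ m = (xvar k - xvar l) * g" for m
  proof -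
    have "xvar i ^ m \<in> Lau" for i m using Lau_powi[of i "int m"] by simp
    then have "(\<Sum>i<m. xvar l ^ (m - Suc i) * xvar k ^ i) \<in> Lau" by (intro Lau_sum Lau_mult)
    then show ?thesis using power_diff_sumr2[of "xvar k" m "xvar l"] by blast
  qed
  show ?thesis
  proof (cases "0 \<le> m")
    case True
    then show ?thesis using nat[of "nat m"] by (simp add: power_int_def)
  next
    case False
    obtain g where g: "g \<in> Lau" "xvar k ^ nat (- m) - xvar l ^ nat (- m) = (xvar k - xvar l) * g"
      using nat by blast
    have i: "xvar i powi m = inverse (xvar i ^ nat (- m))" for i
      using False by (simp add: power_int_def power_inverse)
    have "xvar k powi m - xvar l powi m
        = - (xvar k powi m * (xvar k ^ nat (- m) - xvar l ^ nat (- m)) * xvar l powi m)"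
      unfolding i by (rule inverse_diff_inverse) simp_all
    also have "\<dots> = (xvar k - xvar l) * (scal (- 1) * (xvar k powi m * g * xvar l powi m))"
      unfolding g(2) by (simp add: scal_uminus mult_ac)
    finally show ?thesis using g(1) by (blast intro: Lau_mult Lau_powi Lau_scal)
  qed
qed

text \<open>The factor theorem, proved on monomials after splitting off the power of x_k.\<close>

lemma difference_dvd: "f \<in> Lau \<Longrightarrow> \<exists>g\<in>Lau. f - spec k l f = (xvar k - xvar l) * g"
proof -
  assume "f \<in> Lau"
  then obtain p where p: "f = to_fract p" by (auto simp: Lau_def)
  have "\<forall>\<nu>. \<exists>g. g \<in> Lau \<and> xmon \<nu> - mon (xvar(k := xvar l)) \<nu> = (xvar k - xvar l) * g"
  proof
    fix \<nu> :: "nat \<Rightarrow>\<^sub>0 int"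
    let ?\<kappa> = "\<nu> - single k (lk \<nu> k)"
    have "mon (xvar(k := xvar l)) ?\<kappa> = mon xvar ?\<kappa>"
      unfolding mon_def by (rule prod.cong) (auto simp: in_keys_iff lookup_minus)
    then have "mon (xvar(k := xvar l)) (?\<kappa> + single k (lk \<nu> k)) = xmon ?\<kappa> * xvar l powi lk \<nu> k"
      unfolding mon_spec_add xmon_eq_mon by simp
    moreover have "xmon (?\<kappa> + single k (lk \<nu> k)) = xmon ?\<kappa> * xvar k powi lk \<nu> k"
      unfolding xmon_add xmon_single ..
    ultimately have e: "xmon \<nu> - mon (xvar(k := xvar l)) \<nu> = xmon ?\<kappa> * (xvar k powi lk \<nu> k - xvar l powi lk \<nu> k)"
      by (simp add: right_diff_distrib)
    obtain g where g: "g \<in> Lau" "xvar k powi lk \<nu> k - xvar l powi lk \<nu> k = (xvar k - xvar l) * g"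
      using powi_difference by blast
    have "xmon \<nu> - mon (xvar(k := xvar l)) \<nu> = (xvar k - xvar l) * (xmon ?\<kappa> * g)"
      unfolding e g(2) by (rule mult.left_commute)
    moreover have "xmon ?\<kappa> * g \<in> Lau" by (rule Lau_mult[OF Lau_xmon g(1)])
    ultimately show "\<exists>g. g \<in> Lau \<and> xmon \<nu> - mon (xvar(k := xvar l)) \<nu> = (xvar k - xvar l) * g" by blast
  qed
  then have "\<exists>g. \<forall>\<nu>. g \<nu> \<in> Lau \<and> xmon \<nu> - mon (xvar(k := xvar l)) \<nu> = (xvar k - xvar l) * g \<nu>"
    by (rule choice)
  then obtain g where g: "\<And>\<nu>. g \<nu> \<in> Lau" "\<And>\<nu>. xmon \<nu> - mon (xvar(k := xvar l)) \<nu> = (xvar k - xvar l) * g \<nu>"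
    by blast
  have "f - spec k l f = (\<Sum>\<nu>\<in>keys p. scal (lk p \<nu>) * (xmon \<nu> - mon (xvar(k := xvar l)) \<nu>))"
    unfolding p spec_to_fract unfolding to_fract_expand[of p] sum_subtractf[symmetric] right_diff_distrib ..
  also have "\<dots> = (xvar k - xvar l) * (\<Sum>\<nu>\<in>keys p. scal (lk p \<nu>) * g \<nu>)"
    unfolding g(2) sum_distrib_left by (rule sum.cong[OF refl]) (rule mult.left_commute)
  finally show ?thesis using g(1) by (blast intro: Lau_sum Lau_mult Lau_scal)
qed

lemma spec_act: "f \<in> Lau \<Longrightarrow> spec k l (act (Transposition.transpose k l) f) = spec k l f"
proof -
  assume f: "f \<in> Lau"
  let ?s = "Transposition.transpose k l"
  have mono: "mon (xvar(k := xvar l)) (permexp ?s \<nu>) = mon (xvar(k := xvar l)) \<nu>" for \<nu>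
  proof -
    define a b \<kappa> where "a = lk \<nu> k" "b = lk \<nu> l" "\<kappa> = \<nu> - single k a - single l b"
    have 1: "\<nu> = \<kappa> + single k a + single l b" by (simp add: a_b_\<kappa>_def)
    have 2: "permexp ?s \<nu> = \<kappa> + single k b + single l a"
      using kl by (intro poly_mapping_eqI)
        (auto simp: a_b_\<kappa>_def lookup_permexp lookup_add lookup_minus lookup_single when_def transpose_def)
    show ?thesis unfolding 2 unfolding 1 mon_spec_add mon_single by (simp add: mult_ac)
  qed
  obtain p where p: "f = to_fract p" using f by (auto simp: Lau_def)
  have "sp.has_value (\<Sum>\<nu>\<in>keys p. scal (lk p \<nu>) * xmon (permexp ?s \<nu>)) (\<Sum>\<nu>\<in>keys p. scal (lk p \<nu>) * spec k l (xmon (permexp ?s \<nu>)))"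
    by (intro sp.has_value_sum sp.has_value_mult sp.has_value_scal has_value_spec Lau_xmon)
  moreover have "act ?s f = (\<Sum>\<nu>\<in>keys p. scal (lk p \<nu>) * xmon (permexp ?s \<nu>))"
    unfolding p to_fract_expand field_endo_sum[OF endo_S] S_mult S_scal act_xmon[OF bij_transpose] ..
  ultimately have "spec k l (act ?s f) = (\<Sum>\<nu>\<in>keys p. scal (lk p \<nu>) * spec k l (xmon (permexp ?s \<nu>)))"
    using spec_eqI by simp
  then show ?thesis unfolding p spec_to_fract spec_xmon mono .
qed

lemma spec_prod_differences_nonzero:
  assumes "k < l" "finite Q" "\<And>i j. (i, j) \<in> Q \<Longrightarrow> i < j" "(k, l) \<notin> Q"
  shows "spec k l (\<Prod>(i, j)\<in>Q. xvar i - xvar j) \<noteq> 0"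
proof -
  have "sp.has_value (case p of (i, j) \<Rightarrow> xvar i - xvar j) (case p of (i, j) \<Rightarrow> (xvar(k := xvar l)) i - (xvar(k := xvar l)) j)" for p
    by (cases p) (simp only: prod.case, intro sp.has_value_diff sp.has_value_xvar)
  then have "spec k l (\<Prod>(i, j)\<in>Q. xvar i - xvar j) = (\<Prod>(i, j)\<in>Q. (xvar(k := xvar l)) i - (xvar(k := xvar l)) j)"
    by (intro spec_eqI sp.has_value_prod)
  moreover have "(case p of (i, j) \<Rightarrow> (xvar(k := xvar l)) i - (xvar(k := xvar l)) j) \<noteq> 0" if "p \<in> Q" for p
  proof -
    obtain i j where p: "p = (i, j)" by (cases p)
    then have "i < j" "(i, j) \<noteq> (k, l)" using assms that by auto
    then have "(if i = k then l else i) \<noteq> (if j = k then l else j)" using assms(1) by auto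
    then show ?thesis unfolding p by (auto split: if_splits)
  qed
  ultimately show ?thesis using assms(2) by simp
qed

end

lemma Lau_prod_differences: "(\<Prod>(i, j)\<in>Q. xvar i - xvar j) \<in> Lau"
  by (rule Lau_prod) (auto intro: Lau_diff Lau_xvar)

text \<open>One difference is split off at a time: the product of the others does not vanish at x_k
  = x_l, so the cofactor does.\<close>

lemma prod_differences_dvd:
  assumes "finite Q" "\<And>k l. (k, l) \<in> Q \<Longrightarrow> k < l" "f \<in> Lau" "\<And>k l. (k, l) \<in> Q \<Longrightarrow> spec k l f = 0"
  shows "\<exists>g\<in>Lau. f = g * (\<Prod>(k, l)\<in>Q. xvar k - xvar l)"
  using assms
proof (induction Q rule: finite_induct)
  case (insert q Q)
  obtain k l where q: "q = (k, l)" by (cases q)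
  have kl: "k < l" using insert.prems(1) q by simp
  then have ne: "k \<noteq> l" by simp
  obtain g where g: "g \<in> Lau" "f = g * (\<Prod>(k, l)\<in>Q. xvar k - xvar l)"
    using insert.IH insert.prems by blast
  have "spec k l g * spec k l (\<Prod>(k, l)\<in>Q. xvar k - xvar l) = 0"
    using insert.prems(3)[of k l] q unfolding g(2) spec_mult[OF ne g(1) Lau_prod_differences] by simp
  moreover have "spec k l (\<Prod>(k, l)\<in>Q. xvar k - xvar l) \<noteq> 0"
    by (rule spec_prod_differences_nonzero[OF ne kl insert.hyps(1)]) (use insert q in auto)
  ultimately have "spec k l g = 0" by simp
  then obtain h where h: "h \<in> Lau" "g = (xvar k - xvar l) * h"
    using difference_dvd[OF ne g(1)] by auto
  have "f = h * (\<Prod>(k, l)\<in>insert q Q. xvar k - xvar l)"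
    unfolding g(2) h(2) q prod.insert[OF insert.hyps(1) insert.hyps(2)[unfolded q]] prod.case by (simp only: mult_ac)
  then show ?case using h(1) by blast
qed auto

subsection \<open>Leading terms\<close>

text \<open>\<open>leading s \<kappa> c f\<close>: all exponents of the Laurent polynomial \<open>f\<close> are lexicographically at most
  \<open>\<kappa>\<close> (at least \<open>\<kappa>\<close>, if \<open>s\<close> is false) and \<open>f\<close> has coefficient \<open>c\<close>, possibly zero, at \<open>\<kappa>\<close>.\<close>

definition le_dir :: "bool \<Rightarrow> (nat \<Rightarrow>\<^sub>0 int) \<Rightarrow> (nat \<Rightarrow>\<^sub>0 int) \<Rightarrow> bool" where
  "le_dir s \<mu> \<nu> \<longleftrightarrow> (if s then \<mu> \<le> \<nu> else \<nu> \<le> \<mu>)"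

definition leading :: "bool \<Rightarrow> (nat \<Rightarrow>\<^sub>0 int) \<Rightarrow> K \<Rightarrow> ratfun \<Rightarrow> bool" where
  "leading s \<kappa> c f \<longleftrightarrow> (\<exists>p. f = to_fract p \<and> lk p \<kappa> = c \<and> (\<forall>\<nu>\<in>keys p. le_dir s \<nu> \<kappa>))"

lemma le_dir_add: "le_dir s \<mu> \<kappa> \<Longrightarrow> le_dir s \<nu> \<kappa>' \<Longrightarrow> le_dir s (\<mu> + \<nu>) (\<kappa> + \<kappa>')"
  by (simp add: le_dir_def add_mono split: if_splits)

lemma le_dir_add_eq: "le_dir s \<mu> \<kappa> \<Longrightarrow> le_dir s \<nu> \<kappa>' \<Longrightarrow> \<mu> + \<nu> = \<kappa> + \<kappa>' \<Longrightarrow> \<mu> = \<kappa> \<and> \<nu> = \<kappa>'"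
proof -
  have *: "\<mu> = \<kappa> \<and> \<nu> = \<kappa>'" if "\<mu> \<le> \<kappa>" "\<nu> \<le> \<kappa>'" "\<mu> + \<nu> = \<kappa> + \<kappa>'" for \<mu> \<nu> \<kappa> \<kappa>' :: "nat \<Rightarrow>\<^sub>0 int"
  proof -
    have "\<not> \<mu> < \<kappa>"
    proof
      assume "\<mu> < \<kappa>"
      from add_less_le_mono[OF this that(2)] that(3) show False by simp
    qed
    then have "\<mu> = \<kappa>" by (intro antisym[OF that(1)] leI)
    then show ?thesis using that(3) by simp
  qed
  show "le_dir s \<mu> \<kappa> \<Longrightarrow> le_dir s \<nu> \<kappa>' \<Longrightarrow> \<mu> + \<nu> = \<kappa> + \<kappa>' \<Longrightarrow> \<mu> = \<kappa> \<and> \<nu> = \<kappa>'"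
    using *[of \<mu> \<kappa> \<nu> \<kappa>'] *[of \<kappa> \<mu> \<kappa>' \<nu>] by (auto simp: le_dir_def split: if_splits)
qed

lemma leading_mult:
  assumes "leading s \<kappa> c f" "leading s \<kappa>' d g"
  shows "leading s (\<kappa> + \<kappa>') (c * d) (f * g)"
proof -
  obtain p where p: "f = to_fract p" "lk p \<kappa> = c" "\<And>\<nu>. \<nu> \<in> keys p \<Longrightarrow> le_dir s \<nu> \<kappa>"
    using assms(1) by (auto simp: leading_def)
  obtain q where q: "g = to_fract q" "lk q \<kappa>' = d" "\<And>\<nu>. \<nu> \<in> keys q \<Longrightarrow> le_dir s \<nu> \<kappa>'"
    using assms(2) by (auto simp: leading_def)
  have "p * q = (\<Sum>\<mu>\<in>keys p. single \<mu> (lk p \<mu>)) * (\<Sum>\<nu>\<in>keys q. single \<nu> (lk q \<nu>))"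
    by (simp only: sum_single_lookup)
  also have "\<dots> = (\<Sum>\<mu>\<in>keys p. \<Sum>\<nu>\<in>keys q. single (\<mu> + \<nu>) (lk p \<mu> * lk q \<nu>))"
    by (simp add: sum_product mult_single)
  finally have "lk (p * q) (\<kappa> + \<kappa>') = (\<Sum>\<mu>\<in>keys p. \<Sum>\<nu>\<in>keys q. if \<mu> + \<nu> = \<kappa> + \<kappa>' then lk p \<mu> * lk q \<nu> else 0)"
    by (simp add: lookup_sum lookup_single when_def)
  also have "\<dots> = (\<Sum>\<mu>\<in>keys p. \<Sum>\<nu>\<in>keys q. if \<mu> = \<kappa> then if \<nu> = \<kappa>' then c * d else 0 else 0)"
  proof (rule sum.cong[OF refl], rule sum.cong[OF refl])
    fix \<mu> \<nu> assume "\<mu> \<in> keys p" "\<nu> \<in> keys q"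
    then show "(if \<mu> + \<nu> = \<kappa> + \<kappa>' then lk p \<mu> * lk q \<nu> else 0) = (if \<mu> = \<kappa> then if \<nu> = \<kappa>' then c * d else 0 else 0)"
      using le_dir_add_eq[OF p(3) q(3), of \<mu> \<nu>] p(2) q(2) by auto
  qed
  also have "\<dots> = (\<Sum>\<mu>\<in>keys p. if \<mu> = \<kappa> then (\<Sum>\<nu>\<in>keys q. if \<nu> = \<kappa>' then c * d else 0) else 0)"
    by (rule sum.cong) auto
  also have "\<dots> = c * d" using p(2) q(2) by (auto simp: in_keys_iff)
  finally have 1: "lk (p * q) (\<kappa> + \<kappa>') = c * d" .
  have 2: "le_dir s \<nu> (\<kappa> + \<kappa>')" if "\<nu> \<in> keys (p * q)" for \<nu>
    using subsetD[OF keys_mult that] p(3) q(3) le_dir_add by blast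
  show ?thesis unfolding leading_def
    by (intro exI[of _ "p * q"] conjI ballI) (simp_all only: p(1) q(1) to_fract_mult 1 2)
qed

lemma leading_scal: "leading s 0 c (scal c)"
  unfolding leading_def scal_def by (intro exI[of _ "single 0 c"]) (auto simp: le_dir_def)

lemma leading_1: "leading s 0 1 1"
  using leading_scal[of s 1] by simp

lemma leading_prod: "(\<And>a. a \<in> A \<Longrightarrow> leading s (k a) (c a) (f a)) \<Longrightarrow> leading s (\<Sum>a\<in>A. k a) (\<Prod>a\<in>A. c a) (\<Prod>a\<in>A. f a)"
  by (induction A rule: infinite_finite_induct) (auto simp: leading_1 intro: leading_mult)

lemma leading_0: "leading s \<kappa> 0 0"
  unfolding leading_def by (intro exI[of _ 0]) simp

lemma leading_add:
  assumes "leading s \<kappa> c f" "leading s \<kappa> d g" shows "leading s \<kappa> (c + d) (f + g)"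
proof -
  obtain p where p: "f = to_fract p" "lk p \<kappa> = c" "\<And>\<nu>. \<nu> \<in> keys p \<Longrightarrow> le_dir s \<nu> \<kappa>"
    using assms(1) by (auto simp: leading_def)
  obtain q where q: "g = to_fract q" "lk q \<kappa> = d" "\<And>\<nu>. \<nu> \<in> keys q \<Longrightarrow> le_dir s \<nu> \<kappa>"
    using assms(2) by (auto simp: leading_def)
  have "\<forall>\<nu>\<in>keys (p + q). le_dir s \<nu> \<kappa>"
    using Poly_Mapping.keys_add[of p q] p(3) q(3) by blast
  moreover have "f + g = to_fract (p + q)" "lk (p + q) \<kappa> = c + d" by (simp_all add: p q lookup_add)
  ultimately show ?thesis unfolding leading_def by blast
qed

lemma leading_sum: "(\<And>a. a \<in> A \<Longrightarrow> leading s \<kappa> (c a) (f a)) \<Longrightarrow> leading s \<kappa> (\<Sum>a\<in>A. c a) (\<Sum>a\<in>A. f a)"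
  by (induction A rule: infinite_finite_induct) (auto simp: leading_0 intro: leading_add)

text \<open>The extreme exponent m of f has nonzero coefficient, and so has its product with the
  leading term of g; hence m + \<open>\<rho>\<close> occurs in f g, which bounds m by
  \<open>\<kappa>\<close>.\<close>

lemma leading_quotient:
  assumes f: "f \<in> Lau" and g: "leading s \<rho> d g" "d \<noteq> 0" and fg: "leading s (\<kappa> + \<rho>) c (f * g)"
  shows "leading s \<kappa> (c / d) f"
proof -
  obtain p where p: "f = to_fract p" using f by (auto simp: Lau_def)
  have uniq: "lk r \<nu> = e \<and> (\<forall>\<mu>\<in>keys r. le_dir s \<mu> \<nu>)" if "leading s \<nu> e (to_fract r)" for r \<nu> e
    using that by (auto simp: leading_def)
  have bound: "le_dir s \<nu> \<kappa>" if \<nu>: "\<nu> \<in> keys p" for \<nu>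
  proof -
    define m where "m = (if s then Max (keys p) else Min (keys p))"
    have "keys p \<noteq> {}" using \<nu> by blast
    then have m: "m \<in> keys p" using Max_in[OF finite_keys] Min_in[OF finite_keys] by (auto simp: m_def)
    have "\<forall>\<nu>\<in>keys p. le_dir s \<nu> m" by (simp add: m_def le_dir_def)
    then have "leading s m (lk p m) f" unfolding leading_def p by blast
    then have t: "leading s (m + \<rho>) (lk p m * d) (f * g)" using g(1) by (rule leading_mult)
    obtain q where q: "f * g = to_fract q" using fg by (auto simp: leading_def)
    have "lk q (m + \<rho>) \<noteq> 0" using uniq[OF t[unfolded q]] m g(2) by (simp add: in_keys_iff)
    then have "le_dir s (m + \<rho>) (\<kappa> + \<rho>)" using uniq[OF fg[unfolded q]] by (simp add: in_keys_iff)
    then have "le_dir s m \<kappa>" by (simp add: le_dir_def split: if_splits)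
    moreover have "le_dir s \<nu> m" using \<nu> by (simp add: m_def le_dir_def)
    ultimately show ?thesis by (auto simp: le_dir_def split: if_splits)
  qed
  then have "leading s \<kappa> (lk p \<kappa>) f" unfolding leading_def p by blast
  then have t: "leading s (\<kappa> + \<rho>) (lk p \<kappa> * d) (f * g)" using g(1) by (rule leading_mult)
  obtain q where q: "f * g = to_fract q" using fg by (auto simp: leading_def)
  have "lk p \<kappa> * d = c" using uniq[OF t[unfolded q]] uniq[OF fg[unfolded q]] by simp
  then have "lk p \<kappa> = c / d" using g(2) by (simp add: eq_divide_eq)
  then show ?thesis using \<open>leading s \<kappa> (lk p \<kappa>) f\<close> by simp
qed

text \<open>A smaller index means a lexicographically larger variable, hence \<open>min\<close> for
  the top and \<open>max\<close> for the bottom exponent of x_i - t x_j.\<close>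

definition ek :: "bool \<Rightarrow> nat \<times> nat \<Rightarrow> (nat \<Rightarrow>\<^sub>0 int)" where
  "ek s = (\<lambda>(i, j). single (if s then min i j else max i j) 1)"

lemma single_less: "i < j \<Longrightarrow> single j (1::int) < single i 1"
proof -
  assume ij: "i < j"
  have l: "lk (single a (1::int)) b = (if a = b then 1 else 0)" for a b :: nat
    by (simp add: lookup_single when_def)
  show ?thesis
    unfolding less_poly_mapping.rep_eq less_fun_def l
    by (rule exI[of _ i]) (use ij in auto)
qed

lemma leading_difference:
  assumes "i \<noteq> j"
  shows "leading s (ek s (i, j)) (if (i < j) = s then 1 else - t) (xvar i - scal t * xvar j)"
proof -
  let ?p = "single (single i 1) 1 - single (single j 1) t :: laurent"
  have ne: "single i (1::int) \<noteq> single j 1" using assms by (simp add: single_eq_single_iff)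
  have "xvar i - scal t * xvar j = to_fract ?p" by (simp add: to_fract_single xvar_xmon)
  moreover have "lk ?p (ek s (i, j)) = (if (i < j) = s then 1 else - t)"
  proof -
    have "ek s (i, j) = (if (i < j) = s then single i 1 else single j 1)"
      using assms by (cases s; cases "i < j") (simp_all add: ek_def min_def max_def)
    then show ?thesis using ne by (simp add: lookup_minus lookup_single)
  qed
  moreover have "\<forall>\<nu>\<in>keys ?p. le_dir s \<nu> (ek s (i, j))"
  proof
    fix \<nu> assume "\<nu> \<in> keys ?p"
    then have "\<nu> = single i 1 \<or> \<nu> = single j 1"
      by (auto simp: in_keys_iff lookup_minus lookup_single when_def split: if_splits)
    then show "le_dir s \<nu> (ek s (i, j))"
      using less_imp_le[OF single_less, of i j] less_imp_le[OF single_less, of j i] assms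
      unfolding le_dir_def ek_def prod.case min_def max_def by (cases s; cases "i < j") (elim disjE; simp)+
  qed
  ultimately show ?thesis unfolding leading_def by blast
qed

subsection \<open>Symmetrization over the stabilizer of a dominant exponent\<close>

definition Stab :: "nat \<Rightarrow> (nat \<Rightarrow>\<^sub>0 int) \<Rightarrow> (nat \<Rightarrow> nat) set" where
  "Stab n lam = {w. w permutes {1..n} \<and> (\<forall>i\<in>{1..n}. lk lam (w i) = lk lam i)}"

definition Jp :: "nat \<Rightarrow> (nat \<Rightarrow>\<^sub>0 int) \<Rightarrow> (nat \<times> nat) set" where
  "Jp n lam = {(i, j) \<in> pairs n. lk lam i = lk lam j}"

text \<open>The Hall-Littlewood symmetrizer of the stabilizer. At exponent 0 the group is all of S_n
  and the sum is the numerator of P (\<open>P_sum_eq\<close>); with f = 1 it is the Poincare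
  polynomial.\<close>

definition Sy :: "nat \<Rightarrow> (nat \<Rightarrow>\<^sub>0 int) \<Rightarrow> ratfun \<Rightarrow> ratfun" where
  "Sy n lam f = (\<Sum>w\<in>Stab n lam. act w (f * (\<Prod>(i, j)\<in>Jp n lam. (xvar i - tt * xvar j) / (xvar i - xvar j))))"

text \<open>The factor at a root of height d in Macdonald's product formula for Poincare
  polynomials.\<close>

definition Rd :: "nat \<Rightarrow> K" where
  "Rd d = (1 - tK ^ (d + 1)) / (1 - tK ^ d)"

lemma Rd_nonzero: "d \<noteq> 0 \<Longrightarrow> Rd d \<noteq> 0"
  using tK_power_ne_1[of d] tK_power_ne_1[of "d + 1"] unfolding Rd_def by auto

definition ordp :: "(nat \<Rightarrow> nat) \<Rightarrow> nat \<times> nat \<Rightarrow> nat \<times> nat" where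
  "ordp w = (\<lambda>(i, j). if w i < w j then (w i, w j) else (w j, w i))"

text \<open>The sign of w read off from the inversions within J; \<open>act_Delta\<close> ties it to
  the action.\<close>

definition sgK :: "(nat \<times> nat) set \<Rightarrow> (nat \<Rightarrow> nat) \<Rightarrow> K" where
  "sgK J w = (\<Prod>(i, j)\<in>J. if w i < w j then 1 else - 1)"

lemma sgK_square: "sgK J w * sgK J w = 1"
  unfolding sgK_def prod.distrib[symmetric] by (rule prod.neutral) auto

lemma sgK_cases: "sgK J w = 1 \<or> sgK J w = - 1"
  using sgK_square[of J w] by (simp add: square_eq_1_iff)

lemma finite_pairs: "finite (pairs n)"
proof -
  have "pairs n \<subseteq> Pn n" by (auto simp: pairs_def)
  then show ?thesis by (rule finite_subset) simp
qed

lemma finite_Jp: "finite (Jp n lam)"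
  by (rule finite_subset[OF _ finite_pairs[of n]]) (auto simp: Jp_def)

lemma finite_Stab: "finite (Stab n lam)"
  by (rule finite_subset[OF _ finite_permutations[of "{1..n}"]]) (auto simp: Stab_def)

lemma Jp_less: "(i, j) \<in> Jp n lam \<Longrightarrow> i < j"
  by (simp add: Jp_def pairs_def)

text \<open>Characteristic other than 2, seen in the constant coefficient; this lets antisymmetry
  imply vanishing.\<close>

lemma two_ratfun_nonzero: "(1 + 1 :: ratfun) \<noteq> 0"
proof -
  have "coeff (coeff (1 + 1 :: complex poly poly) 0) 0 = 2" by (simp add: one_pCons del: one_add_one)
  then have "(1 + 1 :: complex poly poly) \<noteq> 0" by (metis coeff_0 zero_neq_numeral)
  then have "to_fract (1 + 1 :: complex poly poly) \<noteq> 0" by (simp only: to_fract_eq_0_iff not_False_eq_True)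
  then have "scal (1 + 1) \<noteq> 0" unfolding to_fract_add to_fract_1 scal_eq_0_iff .
  then show ?thesis unfolding scal_add scal_1 .
qed

lemma eq_uminus_imp_0: "x = - x \<Longrightarrow> x = (0 :: ratfun)"
proof -
  assume "x = - x"
  then have "(1 + 1) * x = 0" by (metis distrib_right eq_neg_iff_add_eq_0 mult_1)
  then show ?thesis using two_ratfun_nonzero by (simp only: mult_eq_0_iff) blast
qed

context
  fixes n :: nat and lam :: "nat \<Rightarrow>\<^sub>0 int"
begin

lemma Stab_permutes: "w \<in> Stab n lam \<Longrightarrow> w permutes {1..n}"
  by (simp add: Stab_def)

lemma Stab_bij: "w \<in> Stab n lam \<Longrightarrow> bij w"
  by (rule permutes_bij[OF Stab_permutes])

lemma Stab_comp: "v \<in> Stab n lam \<Longrightarrow> w \<in> Stab n lam \<Longrightarrow> v \<circ> w \<in> Stab n lam"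
  using permutes_in_image[of w "{1..n}"] by (auto simp: Stab_def permutes_compose)

lemma Stab_inv: "w \<in> Stab n lam \<Longrightarrow> inv w \<in> Stab n lam"
proof -
  assume w: "w \<in> Stab n lam"
  have wp: "w permutes {1..n}" by (rule Stab_permutes[OF w])
  have "lk lam (inv w i) = lk lam i" if "i \<in> {1..n}" for i
  proof -
    have "inv w i \<in> {1..n}" using that permutes_in_image[OF permutes_inv[OF wp]] by blast
    then have "lk lam (w (inv w i)) = lk lam (inv w i)" using w by (simp add: Stab_def)
    then show ?thesis by (simp add: permutes_inverses(1)[OF wp])
  qed
  then show ?thesis using permutes_inv[OF wp] by (simp add: Stab_def)
qed

lemma Stab_transpose:
  assumes "(k, l) \<in> Jp n lam" shows "Transposition.transpose k l \<in> Stab n lam"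
proof -
  have "k \<in> {1..n}" "l \<in> {1..n}" "lk lam k = lk lam l" using assms by (auto simp: Jp_def pairs_def)
  then show ?thesis by (auto simp: Stab_def permutes_swap_id transpose_def)
qed

lemma ordp_bij: assumes w: "w \<in> Stab n lam" shows "bij_betw (ordp w) (Jp n lam) (Jp n lam)"
proof -
  have wp: "w permutes {1..n}" by (rule Stab_permutes[OF w])
  have i: "w a = w b \<longleftrightarrow> a = b" for a b using permutes_inj[OF wp] by (simp add: inj_eq)
  have "inj_on (ordp w) (Jp n lam)"
  proof (rule inj_onI, clarify)
    fix a b c d assume "(a, b) \<in> Jp n lam" "(c, d) \<in> Jp n lam" and eq: "ordp w (a, b) = ordp w (c, d)"
    then have "a < b" "c < d" by (auto dest: Jp_less)
    then show "a = c \<and> b = d" using eq by (auto simp: ordp_def i split: if_splits)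
  qed
  moreover have "ordp w p \<in> Jp n lam" if p: "p \<in> Jp n lam" for p
  proof -
    obtain a b where ab: "p = (a, b)" by (cases p)
    then have h: "a \<in> {1..n}" "b \<in> {1..n}" "a \<noteq> b" "lk lam a = lk lam b" using p by (auto simp: Jp_def pairs_def)
    moreover have "w a \<in> {1..n}" "w b \<in> {1..n}" using h permutes_in_image[OF wp] by blast+
    moreover have "w a \<noteq> w b" using h i by simp
    moreover have "lk lam (w a) = lk lam a" "lk lam (w b) = lk lam b" using h w by (simp_all add: Stab_def)
    ultimately show ?thesis unfolding ab by (auto simp: ordp_def Jp_def pairs_def)
  qed
  ultimately show ?thesis using finite_Jp endo_inj_surj[OF finite_Jp] by (auto simp: bij_betw_def image_subset_iff)
qed

abbreviation (input) "\<Delta> \<equiv> (\<Prod>(i, j)\<in>Jp n lam. xvar i - xvar j)"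
abbreviation (input) "\<M> \<equiv> (\<Prod>(i, j)\<in>Jp n lam. xvar i - tt * xvar j)"

lemma Delta_nonzero: "\<Delta> \<noteq> 0"
  using finite_Jp by (auto dest: Jp_less)

lemma act_Delta: assumes w: "w \<in> Stab n lam" shows "act w \<Delta> = scal (sgK (Jp n lam) w) * \<Delta>"
proof -
  have F: "field_endo (act w)" by (rule field_endo_act[OF Stab_bij[OF w]])
  have "act w (case p of (i, j) \<Rightarrow> xvar i - xvar j) =
      scal (case p of (i, j) \<Rightarrow> if w i < w j then 1 else - 1) * (case ordp w p of (i, j) \<Rightarrow> xvar i - xvar j)" for p
    by (cases p) (simp add: field_endo_diff[OF F] act_xvar[OF Stab_bij[OF w]] ordp_def scal_uminus)
  then have "act w \<Delta> = scal (sgK (Jp n lam) w) * (\<Prod>p\<in>Jp n lam. case ordp w p of (i, j) \<Rightarrow> xvar i - xvar j)"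
    unfolding field_endo_prod[OF F] sgK_def scal_prod prod.distrib[symmetric] by simp
  then show ?thesis unfolding prod.reindex_bij_betw[OF ordp_bij[OF w], of "\<lambda>(i, j). xvar i - xvar j"] .
qed

lemma act_M: assumes w: "w \<in> Stab n lam"
  shows "act w \<M> = (\<Prod>(i, j)\<in>Jp n lam. xvar (w i) - tt * xvar (w j))"
proof -
  have F: "field_endo (act w)" by (rule field_endo_act[OF Stab_bij[OF w]])
  show ?thesis
    unfolding field_endo_prod[OF F]
    by (rule prod.cong) (auto simp: field_endo_diff[OF F] field_endo_mult[OF F] act_scal[OF Stab_bij[OF w]] act_xvar[OF Stab_bij[OF w]])
qed

text \<open>Clearing denominators: \<open>\<Delta>\<close> changes by the sign of w, so the
  symmetrization becomes an alternating sum of Laurent polynomials.\<close>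

lemma Sy_Delta: "Sy n lam f * \<Delta> = (\<Sum>w\<in>Stab n lam. scal (sgK (Jp n lam) w) * act w (f * \<M>))"
proof -
  have q: "(\<Prod>(i, j)\<in>Jp n lam. (xvar i - tt * xvar j) / (xvar i - xvar j)) = \<M> / \<Delta>"
    by (simp add: case_prod_unfold prod_dividef)
  have "act w (f * (\<M> / \<Delta>)) * \<Delta> = scal (sgK (Jp n lam) w) * act w (f * \<M>)" if w: "w \<in> Stab n lam" for w
  proof -
    have F: "field_endo (act w)" by (rule field_endo_act[OF Stab_bij[OF w]])
    have s: "scal (sgK (Jp n lam) w) * scal (sgK (Jp n lam) w) = 1"
      by (simp only: scal_mult[symmetric] sgK_square scal_1)
    then have s0: "scal (sgK (Jp n lam) w) \<noteq> 0" by (metis mult_zero_left zero_neq_one)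
    have "act w (f * (\<M> / \<Delta>)) = act w (f * \<M>) / (scal (sgK (Jp n lam) w) * \<Delta>)"
      unfolding times_divide_eq_right field_endo_divide[OF F] act_Delta[OF w] ..
    then have "act w (f * (\<M> / \<Delta>)) * \<Delta> = act w (f * \<M>) / scal (sgK (Jp n lam) w)"
      using Delta_nonzero by simp
    also have "\<dots> = (scal (sgK (Jp n lam) w) * scal (sgK (Jp n lam) w)) * act w (f * \<M>) / scal (sgK (Jp n lam) w)"
      unfolding s by simp
    also have "\<dots> = scal (sgK (Jp n lam) w) * act w (f * \<M>)" using s0 by simp
    finally show ?thesis .
  qed
  then show ?thesis unfolding Sy_def q sum_distrib_right by (intro sum.cong refl)
qed

lemma act_Sy: assumes s: "s \<in> Stab n lam" shows "act s (Sy n lam f) = Sy n lam f"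
proof -
  have F: "field_endo (act s)" by (rule field_endo_act[OF Stab_bij[OF s]])
  let ?g = "f * (\<Prod>(i, j)\<in>Jp n lam. (xvar i - tt * xvar j) / (xvar i - xvar j))"
  have "act s (Sy n lam f) = (\<Sum>w\<in>Stab n lam. act (s \<circ> w) ?g)"
    unfolding Sy_def field_endo_sum[OF F]
    by (rule sum.cong[OF refl]) (rule act_act[OF Stab_bij[OF s] Stab_bij])
  also have "\<dots> = (\<Sum>w\<in>Stab n lam. act w ?g)"
  proof (rule sum.reindex_bij_betw)
    have "inv s \<circ> (s \<circ> w) = w" "s \<circ> (inv s \<circ> w) = w" for w
      using permutes_inverses[OF Stab_permutes[OF s]] by (simp_all add: fun_eq_iff)
    then show "bij_betw ((\<circ>) s) (Stab n lam) (Stab n lam)"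
      by (intro bij_betw_byWitness[where f' = "(\<circ>) (inv s)"]) (auto intro: Stab_comp[OF s] Stab_comp[OF Stab_inv[OF s]])
  qed
  finally show ?thesis unfolding Sy_def .
qed

lemma Lau_M: "\<M> \<in> Lau"
  by (rule Lau_prod) (auto intro: Lau_diff Lau_xvar Lau_mult Lau_scal)

lemma Lau_Sy_Delta: "f \<in> Lau \<Longrightarrow> Sy n lam f * \<Delta> \<in> Lau"
  unfolding Sy_Delta by (intro Lau_sum Lau_mult Lau_scal Lau_act Lau_M Stab_bij)

text \<open>A transposition changes the sign of \<open>\<Delta>\<close>: otherwise the cofactor of \<open>x\<^sub>k - x\<^sub>l\<close>
  in \<open>\<Delta>\<close> would change sign and hence vanish for \<open>x\<^sub>k = x\<^sub>l\<close>.\<close>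

lemma sgK_transpose: assumes kl: "(k, l) \<in> Jp n lam" shows "sgK (Jp n lam) (Transposition.transpose k l) = - 1"
proof (rule ccontr)
  let ?s = "Transposition.transpose k l" and ?D = "\<Prod>(i, j)\<in>Jp n lam - {(k, l)}. xvar i - xvar j"
  assume "sgK (Jp n lam) ?s \<noteq> - 1"
  then have "sgK (Jp n lam) ?s = 1" using sgK_cases by blast
  then have inv: "act ?s \<Delta> = \<Delta>" using act_Delta[OF Stab_transpose[OF kl]] by simp
  have less: "k < l" by (rule Jp_less[OF kl])
  then have ne: "k \<noteq> l" by simp
  have D: "\<Delta> = (xvar k - xvar l) * ?D"
    using prod.remove[OF finite_Jp kl, of "\<lambda>(i, j). xvar i - xvar j"] by simp
  have DL: "?D \<in> Lau" by (rule Lau_prod_differences)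
  have "(xvar l - xvar k) * act ?s ?D = (xvar k - xvar l) * ?D"
    using inv unfolding D S_mult S_diff S_xvar transpose_apply_first transpose_apply_second .
  then have "(xvar k - xvar l) * (- act ?s ?D) = (xvar k - xvar l) * ?D"
    by (simp add: left_diff_distrib)
  then have "- act ?s ?D = ?D"
    by (rule iffD1[OF mult_left_cancel, rotated]) (use ne in simp)
  then have "spec k l ?D = spec k l (- act ?s ?D)" by (rule arg_cong[OF sym])
  also have "\<dots> = - spec k l ?D"
    unfolding spec_uminus[OF ne Lau_act[OF bij_transpose DL]] spec_act[OF ne DL] ..
  finally have "spec k l ?D = 0" by (rule eq_uminus_imp_0)
  moreover have "spec k l ?D \<noteq> 0"
    by (rule spec_prod_differences_nonzero[OF ne less]) (auto simp: finite_Jp dest: Jp_less)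
  ultimately show False by simp
qed

text \<open>The product with \<open>\<Delta>\<close> is antisymmetric, so it vanishes at x_k = x_l
  for each pair and is divisible by the whole of \<open>\<Delta>\<close>.\<close>

lemma Lau_Sy: assumes f: "f \<in> Lau" shows "Sy n lam f \<in> Lau"
proof -
  have "\<exists>g\<in>Lau. Sy n lam f * \<Delta> = g * \<Delta>"
  proof (rule prod_differences_dvd[OF finite_Jp Jp_less Lau_Sy_Delta[OF f]])
    fix k l assume kl: "(k, l) \<in> Jp n lam"
    have ne: "k \<noteq> l" using Jp_less[OF kl] by simp
    let ?s = "Transposition.transpose k l"
    note s = Stab_transpose[OF kl]
    have "act ?s (Sy n lam f * \<Delta>) = - (Sy n lam f * \<Delta>)"
      unfolding S_mult act_Sy[OF s] act_Delta[OF s] sgK_transpose[OF kl] scal_uminus scal_1 by simp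
    then have "spec k l (Sy n lam f * \<Delta>) = spec k l (- (Sy n lam f * \<Delta>))"
      using spec_act[OF ne Lau_Sy_Delta[OF f]] by simp
    also have "\<dots> = - spec k l (Sy n lam f * \<Delta>)" by (rule spec_uminus[OF ne Lau_Sy_Delta[OF f]])
    finally show "spec k l (Sy n lam f * \<Delta>) = 0" by (rule eq_uminus_imp_0)
  qed
  then obtain g where g: "g \<in> Lau" "Sy n lam f * \<Delta> = g * \<Delta>" by blast
  then show ?thesis using Delta_nonzero by simp
qed

definition ck :: "bool \<Rightarrow> K \<Rightarrow> nat \<Rightarrow> nat \<Rightarrow> K" where
  "ck s t i j = (if (i < j) = s then 1 else - t)"

text \<open>The leading term of the alternating sum is divided by that of \<open>\<Delta>\<close>.
  All summands share one exponent: w only reorders the pairs, and the extreme exponent of x_i - t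
  x_j is symmetric in i and j.\<close>

lemma leading_Sy:
  assumes f: "f \<in> Lau" and t: "\<And>w. w \<in> Stab n lam \<Longrightarrow> leading s \<kappa> (c w) (act w f)"
  shows "leading s \<kappa> ((\<Sum>w\<in>Stab n lam. sgK (Jp n lam) w * (c w * (\<Prod>(i, j)\<in>Jp n lam. ck s tK (w i) (w j)))) / (\<Prod>(i, j)\<in>Jp n lam. ck s 1 i j)) (Sy n lam f)"
proof (rule leading_quotient[OF Lau_Sy[OF f]])
  let ?\<rho> = "\<Sum>p\<in>Jp n lam. ek s p"
  have e: "ek s (a, b) = ek s (b, a)" for a b by (simp add: ek_def min.commute max.commute)
  have "leading s (ek s p) (case p of (i, j) \<Rightarrow> ck s 1 i j) (case p of (i, j) \<Rightarrow> xvar i - xvar j)" if "p \<in> Jp n lam" for p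
  proof -
    obtain i j where ij: "p = (i, j)" by (cases p)
    have "i \<noteq> j" using Jp_less[of i j n lam] that ij by simp
    from leading_difference[OF this, of s 1] show ?thesis unfolding ij ck_def by simp
  qed
  then show "leading s ?\<rho> (\<Prod>(i, j)\<in>Jp n lam. ck s 1 i j) \<Delta>" by (rule leading_prod)
  show "(\<Prod>(i, j)\<in>Jp n lam. ck s 1 i j) \<noteq> 0" by (auto simp: finite_Jp ck_def split: if_splits)
  show "leading s (\<kappa> + ?\<rho>) (\<Sum>w\<in>Stab n lam. sgK (Jp n lam) w * (c w * (\<Prod>(i, j)\<in>Jp n lam. ck s tK (w i) (w j)))) (Sy n lam f * \<Delta>)"
    unfolding Sy_Delta
  proof (rule leading_sum)
    fix w assume w: "w \<in> Stab n lam"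
    have F: "field_endo (act w)" by (rule field_endo_act[OF Stab_bij[OF w]])
    have "leading s (ek s (ordp w p)) (case p of (i, j) \<Rightarrow> ck s tK (w i) (w j)) (case p of (i, j) \<Rightarrow> xvar (w i) - tt * xvar (w j))"
      if p: "p \<in> Jp n lam" for p
    proof -
      obtain i j where ij: "p = (i, j)" by (cases p)
      have "w i \<noteq> w j" using Jp_less[of i j] p ij permutes_inj[OF Stab_permutes[OF w]] by (auto simp: inj_eq)
      then have "leading s (ek s (w i, w j)) (ck s tK (w i) (w j)) (xvar (w i) - tt * xvar (w j))"
        unfolding ck_def by (rule leading_difference)
      moreover have "ek s (ordp w p) = ek s (w i, w j)" unfolding ij ordp_def using e by simp
      ultimately show ?thesis unfolding ij by simp
    qed
    then have "leading s (\<Sum>p\<in>Jp n lam. ek s (ordp w p)) (\<Prod>(i, j)\<in>Jp n lam. ck s tK (w i) (w j)) (act w \<M>)"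
      unfolding act_M[OF w] by (rule leading_prod)
    then have "leading s ?\<rho> (\<Prod>(i, j)\<in>Jp n lam. ck s tK (w i) (w j)) (act w \<M>)"
      unfolding sum.reindex_bij_betw[OF ordp_bij[OF w]] .
    then have "leading s (\<kappa> + ?\<rho>) (c w * (\<Prod>(i, j)\<in>Jp n lam. ck s tK (w i) (w j))) (act w f * act w \<M>)"
      by (rule leading_mult[OF t[OF w]])
    then have "leading s (0 + (\<kappa> + ?\<rho>)) (sgK (Jp n lam) w * (c w * (\<Prod>(i, j)\<in>Jp n lam. ck s tK (w i) (w j))))
        (scal (sgK (Jp n lam) w) * (act w f * act w \<M>))"
      by (rule leading_mult[OF leading_scal])
    then show "leading s (\<kappa> + ?\<rho>) (sgK (Jp n lam) w * (c w * (\<Prod>(i, j)\<in>Jp n lam. ck s tK (w i) (w j)))) (scal (sgK (Jp n lam) w) * act w (f * \<M>))"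
      unfolding field_endo_mult[OF F] add_0 .
  qed
qed

text \<open>t to the number of inversions of w among the pairs in \<open>Jp\<close>, which is t^l(w)
  on the stabilizer of a dominant exponent.\<close>

definition tinv :: "(nat \<Rightarrow> nat) \<Rightarrow> K" where
  "tinv w = (\<Prod>(i, j)\<in>Jp n lam. if w i < w j then 1 else tK)"

text \<open>An inverted pair contributes the sign -1 and the leading coefficient -t, together
  t.\<close>

lemma leading_Sy_lex:
  assumes f: "f \<in> Lau" and t: "\<And>w. w \<in> Stab n lam \<Longrightarrow> leading True \<kappa> (c w) (act w f)"
  shows "leading True \<kappa> (\<Sum>w\<in>Stab n lam. c w * tinv w) (Sy n lam f)"
proof -
  have 1: "(\<Prod>(i, j)\<in>Jp n lam. ck True 1 i j) = 1"
    by (rule prod.neutral) (auto simp: ck_def dest: Jp_less)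
  have 2: "sgK (Jp n lam) w * (\<Prod>(i, j)\<in>Jp n lam. ck True tK (w i) (w j)) = tinv w" for w
    unfolding sgK_def tinv_def prod.distrib[symmetric] by (rule prod.cong) (auto simp: ck_def)
  have 3: "sgK (Jp n lam) w * (c w * (\<Prod>(i, j)\<in>Jp n lam. ck True tK (w i) (w j))) = c w * tinv w" for w
    unfolding 2[symmetric] by (rule mult.left_commute)
  have "leading True \<kappa> ((\<Sum>w\<in>Stab n lam. sgK (Jp n lam) w * (c w * (\<Prod>(i, j)\<in>Jp n lam. ck True tK (w i) (w j)))) / (\<Prod>(i, j)\<in>Jp n lam. ck True 1 i j)) (Sy n lam f)"
    by (rule leading_Sy[OF f t])
  then show ?thesis unfolding 1 3 div_by_1 .
qed

text \<open>The exponents in \<open>Sy n lam 1\<close> are both at most and at least 0.\<close>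

lemma Sy_1: "Sy n lam 1 = scal (\<Sum>w\<in>Stab n lam. tinv w)"
proof -
  have a: "leading s 0 1 (act w 1)" if "w \<in> Stab n lam" for w s
    using leading_1 by (simp only: field_endo_1[OF field_endo_act[OF Stab_bij[OF that]]])
  have "leading True 0 (\<Sum>w\<in>Stab n lam. tinv w) (Sy n lam 1)"
    using leading_Sy_lex[OF Lau_1 a] by simp
  then obtain p where p: "Sy n lam 1 = to_fract p" "lk p 0 = (\<Sum>w\<in>Stab n lam. tinv w)" "\<forall>\<nu>\<in>keys p. le_dir True \<nu> 0"
    by (auto simp: leading_def)
  obtain c where "leading False 0 c (Sy n lam 1)"
    using leading_Sy[OF Lau_1 a] by blast
  then have "\<forall>\<nu>\<in>keys p. le_dir False \<nu> 0" unfolding p(1) by (auto simp: leading_def)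
  then have "\<nu> = 0" if "\<nu> \<in> keys p" for \<nu>
    using p(3) that by (intro antisym) (simp_all add: le_dir_def)
  then have "keys p \<subseteq> {0}" by blast
  then have "p = single 0 (lk p 0)"
    by (intro poly_mapping_eqI) (auto simp: lookup_single when_def in_keys_iff)
  then show ?thesis unfolding p(1) p(2)[symmetric] scal_def by simp
qed

context
  assumes lam: "dominant n lam"
begin

text \<open>A descent r of the inverse v of w yields the w-values r and r+1. Dominance orders the
  parts at v(r+1), v(r) one way and those at r+1, r the other way, so they are equal and the pair
  lies in \<open>Jp\<close>.\<close>

lemma Stab_descent:
  assumes w: "w \<in> Stab n lam" and "w \<noteq> id"
  shows "\<exists>(i, j)\<in>Jp n lam. w i = Suc (w j)"
proof -
  have wp: "w permutes {1..n}" by (rule Stab_permutes[OF w])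
  define v where "v = inv w"
  have v: "v permutes {1..n}" "v \<in> Stab n lam"
    unfolding v_def by (rule permutes_inv[OF wp], rule Stab_inv[OF w])
  have wv: "w (v r) = r" for r unfolding v_def by (rule permutes_inverses(1)[OF wp])
  have "\<exists>r. 1 \<le> r \<and> r < n \<and> v (Suc r) < v r"
  proof (rule ccontr)
    assume no: "\<nexists>r. 1 \<le> r \<and> r < n \<and> v (Suc r) < v r"
    \<comment> \<open>Without descents v is increasing on 1..n, so r <= v(r) and v is the
      identity.\<close>
    have "r \<le> v r" if "1 \<le> r" "r \<le> n" for r
      using that
    proof (induction r)
      case (Suc r)
      show ?case
      proof (cases "r = 0")
        case True
        then have "v (Suc r) \<in> {1..n}" using Suc.prems permutes_in_image[OF v(1), of "Suc r"] by simp
        then show ?thesis using True by simp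
      next
        case False
        then have "r \<le> v r" "\<not> v (Suc r) < v r" using Suc no by auto
        moreover have "v (Suc r) \<noteq> v r" using permutes_inj[OF v(1)] by (simp add: inj_eq)
        ultimately show ?thesis by simp
      qed
    qed simp
    then have "v = id" by (intro permutes_natset_ge[OF v(1)]) auto
    then have "w = id" using wv by (auto simp: fun_eq_iff)
    then show False using assms(2) by simp
  qed
  then obtain r where r: "1 \<le> r" "r < n" "v (Suc r) < v r" by blast
  have rn: "r \<in> {1..n}" "Suc r \<in> {1..n}" using r by auto
  then have vin: "v r \<in> {1..n}" "v (Suc r) \<in> {1..n}" using permutes_in_image[OF v(1)] by blast+
  have lamv: "lk lam (v r) = lk lam r" "lk lam (v (Suc r)) = lk lam (Suc r)"
    using v(2) rn by (simp_all add: Stab_def)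
  have "lk lam (v r) \<le> lk lam (v (Suc r))" "lk lam (Suc r) \<le> lk lam r"
    using lam vin rn r(3) by (simp_all add: dominant_def)
  then have "(v (Suc r), v r) \<in> Jp n lam" using vin r(3) lamv by (simp add: Jp_def pairs_def)
  then show ?thesis by (rule bexI[rotated]) (simp add: wv)
qed

lemma eval_princ_Sy:
  assumes f: "f \<in> Lau"
  shows "eval_princ (Sy n lam f) = eval_princ f * (\<Prod>(i, j)\<in>Jp n lam. Rd (j - i))"
proof -
  let ?v = "\<lambda>w. eval_princ (act w f) * (\<Prod>(i, j)\<in>Jp n lam. (tK ^ (w i - 1) - tK * tK ^ (w j - 1)) / (tK ^ (w i - 1) - tK ^ (w j - 1)))"
  have val: "princ.has_value (act w (f * (\<Prod>(i, j)\<in>Jp n lam. (xvar i - tt * xvar j) / (xvar i - xvar j)))) (?v w)"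
    if w: "w \<in> Stab n lam" for w
  proof -
    have F: "field_endo (act w)" by (rule field_endo_act[OF Stab_bij[OF w]])
    have "princ.has_value (act w (case p of (i, j) \<Rightarrow> (xvar i - tt * xvar j) / (xvar i - xvar j)))
        (case p of (i, j) \<Rightarrow> (tK ^ (w i - 1) - tK * tK ^ (w j - 1)) / (tK ^ (w i - 1) - tK ^ (w j - 1)))"
      if p: "p \<in> Jp n lam" for p
    proof -
      obtain i j where ij: "p = (i, j)" by (cases p)
      have h: "i \<in> {1..n}" "j \<in> {1..n}" "i \<noteq> j" using p ij by (auto simp: Jp_def pairs_def)
      have "w i \<in> {1..n}" "w j \<in> {1..n}" using h permutes_in_image[OF Stab_permutes[OF w]] by blast+
      moreover have "w i \<noteq> w j" using h permutes_inj[OF Stab_permutes[OF w]] by (simp add: inj_eq)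
      ultimately have "tK ^ (w i - 1) - tK ^ (w j - 1) \<noteq> 0" by (auto simp: tK_power_eq_iff)
      then show ?thesis
        unfolding ij prod.case field_endo_divide[OF F] field_endo_diff[OF F] field_endo_mult[OF F]
          act_scal[OF Stab_bij[OF w]] act_xvar[OF Stab_bij[OF w]]
        by (intro princ.has_value_divide princ.has_value_diff princ.has_value_mult princ.has_value_scal princ.has_value_xvar)
    qed
    then show ?thesis unfolding field_endo_mult[OF F] field_endo_prod[OF F]
      by (intro princ.has_value_mult princ.has_value_prod has_value_Lau[OF Lau_act[OF Stab_bij[OF w] f]])
  qed
  have "princ.has_value (Sy n lam f) (\<Sum>w\<in>Stab n lam. ?v w)"
    unfolding Sy_def using val by (rule princ.has_value_sum)
  then have "eval_princ (Sy n lam f) = (\<Sum>w\<in>Stab n lam. ?v w)" by (rule eval_princ_eqI)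
  also have "\<dots> = (\<Sum>w\<in>{id}. ?v w)"
  proof (rule sum.mono_neutral_right)
    show "{id} \<subseteq> Stab n lam" by (simp add: Stab_def permutes_id)
    show "\<forall>w\<in>Stab n lam - {id}. ?v w = 0"
    proof
      fix w assume w: "w \<in> Stab n lam - {id}"
      then obtain i j where ij: "(i, j) \<in> Jp n lam" "w i = Suc (w j)" using Stab_descent[of w] by auto
      have "j \<in> {1..n}" using ij(1) by (auto simp: Jp_def pairs_def)
      then have "w j \<in> {1..n}" using w permutes_in_image[OF Stab_permutes, of w j] by blast
      then have "tK ^ (w i - 1) = tK * tK ^ (w j - 1)" unfolding ij(2) by (cases "w j") auto
      then have "(\<Prod>(i, j)\<in>Jp n lam. (tK ^ (w i - 1) - tK * tK ^ (w j - 1)) / (tK ^ (w i - 1) - tK ^ (w j - 1))) = 0"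
        by (intro prod_zero[OF finite_Jp] bexI[OF _ ij(1)]) simp
      then show "?v w = 0" by simp
    qed
  qed (rule finite_Stab)
  also have "\<dots> = eval_princ f * (\<Prod>(i, j)\<in>Jp n lam. Rd (j - i))"
  proof -
    have "(tK ^ (i - 1) - tK * tK ^ (j - 1)) / (tK ^ (i - 1) - tK ^ (j - 1)) = Rd (j - i)" if "(i, j) \<in> Jp n lam" for i j
    proof -
      have ij: "1 \<le> i" "i < j" using that by (auto simp: Jp_def pairs_def)
      \<comment> \<open>Cancelling t^(i-1) leaves a quotient that depends on j - i only.\<close>
      have "tK ^ (j - 1) = tK ^ (i - 1) * tK ^ (j - i)" using ij by (simp flip: power_add)
      then have "(tK ^ (i - 1) - tK * tK ^ (j - 1)) / (tK ^ (i - 1) - tK ^ (j - 1))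
          = (tK ^ (i - 1) * (1 - tK ^ (j - i + 1))) / (tK ^ (i - 1) * (1 - tK ^ (j - i)))"
        by (simp add: algebra_simps)
      then show ?thesis unfolding Rd_def by simp
    qed
    then have "(\<Prod>(i, j)\<in>Jp n lam. (tK ^ (i - 1) - tK * tK ^ (j - 1)) / (tK ^ (i - 1) - tK ^ (j - 1))) = (\<Prod>(i, j)\<in>Jp n lam. Rd (j - i))"
      by (intro prod.cong) auto
    then show ?thesis by (simp add: act_id)
  qed
  finally show ?thesis .
qed

lemma poincare: "(\<Sum>w\<in>Stab n lam. tinv w) = (\<Prod>(i, j)\<in>Jp n lam. Rd (j - i))"
  using eval_princ_Sy[OF Lau_1] by (simp add: Sy_1 eval_princ_scal eval_princ_1)

end

end

subsection \<open>The symmetric Macdonald polynomials\<close>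

context
  fixes n :: nat and E :: "(nat \<Rightarrow>\<^sub>0 int) \<Rightarrow> ratfun" and lam :: "nat \<Rightarrow>\<^sub>0 int"
  assumes n: "0 < n" and E: "macdonald_E n E" and lam: "dominant n lam"
begin

lemma lam_Zn: "lam \<in> Zn n"
  using lam by (simp add: dominant_def)

lemma P_sum_eq: "P_sum n E lam = Sy n 0 (E lam)"
proof -
  have "Stab n 0 = {w. w permutes {1..n}}" "Jp n 0 = pairs n" by (auto simp: Stab_def Jp_def)
  then show ?thesis by (simp only: P_sum_def Sy_def)
qed

lemma E_lam_Lau: "E lam \<in> Lau"
  by (rule laurent_polys_Lau[OF E_Laurent[OF n E lam_Zn]])

text \<open>Exponents of w E_lam are w-images of exponents below \<open>lam\<close>, hence
  lexicographically at most \<open>lam\<close>. By \<open>below_dominant_orbit\<close> only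
  \<open>lam\<close> itself can be moved to \<open>lam\<close>, and this needs w in the
  stabilizer.\<close>

lemma leading_act_E:
  assumes w: "w permutes {1..n}"
  shows "leading True lam (if w \<in> Stab n lam then 1 else 0) (act w (E lam))"
proof -
  have b: "bij w" by (rule permutes_bij[OF w])
  obtain p where p: "E lam = to_fract p" "\<And>\<nu>. \<nu> \<in> keys p \<Longrightarrow> \<nu> \<in> Zn n \<and> below n \<nu> lam" "lk p lam = 1"
    using E_triangular[OF n E lam_Zn] by (auto simp: triangular_def)
  let ?q = "\<Sum>\<nu>\<in>keys p. single (permexp w \<nu>) (lk p \<nu>)"
  have F: "field_endo (act w)" by (rule field_endo_act[OF b])
  have 1: "act w (E lam) = to_fract ?q"
    unfolding p(1) to_fract_expand[of p] field_endo_sum[OF F] field_endo_mult[OF F] act_scal[OF b] act_xmon[OF b]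
      to_fract_sum to_fract_single ..
  have 2: "\<forall>\<kappa>\<in>keys ?q. le_dir True \<kappa> lam"
  proof
    fix \<kappa> assume "\<kappa> \<in> keys ?q"
    then have "(\<Sum>\<nu>\<in>keys p. lk (single (permexp w \<nu>) (lk p \<nu>)) \<kappa>) \<noteq> 0" by (simp add: in_keys_iff lookup_sum)
    then obtain \<nu> where \<nu>: "\<nu> \<in> keys p" "lk (single (permexp w \<nu>) (lk p \<nu>)) \<kappa> \<noteq> 0"
      by (rule sum.not_neutral_contains_not_neutral)
    then have "\<kappa> = permexp w \<nu>" by (auto simp: lookup_single when_def split: if_splits)
    then show "le_dir True \<kappa> lam"
      using permexp_le_dominant[OF lam w] p(2)[OF \<nu>(1)] by (simp add: le_dir_def)
  qed
  have 3: "lk ?q lam = (if w \<in> Stab n lam then 1 else 0)"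
  proof -
    have stab: "permexp w lam = lam \<longleftrightarrow> w \<in> Stab n lam"
    proof
      assume eq: "permexp w lam = lam"
      have "lk lam (w i) = lk lam i" for i
        using arg_cong[OF eq, of "\<lambda>\<mu>. lk \<mu> (w i)"] by (simp add: lookup_permexp[OF b] permutes_inverses(2)[OF w])
      then show "w \<in> Stab n lam" using w by (simp add: Stab_def)
    next
      assume "w \<in> Stab n lam"
      then have "inv w \<in> Stab n lam" by (rule Stab_inv)
      then show "permexp w lam = lam"
        by (intro Zn_eqI[OF permexp_Zn[OF w lam_Zn] lam_Zn]) (simp add: lookup_permexp[OF b] Stab_def)
    qed
    have "lk ?q lam = (\<Sum>\<nu>\<in>keys p. if \<nu> = lam then (if w \<in> Stab n lam then 1 else 0) else 0)"
      unfolding lookup_sum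
    proof (rule sum.cong[OF refl])
      fix \<nu> assume \<nu>: "\<nu> \<in> keys p"
      show "lk (single (permexp w \<nu>) (lk p \<nu>)) lam = (if \<nu> = lam then if w \<in> Stab n lam then 1 else 0 else 0)"
      proof (cases "permexp w \<nu> = lam")
        case True
        then have "\<nu> = lam" using below_dominant_orbit[OF lam w] p(2)[OF \<nu>] by blast
        then show ?thesis using True stab p(3) by simp
      next
        case False
        then show ?thesis using stab by (auto simp: lookup_single)
      qed
    qed
    also have "\<dots> = (if w \<in> Stab n lam then 1 else 0)" using p(3) by (simp add: in_keys_iff)
    finally show ?thesis .
  qed
  show ?thesis unfolding leading_def by (rule exI[of _ ?q]) (intro conjI 1 2 3)
qed

text \<open>An element of the stabilizer maps each block of equal parts to itself, and dominance
  orders the blocks, so it inverts no pair outside \<open>Jp\<close>.\<close>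

lemma tinv_zero_Stab: assumes w: "w \<in> Stab n lam" shows "tinv n 0 w = tinv n lam w"
proof -
  have "tinv n 0 w = (\<Prod>(i, j)\<in>pairs n. if w i < w j then 1 else tK)"
    by (simp add: tinv_def Jp_def)
  also have "\<dots> = tinv n lam w" unfolding tinv_def
  proof (rule prod.mono_neutral_right[OF finite_pairs])
    show "Jp n lam \<subseteq> pairs n" by (auto simp: Jp_def)
    show "\<forall>p\<in>pairs n - Jp n lam. (case p of (i, j) \<Rightarrow> if w i < w j then 1 else tK) = 1"
    proof
      fix p assume "p \<in> pairs n - Jp n lam"
      then obtain i j where ij: "p = (i, j)" "i \<in> {1..n}" "j \<in> {1..n}" "i < j" "lk lam i \<noteq> lk lam j"
        by (auto simp: pairs_def Jp_def)
      have "lk lam j \<le> lk lam i" using lam ij(2-4) by (simp add: dominant_def)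
      then have less: "lk lam j < lk lam i" using ij(5) by simp
      have win: "w i \<in> {1..n}" "w j \<in> {1..n}" using ij permutes_in_image[OF Stab_permutes[OF w]] by blast+
      have lw: "lk lam (w i) = lk lam i" "lk lam (w j) = lk lam j" using w ij(2,3) by (simp_all add: Stab_def)
      have "\<not> w j \<le> w i"
      proof
        assume "w j \<le> w i"
        then have "lk lam (w i) \<le> lk lam (w j)" using lam win by (simp add: dominant_def)
        then show False using lw less by simp
      qed
      then show "(case p of (i, j) \<Rightarrow> if w i < w j then 1 else tK) = 1" by (simp add: ij)
    qed
  qed
  finally show ?thesis .
qed

lemma leading_P_sum: "leading True lam (\<Prod>(i, j)\<in>Jp n lam. Rd (j - i)) (P_sum n E lam)"
proof -
  have "leading True lam (\<Sum>w\<in>Stab n 0. (if w \<in> Stab n lam then 1 else 0) * tinv n 0 w) (Sy n 0 (E lam))"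
    by (rule leading_Sy_lex[OF E_lam_Lau leading_act_E]) (rule Stab_permutes)
  also have "(\<Sum>w\<in>Stab n 0. (if w \<in> Stab n lam then 1 else 0) * tinv n 0 w) = (\<Sum>w\<in>Stab n lam. tinv n lam w)"
    by (rule sum.mono_neutral_cong_right[OF finite_Stab]) (auto simp: tinv_zero_Stab Stab_def)
  finally show ?thesis unfolding poincare[OF lam] P_sum_eq .
qed

lemma W_const_eq: "W_const n E lam = (\<Prod>(i, j)\<in>Jp n lam. Rd (j - i))"
proof -
  let ?W = "\<Prod>(i, j)\<in>Jp n lam. Rd (j - i)"
  have W0: "?W \<noteq> 0" using Rd_nonzero Jp_less by (auto simp: finite_Jp)
  obtain p where p: "P_sum n E lam = to_fract p" "lk p lam = ?W"
    using leading_P_sum by (auto simp: leading_def)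
  have "(\<exists>r. scal (1 / c) * P_sum n E lam = to_fract r \<and> lk r lam = 1) \<longleftrightarrow> c = ?W" for c
  proof -
    have "scal (1 / c) * P_sum n E lam = to_fract (single 0 (1 / c) * p)" by (simp only: p(1) scal_to_fract)
    then have "(\<exists>r. scal (1 / c) * P_sum n E lam = to_fract r \<and> lk r lam = 1) \<longleftrightarrow> lk (single 0 (1 / c) * p) lam = 1"
      by (auto simp only: to_fract_eq_iff)
    \<comment> \<open>The case c = 0 is ruled out since 1 / 0 = 0 would give the coefficient
      0.\<close>
    also have "\<dots> \<longleftrightarrow> c = ?W" unfolding lookup_scaled p(2) using W0 by (auto simp: divide_simps)
    finally show ?thesis .
  qed
  then show ?thesis unfolding W_const_def by simp
qed

lemma pairs_prod_split:
  "(\<Prod>(i, j)\<in>pairs n. f i j) = (\<Prod>(i, j)\<in>Jp n lam. f i j) * (\<Prod>(i, j)\<in>pairs n. if lk lam i = lk lam j then 1 else f i j :: K)"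
proof -
  have "(\<Prod>(i, j)\<in>Jp n lam. f i j) = (\<Prod>(i, j)\<in>pairs n. if lk lam i = lk lam j then f i j else 1)"
    by (rule prod.mono_neutral_cong_left[OF finite_pairs]) (auto simp: Jp_def split: if_splits)
  then show ?thesis by (simp add: prod.distrib[symmetric] case_prod_unfold if_distrib cong: if_cong)
qed

text \<open>The symmetrizer contributes the product over all pairs, and W_lam removes the pairs with
  equal parts.\<close>

lemma eval_princ_P_aux:
  "eval_princ (macdonald_P n E lam) = Gval n lam * (\<Prod>(i, j)\<in>pairs n. if lk lam i = lk lam j then 1 else Rd (j - i))"
proof -
  let ?W = "\<Prod>(i, j)\<in>Jp n lam. Rd (j - i)"
  have W0: "?W \<noteq> 0" using Rd_nonzero Jp_less by (auto simp: finite_Jp)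
  have "Jp n 0 = pairs n" by (auto simp: Jp_def)
  then have "eval_princ (P_sum n E lam) = Gval n lam * (\<Prod>(i, j)\<in>pairs n. Rd (j - i))"
    using eval_princ_Sy[OF dominant_zero E_lam_Lau] eval_princ_E[OF n E lam_Zn] unfolding P_sum_eq by simp
  moreover have "P_sum n E lam \<in> Lau" unfolding P_sum_eq by (rule Lau_Sy[OF E_lam_Lau])
  ultimately have "eval_princ (macdonald_P n E lam) = 1 / ?W * (Gval n lam * (\<Prod>(i, j)\<in>pairs n. Rd (j - i)))"
    unfolding macdonald_P_def W_const_eq by (simp only: eval_princ_mult Lau_scal eval_princ_scal)
  then show ?thesis unfolding pairs_prod_split[of "\<lambda>i j. Rd (j - i)"] using W0 by simp
qed

text \<open>On a block of equal parts \<open>v\<^sub>\<lambda>\<close> is increasing, so \<open>a \<mapsto> n + 1 - v\<^sub>\<lambda>(a)\<close> reverses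
  each block.\<close>

lemma lookup_reversed_vperm:
  assumes a: "a \<in> {1..n}"
  shows "lk lam (n + 1 - vperm n lam a) = lk lam a"
proof -
  let ?v = "vperm n lam" and ?r = "\<lambda>i. if i \<in> {1..n} then n + 1 - i else i"
  have rb: "?r permutes {1..n}"
  proof (rule bij_imp_permutes)
    show "bij_betw ?r {1..n} {1..n}" by (rule bij_betw_byWitness[where f' = ?r]) auto
  qed auto
  define \<sigma> where "\<sigma> = ?r \<circ> ?v"
  have s: "\<sigma> permutes {1..n}" unfolding \<sigma>_def by (rule permutes_compose[OF vperm_permutes rb])
  have vin: "?v c \<in> {1..n}" if "c \<in> {1..n}" for c using permutes_in_image[OF vperm_permutes] that by blast
  have sv: "\<sigma> c = n + 1 - ?v c" if "c \<in> {1..n}" for c using vin[OF that] by (simp add: \<sigma>_def)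
  let ?\<kappa> = "permexp \<sigma> lam"
  have \<kappa>Z: "?\<kappa> \<in> Zn n" by (rule permexp_Zn[OF s lam_Zn])
  have "dominant n ?\<kappa>"
    unfolding dominant_def
  proof (intro conjI \<kappa>Z ballI impI)
    fix i j assume ij: "i \<in> {1..n}" "j \<in> {1..n}" "i \<le> j"
    define c d where "c = inv \<sigma> i" "d = inv \<sigma> j"
    have cd: "c \<in> {1..n}" "d \<in> {1..n}" unfolding c_d_def using ij permutes_in_image[OF permutes_inv[OF s]] by blast+
    have "\<sigma> c = i" "\<sigma> d = j" by (simp_all add: c_d_def permutes_inverses(1)[OF s])
    then have "n + 1 - ?v c \<le> n + 1 - ?v d" using ij(3) sv[OF cd(1)] sv[OF cd(2)] by simp
    then have "?v d \<le> ?v c" using vin[OF cd(1)] vin[OF cd(2)] by auto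
    then have "\<not> ?v c < ?v d" by simp
    then have "\<not> (vleq lam c d \<and> c \<noteq> d)" using vperm_less_iff[OF cd, of lam] by simp
    then have "lk lam d \<le> lk lam c" by (auto simp: vleq_def)
    then show "lk ?\<kappa> j \<le> lk ?\<kappa> i" by (simp add: lookup_permexp[OF permutes_bij[OF s]] c_d_def)
  qed
  \<comment> \<open>Both are dominant and rearrangements of one another, so each is
    lexicographically at most the other.\<close>
  then have "?\<kappa> = lam"
    using le_dominant[OF lam \<kappa>Z] le_dominant[OF _ lam_Zn, of ?\<kappa>] Nf_permexp[OF s, of lam]
    by (intro antisym) simp_all
  moreover have "lk ?\<kappa> (\<sigma> a) = lk lam a"
    unfolding lookup_permexp[OF permutes_bij[OF s]] permutes_inverses(2)[OF s] ..
  ultimately show ?thesis using sv[OF a] by simp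
qed

lemma reversed_vperm_bij: "bij_betw (\<lambda>a. n + 1 - vperm n lam a) {1..n} {1..n}"
proof -
  have "bij_betw (\<lambda>i. n + 1 - i) {1..n} {1..n}"
    by (rule bij_betw_byWitness[where f' = "\<lambda>i. n + 1 - i"]) auto
  from bij_betw_trans[OF permutes_imp_bij[OF vperm_permutes] this] show ?thesis unfolding o_def .
qed

text \<open>Reindexing by the block reversal turns the exponents v(a) - v(b) into heights j - i. The
  indicator of a < b can change only where lam_a <= lam_b, and there \<open>Hf\<close> is 1.\<close>

lemma GH_dominant: "GH n lam = (\<Prod>(i, j)\<in>pairs n. Hf (lk lam i - lk lam j - 1) (int (j - i)))"
proof -
  let ?\<sigma> = "\<lambda>a. n + 1 - vperm n lam a"
  define F where "F = (\<lambda>(a, b). Hf (lk lam a - lk lam b - of_bool (a < b)) (int b - int a))"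
  have mono: "a < b" if "a \<in> {1..n}" "b \<in> {1..n}" "lk lam b < lk lam a" for a b
  proof (rule ccontr)
    assume "\<not> a < b"
    then have "lk lam a \<le> lk lam b" using lam that by (simp add: dominant_def)
    then show False using that(3) by simp
  qed
  have sin: "?\<sigma> a \<in> {1..n}" if "a \<in> {1..n}" for a by (rule bij_betw_apply[OF reversed_vperm_bij that])
  have "GH n lam = (\<Prod>p\<in>Pn n. F (map_prod ?\<sigma> ?\<sigma> p))"
    unfolding GH_def
  proof (rule prod.cong[OF refl], clarify)
    fix a b assume ab: "a \<in> {1..n}" "b \<in> {1..n}"
    have vin: "vperm n lam c \<le> n" if "c \<in> {1..n}" for c
      using permutes_in_image[OF vperm_permutes, of n lam c] that by simp
    have d: "int (?\<sigma> b) - int (?\<sigma> a) = int (vperm n lam a) - int (vperm n lam b)"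
      using vin[OF ab(1)] vin[OF ab(2)] by (simp add: of_nat_diff)
    have l: "lk lam (?\<sigma> a) = lk lam a" "lk lam (?\<sigma> b) = lk lam b"
      using ab by (simp_all only: lookup_reversed_vperm)
    show "Hf (lk lam a - lk lam b - of_bool (a < b)) (int (vperm n lam a) - int (vperm n lam b)) = F (map_prod ?\<sigma> ?\<sigma> (a, b))"
    proof (cases "lk lam b < lk lam a")
      case True
      then have "a < b" "?\<sigma> a < ?\<sigma> b"
        using mono[OF ab] mono[OF sin[OF ab(1)] sin[OF ab(2)]] l by simp_all
      then show ?thesis unfolding F_def map_prod_simp prod.case d l by simp
    next
      case False
      then show ?thesis unfolding F_def map_prod_simp prod.case d l by (simp add: Hf_nonpos)
    qed
  qed
  also have "\<dots> = (\<Prod>p\<in>Pn n. F p)"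
    by (rule prod.reindex_bij_betw[OF bij_betw_pairs[OF reversed_vperm_bij]])
  also have "\<dots> = (\<Prod>(i, j)\<in>pairs n. Hf (lk lam i - lk lam j - 1) (int (j - i)))"
  proof (rule prod.mono_neutral_cong_right)
    show "pairs n \<subseteq> Pn n" by (auto simp: pairs_def)
    show "\<forall>p\<in>Pn n - pairs n. F p = 1"
    proof
      fix p assume p: "p \<in> Pn n - pairs n"
      obtain a b where ab: "p = (a, b)" by (cases p)
      then have "a \<in> {1..n}" "b \<in> {1..n}" "b \<le> a" using p by (auto simp: pairs_def)
      then have "lk lam a \<le> lk lam b" using lam by (simp add: dominant_def)
      then show "F p = 1" by (simp add: F_def ab Hf_nonpos)
    qed
    show "F p = (case p of (i, j) \<Rightarrow> Hf (lk lam i - lk lam j - 1) (int (j - i)))" if p: "p \<in> pairs n" for p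
    proof -
      obtain i j where "p = (i, j)" "i < j" using p by (auto simp: pairs_def)
      then show ?thesis by (simp add: F_def of_nat_diff)
    qed
  qed simp
  finally show ?thesis .
qed

lemma desc_dominant: "desc n lam = (\<Sum>(i, j)\<in>pairs n. lk lam i - lk lam j)"
  unfolding desc_def
proof (rule sum.mono_neutral_cong_right)
  show "pairs n \<subseteq> Pn n" by (auto simp: pairs_def)
  show "\<forall>p\<in>Pn n - pairs n. (case p of (a, b) \<Rightarrow> max 0 (lk lam a - lk lam b)) = 0"
  proof
    fix p assume p: "p \<in> Pn n - pairs n"
    obtain a b where ab: "p = (a, b)" by (cases p)
    then have "a \<in> {1..n}" "b \<in> {1..n}" "b \<le> a" using p by (auto simp: pairs_def)
    then have "lk lam a \<le> lk lam b" using lam by (simp add: dominant_def)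
    then show "(case p of (a, b) \<Rightarrow> max 0 (lk lam a - lk lam b)) = 0" by (simp add: ab)
  qed
  show "(case p of (a, b) \<Rightarrow> max 0 (lk lam a - lk lam b)) = (case p of (a, b) \<Rightarrow> lk lam a - lk lam b)" if "p \<in> pairs n" for p
    using lam that by (auto simp: pairs_def dominant_def)
qed simp

text \<open>The factor at m = 0 is t^(-1/2) times \<open>Rd d\<close>, the others form
  \<open>Hf\<close>. There is none for D = 0, in agreement with the omission of equal parts in
  \<open>eval_princ_P_aux\<close>.\<close>

lemma prod_cval_from_0:
  assumes "0 \<le> D"
  shows "(\<Prod>m\<in>{0..<D}. cval m (int d)) = thalf powi (- D) * ((if D = 0 then 1 else Rd d) * Hf (D - 1) (int d))"
proof (cases "D = 0")
  case True
  then show ?thesis by (simp add: Hf_nonpos)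
next
  case False
  then have "{0..<D} = insert 0 {1..D - 1}" using assms by auto
  then have "(\<Prod>m\<in>{0..<D}. cval m (int d)) = cval 0 (int d) * (thalf powi (- (D - 1)) * Hf (D - 1) (int d))"
    using False assms by (simp add: prod_cval[OF n])
  also have "cval 0 (int d) = thalf powi (- 1) * Rd d"
    using power_int_of_nat[of tK "d + 1"] by (simp add: cval_def[OF n] Rd_def power_int_minus add.commute)
  also have "thalf powi (- 1) * Rd d * (thalf powi (- (D - 1)) * Hf (D - 1) (int d))
      = (thalf powi (- 1) * thalf powi (- (D - 1))) * (Rd d * Hf (D - 1) (int d))"
    by (simp only: mult_ac)
  also have "thalf powi (- 1) * thalf powi (- (D - 1)) = thalf powi (- 1 + - (D - 1))"
    by (rule power_int_add[symmetric]) simp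
  finally show ?thesis using False by simp
qed

lemma ev0_tinv_transl:
  "ev0_tinv n (c_prod n (transl n lam)) = thalf powi (- desc n lam) *
    ((\<Prod>(i, j)\<in>pairs n. if lk lam i = lk lam j then 1 else Rd (j - i)) * GH n lam)"
proof -
  have dom: "lk lam j \<le> lk lam i" if "i \<in> {1..n}" "j \<in> {1..n}" "i \<le> j" for i j
    using lam that by (simp add: dominant_def)
  let ?A = "SIGMA (i, j) : pairs n. {0..<lk lam i - lk lam j}"
  have inv: "Inv n (transl n lam) = (\<lambda>((i, j), m). (int i, int j + int n * m)) ` ?A"
    by (rule Inv_transl[OF n dom])
  have "ev0_tinv n (c_prod n (transl n lam)) = (\<Prod>x\<in>?A. case x of ((i, j), m) \<Rightarrow> cval m (int (j - i)))"
    unfolding ev0_tinv_eq[OF n]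
  \<comment> \<open>With e = 1 the quotient of Y_j by Y_i takes the value t^(j-i).\<close>
  proof (rule c_prod_value[OF n inv, where e = 1], goal_cases)
    case 1
    show ?case
    proof (rule inj_onI, clarsimp)
      fix i j m j' m'
      assume "(i, j) \<in> pairs n" "(i, j') \<in> pairs n" and eq: "int j + int n * m = int j' + int n * m'"
      then have "j \<in> {1..n}" "j' \<in> {1..n}" by (auto simp: pairs_def)
      then show "j = j' \<and> m = m'" using residue_eq_iff[OF n] eq by blast
    qed
  next
    case 2
    show ?case by simp
  next
    case (3 x)
    then obtain i j m where x: "x = ((i, j), m)" "(i, j) \<in> pairs n" by auto
    then show ?case
      by (intro exI[of _ i] exI[of _ j] exI[of _ m]) (auto simp: pairs_def of_nat_diff)
  qed
  also have "\<dots> = (\<Prod>p\<in>pairs n. \<Prod>m\<in>{0..<lk lam (fst p) - lk lam (snd p)}. cval m (int (snd p - fst p)))"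
    by (subst prod.Sigma) (auto simp: case_prod_unfold finite_pairs)
  also have "\<dots> = (\<Prod>p\<in>pairs n. thalf powi (- (lk lam (fst p) - lk lam (snd p))) *
      ((if lk lam (fst p) = lk lam (snd p) then 1 else Rd (snd p - fst p)) * Hf (lk lam (fst p) - lk lam (snd p) - 1) (int (snd p - fst p))))"
  proof (rule prod.cong[OF refl])
    fix p assume "p \<in> pairs n"
    then have "0 \<le> lk lam (fst p) - lk lam (snd p)" using dom by (auto simp: pairs_def)
    then show "(\<Prod>m\<in>{0..<lk lam (fst p) - lk lam (snd p)}. cval m (int (snd p - fst p)))
      = thalf powi (- (lk lam (fst p) - lk lam (snd p))) *
      ((if lk lam (fst p) = lk lam (snd p) then 1 else Rd (snd p - fst p)) * Hf (lk lam (fst p) - lk lam (snd p) - 1) (int (snd p - fst p)))"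
      by (simp add: prod_cval_from_0)
  qed
  finally show ?thesis
    unfolding prod.distrib prod_thalf_powi[OF n] sum_negf GH_dominant desc_dominant by (simp add: case_prod_unfold)
qed

lemma eval_princ_P:
  "eval_princ (macdonald_P n E lam) = thalf powi ((int n - 1) * wt_sum n lam) * ev0_tinv n (c_prod n (transl n lam))"
proof -
  have "thalf powi ((int n - 1) * wt_sum n lam - desc n lam) = thalf powi ((int n - 1) * wt_sum n lam) * thalf powi (- desc n lam)"
    using power_int_add[of thalf "(int n - 1) * wt_sum n lam" "- desc n lam"] by simp
  then show ?thesis
    unfolding eval_princ_P_aux ev0_tinv_transl Gval_def by (simp only: mult_ac)
qed

end

theorem theorem5p1:
  fixes n :: nat
    and E :: "(nat \<Rightarrow>\<^sub>0 int) \<Rightarrow> ratfun"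
    and \<mu> lam :: "nat \<Rightarrow>\<^sub>0 int"
  assumes "n > 0"
    and "macdonald_E n E"
    and "\<mu> \<in> Zn n"
    and "lam \<in> Zn n"
    and "\<forall>i\<in>{1..<n}. Poly_Mapping.lookup lam i \<ge> Poly_Mapping.lookup lam (i + 1)"
  shows "eval_princ (E \<mu>) =
           thalf powi ((int n - 1) * wt_sum n \<mu>) * thalf powi (- int (len n (inv (vperm n \<mu>)))) *
           ev0_t n (c_prod n (uperm n \<mu>))
       \<and> eval_princ (macdonald_P n E lam) =
           thalf powi ((int n - 1) * wt_sum n lam) * ev0_tinv n (c_prod n (transl n lam))
       \<and> (n \<ge> 2 \<longrightarrow> eval_princ (macdonald_A n E lam) = 0)"
proof -
  have dom: "dominant n lam" by (rule dominantI) (use assms in auto)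
  show ?thesis
    unfolding eval_princ_E[OF assms(1,2,3)] Gval_eq_ev0_t[OF assms(1)] eval_princ_P[OF assms(1,2) dom]
    using eval_princ_A[OF assms(1,2) _ assms(4)] by simp
qed

end
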